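(* Let $X\subset\mathbb{R}^n$ be compact, let $K\in C^\infty(X\times X)$ be a Mercer kernel with reproducing kernel Hilbert space $\mathcal{H}_K$, and let $q>1$. Assume that $f_q\in\mathcal{H}_K$, that $\|f_q\|_\infty\le\frac14$, and that the conditional distributions $\{\rho_x\}_{x\in X}$ have density functions given by $$\frac{d\rho_x}{dy}(y)=\begin{cases}A|y-f_q(x)|^{\varphi}, & \text{if } |y-f_q(x)|\le\frac14,\\ 0, & \text{otherwise},\end{cases}$$ where $\varphi>0$ and $A=2^{2\varphi+1}(\varphi+1)$. Take $\lambda=\epsilon=T^{-\frac{q+\varphi+1}{2(q+\varphi)}}$. Then for any $0<\delta<1$, with confidence $1-\delta$ (i.e. with $\rho^T$-probability at least $1-\delta$ over the sample $\mathbf{z}\in Z^T$), $$\|\pi(f^\epsilon_{\mathbf{z}})-f_q\|_{L^{q+\varphi+1}_{\rho_X}}\le C'\sqrt{\log\frac{3}{\delta}}\;T^{-\frac{1}{2(q+\varphi)}},$$ where $C'$ is a constant independent of $T$ or $\delta$.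
   Context: $Y=\mathbb{R}$, $Z=X\times Y$, and $\rho$ is a Borel probability measure on $Z$ with marginal $\rho_X$ on $X$ and conditional distributions $\rho_x$ on $Y$, $x\in X$. Let $\psi_q(u)=|u|^q$ and $\mathcal{E}(f)=\int_Z\psi_q(y-f(x))\,d\rho$ for measurable $f:X\to Y$. $f_q:X\to Y$ is the minimizer of $\mathcal{E}$ over all measurable functions; $f_q(x)$ minimizes $t\mapsto\int_Y|y-t|^q\,d\rho_x(y)$ for each $x$. A Mercer kernel is a continuous, symmetric, positive semidefinite function $K:X\times X\to\mathbb{R}$; $\mathcal{H}_K$ is the completion of the span of $\{K_x=K(x,\cdot):x\in X\}$ under the inner product with $\langle K_x,K_u\rangle_K=K(x,u)$, and its norm is $\|\cdot\|_K$. For $\epsilon\ge0$ the $\epsilon$-insensitive $q$-norm loss is $\psi_q^\epsilon(u)=(|u|-\epsilon)^q$ if $|u|>\epsilon$ and $\psi_q^\epsilon(u)=0$ if $|u|\le\epsilon$. Given a sample $\mathbf{z}=\{(x_t,y_t)\}_{t=1}^T\in Z^T$ drawn independently according to $\rho$ and $\lambda>0$, $$f^\epsilon_{\mathbf{z}}=\arg\min_{f\in\mathcal{H}_K}\Big\{\frac1T\sum_{t=1}^T\psi_q^\epsilon(f(x_t)-y_t)+\lambda\|f\|_K^2\Big\}.$$ The projection $\pi$ is defined by $\pi(f)(x)=1$ if $f(x)\ge1$, $\pi(f)(x)=f(x)$ if $-1<f(x)<1$, $\pi(f)(x)=-1$ if $f(x)\le-1$. $L^s_{\rho_X}$ is the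 space of functions $g$ with $\|g\|_{L^s_{\rho_X}}=(\int_X|g|^s\,d\rho_X)^{1/s}<\infty$. *)

theory Defs
  imports "HOL-Probability.Probability" "HOL-Library.Poly_Mapping"
begin

(* Functions on X are represented by total functions on the ambient type, of which only the
   values on X matter. *)

fun Ck_on :: "nat \<Rightarrow> ('a::euclidean_space \<Rightarrow> real) \<Rightarrow> 'a set \<Rightarrow> bool" where
  "Ck_on 0 f U \<longleftrightarrow> continuous_on U f"
| "Ck_on (Suc k) f U \<longleftrightarrow>
     f differentiable_on U \<and> (\<forall>b\<in>Basis. Ck_on k (\<lambda>x. frechet_derivative f (at x) b) U)"

(* X has no regularity, so C_infinity on X \<times> X is taken in the usual sense for compact sets:
   restriction of a smooth function on an open neighbourhood. *)
definition smooth_kernel_on :: "'a::euclidean_space set \<Rightarrow> ('a \<Rightarrow> 'a \<Rightarrow> real) \<Rightarrow> bool" where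
  "smooth_kernel_on X K \<longleftrightarrow>
     (\<exists>U G. open U \<and> X \<times> X \<subseteq> U \<and> (\<forall>k. Ck_on k G U) \<and> (\<forall>x\<in>X. \<forall>u\<in>X. G (x, u) = K x u))"


(* The finitely supported c stands for the element sum_x c(x) K_x of the span of the kernel
   sections; kernel_inner is the bilinear form with <K_x, K_u> = K(x,u). *)

definition kernel_comb :: "('a \<Rightarrow> 'a \<Rightarrow> real) \<Rightarrow> ('a \<Rightarrow>\<^sub>0 real) \<Rightarrow> 'a \<Rightarrow> real" where
  "kernel_comb K c u = (\<Sum>x\<in>Poly_Mapping.keys c. Poly_Mapping.lookup c x * K x u)"

definition kernel_inner :: "('a \<Rightarrow> 'a \<Rightarrow> real) \<Rightarrow> ('a \<Rightarrow>\<^sub>0 real) \<Rightarrow> ('a \<Rightarrow>\<^sub>0 real) \<Rightarrow> real" where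
  "kernel_inner K c d =
     (\<Sum>x\<in>Poly_Mapping.keys c. \<Sum>u\<in>Poly_Mapping.keys d.
        Poly_Mapping.lookup c x * Poly_Mapping.lookup d u * K x u)"

definition kernel_norm :: "('a \<Rightarrow> 'a \<Rightarrow> real) \<Rightarrow> ('a \<Rightarrow>\<^sub>0 real) \<Rightarrow> real" where
  "kernel_norm K c = sqrt (kernel_inner K c c)"

definition mercer_kernel :: "'a::topological_space set \<Rightarrow> ('a \<Rightarrow> 'a \<Rightarrow> real) \<Rightarrow> bool" where
  "mercer_kernel X K \<longleftrightarrow>
     continuous_on (X \<times> X) (\<lambda>(x, u). K x u) \<and>
     (\<forall>x\<in>X. \<forall>u\<in>X. K x u = K u x) \<and>
     (\<forall>c. Poly_Mapping.keys c \<subseteq> X \<longrightarrow> kernel_inner K c c \<ge> 0)"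

(* The completion of the span, realised as a space of functions on X: since
   |f(x)| \<le> sqrt (K(x,x)) * norm f on the span, a Cauchy sequence of the span converges
   pointwise on X, and its class in the completion is determined by the pointwise limit. *)

definition rkhs_approx ::
  "'a set \<Rightarrow> ('a \<Rightarrow> 'a \<Rightarrow> real) \<Rightarrow> (nat \<Rightarrow> 'a \<Rightarrow>\<^sub>0 real) \<Rightarrow> ('a \<Rightarrow> real) \<Rightarrow> bool" where
  "rkhs_approx X K c f \<longleftrightarrow>
     (\<forall>n. Poly_Mapping.keys (c n) \<subseteq> X) \<and>
     (\<forall>e>0. \<exists>N. \<forall>m\<ge>N. \<forall>n\<ge>N. kernel_norm K (c m - c n) < e) \<and>
     (\<forall>x\<in>X. (\<lambda>n. kernel_comb K (c n) x) \<longlonglongrightarrow> f x)"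

definition rkhs :: "'a set \<Rightarrow> ('a \<Rightarrow> 'a \<Rightarrow> real) \<Rightarrow> ('a \<Rightarrow> real) set" where
  "rkhs X K = {f. \<exists>c. rkhs_approx X K c f}"

definition rkhs_norm :: "'a set \<Rightarrow> ('a \<Rightarrow> 'a \<Rightarrow> real) \<Rightarrow> ('a \<Rightarrow> real) \<Rightarrow> real" where
  "rkhs_norm X K f =
     (THE r. \<exists>c. rkhs_approx X K c f \<and> (\<lambda>n. kernel_norm K (c n)) \<longlonglongrightarrow> r)"


definition borel_prob_on :: "'a::topological_space set \<Rightarrow> 'a measure \<Rightarrow> bool" where
  "borel_prob_on S M \<longleftrightarrow> prob_space M \<and> sets M = sets (restrict_space borel S)"

definition marginal_X :: "'a::topological_space set \<Rightarrow> ('a \<times> real) measure \<Rightarrow> 'a measure" where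
  "marginal_X X \<rho> = distr \<rho> (restrict_space borel X) fst"

definition conditional_distributions ::
  "'a::topological_space set \<Rightarrow> ('a \<times> real) measure \<Rightarrow> ('a \<Rightarrow> real measure) \<Rightarrow> bool" where
  "conditional_distributions X \<rho> \<kappa> \<longleftrightarrow>
     \<kappa> \<in> marginal_X X \<rho> \<rightarrow>\<^sub>M prob_algebra borel \<and>
     (\<forall>B\<in>sets \<rho>. emeasure \<rho> B = (\<integral>\<^sup>+x. emeasure (\<kappa> x) {y. (x, y) \<in> B} \<partial>marginal_X X \<rho>))"

(* Extended nonnegative integrals, so that a non-integrable loss counts as infinite risk. *)

definition q_risk :: "real \<Rightarrow> ('a \<times> real) measure \<Rightarrow> ('a \<Rightarrow> real) \<Rightarrow> ennreal" where
  "q_risk q \<rho> f = (\<integral>\<^sup>+z. ennreal (\<bar>snd z - f (fst z)\<bar> powr q) \<partial>\<rho>)"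

definition is_q_minimizer ::
  "'a::topological_space set \<Rightarrow> real \<Rightarrow> ('a \<times> real) measure \<Rightarrow> ('a \<Rightarrow> real measure) \<Rightarrow>
   ('a \<Rightarrow> real) \<Rightarrow> bool" where
  "is_q_minimizer X q \<rho> \<kappa> f \<longleftrightarrow>
     is_arg_min (q_risk q \<rho>) (\<lambda>g. g \<in> borel_measurable (restrict_space borel X)) f \<and>
     (\<forall>x\<in>X. is_arg_min (\<lambda>t. \<integral>\<^sup>+y. ennreal (\<bar>y - t\<bar> powr q) \<partial>\<kappa> x) (\<lambda>t. True) (f x))"


definition insensitive_loss :: "real \<Rightarrow> real \<Rightarrow> real \<Rightarrow> real" where
  "insensitive_loss q \<epsilon> u = (if \<bar>u\<bar> > \<epsilon> then (\<bar>u\<bar> - \<epsilon>) powr q else 0)"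

definition regularized_risk ::
  "'a set \<Rightarrow> ('a \<Rightarrow> 'a \<Rightarrow> real) \<Rightarrow> real \<Rightarrow> real \<Rightarrow> real \<Rightarrow> nat \<Rightarrow> (nat \<Rightarrow> 'a \<times> real) \<Rightarrow>
   ('a \<Rightarrow> real) \<Rightarrow> real" where
  "regularized_risk X K q \<epsilon> lam T z f =
     (1 / real T) * (\<Sum>t=1..T. insensitive_loss q \<epsilon> (f (fst (z t)) - snd (z t)))
       + lam * (rkhs_norm X K f)\<^sup>2"

(* For lam > 0 and q > 1 the objective is strictly convex, so the values on X are unique. *)
definition svr_estimator ::
  "'a set \<Rightarrow> ('a \<Rightarrow> 'a \<Rightarrow> real) \<Rightarrow> real \<Rightarrow> real \<Rightarrow> real \<Rightarrow> nat \<Rightarrow> (nat \<Rightarrow> 'a \<times> real) \<Rightarrow>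
   'a \<Rightarrow> real" where
  "svr_estimator X K q \<epsilon> lam T z = arg_min_on (regularized_risk X K q \<epsilon> lam T z) (rkhs X K)"

definition proj_unit :: "('a \<Rightarrow> real) \<Rightarrow> 'a \<Rightarrow> real" where
  "proj_unit f x = (if f x \<ge> 1 then 1 else if f x \<le> -1 then -1 else f x)"

(* For g in L^s(M) only: the Bochner integral of a non-integrable function is 0. *)
definition Ls_norm :: "real \<Rightarrow> 'a measure \<Rightarrow> ('a \<Rightarrow> real) \<Rightarrow> real" where
  "Ls_norm s M g = (\<integral>x. \<bar>g x\<bar> powr s \<partial>M) powr (1 / s)"

end

theory Submission
  imports Defs
begin

text \<open>The rate comes from comparing three quantities of the same order \<open>\<lambda> = \<epsilon> = T powr (-\<alpha>)\<close> with
\<open>\<alpha> = (q + \<phi> + 1) / (2 * (q + \<phi>)) < 1\<close>: the price of regularization, the price of the insensitive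
zone, and the statistical error of a class whose metric entropy grows more slowly than any power of \<open>T\<close>.

Write \<open>F\<close> for the estimator and \<open>\<pi>F\<close> for its projection.  Comparing the regularized risk of \<open>F\<close> with that
of \<open>f\<^sub>q\<close> shows that the empirical mean of the excess loss
\<open>\<xi>\<^sub>g(x, y) = \<bar>y - g x\<bar>\<^sup>q - \<bar>y - f\<^sub>q x\<bar>\<^sup>q\<close> at \<open>g = \<pi>F\<close> is at most a constant times \<open>\<lambda>\<close>
(\<open>estimator_excess_le\<close>).  This part is deterministic, given \<open>\<bar>y\<^sub>t\<bar> \<le> 1/2\<close>, which holds almost surely.

The step from empirical means to expectations is fast because of the noise.  The density
\<open>A \<bar>u\<bar>\<^sup>\<phi>\<close> vanishes at the centre but puts positive mass on \<open>1/8 \<le> \<bar>u\<bar> \<le> 1/4\<close>, where the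
loss is strongly convex.  Hence the expected excess loss dominates the squared \<open>L\<^sup>2\<close> distance to \<open>f\<^sub>q\<close>
(\<open>expectation_excess_ge\<close>).  The excess loss is Lipschitz in \<open>g\<close>, so its second moment is dominated by the same
distance, and therefore by its own mean.  A nonnegative mean that controls the second moment gives the
Chernoff bound \<open>P(\<Sum>\<xi> < T E\<xi> / 2 - u) \<le> exp(-s u)\<close> with \<open>s\<close> independent of \<open>T\<close>
(\<open>iid_lower_tail\<close>): the deviation is of order \<open>1/T\<close> instead of \<open>1/sqrt T\<close>.

To apply it to the random function \<open>F\<close> one takes a union bound over a net.  Since \<open>\<lambda> \<parallel>F\<parallel>\<^sup>2 \<le> 1\<close> and \<open>\<lambda> \<ge> 1/T\<close>, the
estimator lies in the ball of radius \<open>sqrt T\<close>.  For a smooth kernel this ball has, for every \<open>p > 0\<close>, a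
\<open>1/T\<close>-net in the supremum norm with at most \<open>exp (C * T powr p)\<close> elements (\<open>rkhs_ball_net\<close>).  The reason is
that on a cell of diameter \<open>h\<close> the functional of evaluation at a point is, up to an error of order \<open>h powr (m/2)\<close> in the dual norm,
a bounded combination of evaluations at a number of points that depends only on the order \<open>m\<close>: one chooses weights that
reproduce polynomials of degree less than \<open>m\<close> and applies Taylor's formula to the kernel.  So a function of the ball
is determined up to \<open>1/T\<close> by its rounded values at few points.  Taking \<open>p = 1 - \<alpha>\<close> makes the entropy term
\<open>T powr p / T\<close> equal to \<open>\<lambda>\<close>.

Altogether the squared \<open>L\<^sup>2\<close> error is at most a constant times \<open>\<lambda> ln (3/\<delta>)\<close>.  With \<open>s = q + \<phi> + 1 > 2\<close> and
bounded functions, the integral of \<open>\<bar>\<pi>F - f\<^sub>q\<bar>\<^sup>s\<close> has the same bound; its \<open>s\<close>-th root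
gives the exponent \<open>\<alpha>/s = 1/(2 (q + \<phi>))\<close>, and \<open>1/s \<le> 1/2\<close> with \<open>ln (3/\<delta>) \<ge> 1\<close> gives the square root
of the logarithm.

The probability of the error event is meaningful only if the event is measurable.  By strong convexity, near-minimizers
of the regularized risk are close to the minimizer, so the estimator is a pointwise limit of near-minimizers chosen, by
least index, from a countable dense family (\<open>svr_estimator_measurable\<close>).  The same convexity argument yields
existence and uniqueness of the minimizer on \<open>X\<close>.\<close>

section \<open>Semi-inner product on the span of the kernel sections\<close>

definition scale_pm :: "real \<Rightarrow> ('a \<Rightarrow>\<^sub>0 real) \<Rightarrow> ('a \<Rightarrow>\<^sub>0 real)" where
  "scale_pm t c = Poly_Mapping.map ((*) t) c"

lemma lookup_scale_pm [simp]:
  "Poly_Mapping.lookup (scale_pm t c) x = t * Poly_Mapping.lookup c x"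
  by (simp add: scale_pm_def map.rep_eq when_def)

lemma keys_scale_pm: "Poly_Mapping.keys (scale_pm t c) \<subseteq> Poly_Mapping.keys c"
  by (auto simp: in_keys_iff)

lemma kernel_comb_superset:
  assumes "finite S" "Poly_Mapping.keys c \<subseteq> S"
  shows "kernel_comb K c u = (\<Sum>x\<in>S. Poly_Mapping.lookup c x * K x u)"
  unfolding kernel_comb_def
  by (intro sum.mono_neutral_left) (use assms in \<open>auto simp: in_keys_iff\<close>)

lemma kernel_comb_add: "kernel_comb K (c + d) u = kernel_comb K c u + kernel_comb K d u"
proof -
  let ?S = "Poly_Mapping.keys c \<union> Poly_Mapping.keys d"
  have "Poly_Mapping.keys (c + d) \<subseteq> ?S" by (rule keys_add)
  then show ?thesis
    by (simp add: kernel_comb_superset[of ?S] lookup_add algebra_simps sum.distrib)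
qed

lemma kernel_comb_diff: "kernel_comb K (c - d) u = kernel_comb K c u - kernel_comb K d u"
  by (metis add_diff_cancel diff_add_cancel kernel_comb_add)

lemma kernel_comb_scale: "kernel_comb K (scale_pm t c) u = t * kernel_comb K c u"
  by (subst kernel_comb_superset[OF finite_keys keys_scale_pm])
    (simp add: kernel_comb_def sum_distrib_left mult.assoc)

lemma kernel_comb_zero [simp]: "kernel_comb K 0 u = 0"
  by (simp add: kernel_comb_def)

lemma kernel_comb_single: "kernel_comb K (Poly_Mapping.single x a) u = a * K x u"
  by (simp add: kernel_comb_def)

lemma kernel_inner_eq_comb:
  "kernel_inner K c d = (\<Sum>u\<in>Poly_Mapping.keys d. Poly_Mapping.lookup d u * kernel_comb K c u)"
  unfolding kernel_inner_def kernel_comb_def sum_distrib_left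
  by (subst sum.swap) (simp add: mult_ac)

lemma kernel_inner_add_left:
  "kernel_inner K (c + c') d = kernel_inner K c d + kernel_inner K c' d"
  by (simp add: kernel_inner_eq_comb kernel_comb_add distrib_left sum.distrib)

lemma kernel_inner_scale_left: "kernel_inner K (scale_pm t c) d = t * kernel_inner K c d"
  by (simp add: kernel_inner_eq_comb kernel_comb_scale sum_distrib_left mult_ac)

lemma kernel_inner_single_right:
  "kernel_inner K c (Poly_Mapping.single u 1) = kernel_comb K c u"
  by (simp add: kernel_inner_eq_comb)

lemma keys_diff_subset:
  fixes c d :: "'a \<Rightarrow>\<^sub>0 real"
  assumes "Poly_Mapping.keys c \<subseteq> X" "Poly_Mapping.keys d \<subseteq> X"
  shows "Poly_Mapping.keys (c - d) \<subseteq> X"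
  using keys_diff assms by (metis Un_least subset_trans)

lemma keys_add_subset:
  fixes c d :: "'a \<Rightarrow>\<^sub>0 real"
  assumes "Poly_Mapping.keys c \<subseteq> X" "Poly_Mapping.keys d \<subseteq> X"
  shows "Poly_Mapping.keys (c + d) \<subseteq> X"
  using keys_add assms by (metis Un_least subset_trans)

lemma keys_scale_subset:
  assumes "Poly_Mapping.keys c \<subseteq> X"
  shows "Poly_Mapping.keys (scale_pm t c) \<subseteq> X"
  using keys_scale_pm assms by (rule subset_trans)

lemmas keys_closed = keys_diff_subset keys_add_subset keys_scale_subset

locale pd_kernel =
  fixes X :: "'a set" and K :: "'a \<Rightarrow> 'a \<Rightarrow> real"
  assumes kernel_sym: "x \<in> X \<Longrightarrow> u \<in> X \<Longrightarrow> K x u = K u x"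
    and kernel_psd: "Poly_Mapping.keys c \<subseteq> X \<Longrightarrow> kernel_inner K c c \<ge> 0"
begin

abbreviation "combs \<equiv> {c :: 'a \<Rightarrow>\<^sub>0 real. Poly_Mapping.keys c \<subseteq> X}"

lemma inner_sym: "c \<in> combs \<Longrightarrow> d \<in> combs \<Longrightarrow> kernel_inner K c d = kernel_inner K d c"
  unfolding kernel_inner_def
  by (subst sum.swap) (auto intro!: sum.cong simp: kernel_sym subset_iff)

lemma inner_add_right: "c \<in> combs \<Longrightarrow> d \<in> combs \<Longrightarrow> d' \<in> combs \<Longrightarrow>
    kernel_inner K c (d + d') = kernel_inner K c d + kernel_inner K c d'"
  using inner_sym[of c] by (simp add: kernel_inner_add_left keys_closed)

lemma inner_scale_right: "c \<in> combs \<Longrightarrow> d \<in> combs \<Longrightarrow>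
    kernel_inner K c (scale_pm t d) = t * kernel_inner K c d"
  using inner_sym[of c] by (simp add: kernel_inner_scale_left keys_closed)

lemma inner_diff_left: "kernel_inner K (c - c') d = kernel_inner K c d - kernel_inner K c' d"
  by (simp add: kernel_inner_eq_comb kernel_comb_diff right_diff_distrib sum_subtractf)

lemma inner_diff_right: "c \<in> combs \<Longrightarrow> d \<in> combs \<Longrightarrow> d' \<in> combs \<Longrightarrow>
    kernel_inner K c (d - d') = kernel_inner K c d - kernel_inner K c d'"
  using inner_sym[of c] by (simp add: inner_diff_left keys_closed)

lemma norm_sq: "c \<in> combs \<Longrightarrow> (kernel_norm K c)\<^sup>2 = kernel_inner K c c"
  by (simp add: kernel_norm_def kernel_psd)

lemma norm_nonneg [simp]: "c \<in> combs \<Longrightarrow> 0 \<le> kernel_norm K c"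
  by (simp add: kernel_norm_def kernel_psd)

text \<open>The form is only semi-definite, so the case of a null vector needs an argument of its own: there the quadratic
\<open>t \<mapsto> \<langle>c + t d, c + t d\<rangle>\<close> is affine and can be nonnegative only if its slope vanishes.\<close>

lemma inner_cauchy_schwarz:
  assumes c: "c \<in> combs" and d: "d \<in> combs"
  shows "\<bar>kernel_inner K c d\<bar> \<le> kernel_norm K c * kernel_norm K d"
proof -
  have quad: "0 \<le> kernel_inner K c c + 2 * t * kernel_inner K c d + t\<^sup>2 * kernel_inner K d d" for t
  proof -
    have td: "scale_pm t d \<in> combs" using d by (simp add: keys_closed)
    then have "c + scale_pm t d \<in> combs" using c by (simp add: keys_closed)
    then have "0 \<le> kernel_inner K (c + scale_pm t d) (c + scale_pm t d)"
      by (simp add: kernel_psd)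
    also have "\<dots> = kernel_inner K c c + 2 * t * kernel_inner K c d + t\<^sup>2 * kernel_inner K d d"
      using c d td inner_sym[OF c d]
      by (simp add: kernel_inner_add_left inner_add_right kernel_inner_scale_left
          inner_scale_right power2_eq_square algebra_simps)
    finally show ?thesis .
  qed
  let ?a = "kernel_inner K d d" and ?b = "kernel_inner K c d" and ?e = "kernel_inner K c c"
  have a: "?a \<ge> 0" "?e \<ge> 0" using c d kernel_psd by auto
  have "?b\<^sup>2 \<le> ?e * ?a"
  proof (cases "?a = 0")
    case True
    have "?b = 0"
    proof (rule ccontr)
      assume b: "?b \<noteq> 0"
      show False using quad[of "-(?e + 1) / (2 * ?b)"] True b a by (simp add: field_simps)
    qed
    then show ?thesis using True by simp
  next
    case False
    then have "?a > 0" using a by simp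
    then show ?thesis using quad[of "- ?b / ?a"]
      by (simp add: field_simps power2_eq_square)
  qed
  then have "sqrt (?b\<^sup>2) \<le> sqrt (?e * ?a)" by (rule real_sqrt_le_mono)
  then show ?thesis by (simp add: kernel_norm_def real_sqrt_mult)
qed

lemma norm_triangle:
  assumes c: "c \<in> combs" and d: "d \<in> combs"
  shows "kernel_norm K (c + d) \<le> kernel_norm K c + kernel_norm K d"
proof (rule power2_le_imp_le)
  have cd: "c + d \<in> combs" using c d by (simp add: keys_closed)
  have "(kernel_norm K (c + d))\<^sup>2 = kernel_inner K c c + 2 * kernel_inner K c d + kernel_inner K d d"
    using c d cd inner_sym[OF c d] by (simp add: norm_sq kernel_inner_add_left inner_add_right)
  also have "\<dots> \<le> (kernel_norm K c + kernel_norm K d)\<^sup>2"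
    using inner_cauchy_schwarz[OF c d] c d by (simp add: power2_sum norm_sq)
  finally show "(kernel_norm K (c + d))\<^sup>2 \<le> (kernel_norm K c + kernel_norm K d)\<^sup>2" .
qed (use c d in simp)

lemma norm_diff_swap: "c \<in> combs \<Longrightarrow> d \<in> combs \<Longrightarrow> kernel_norm K (c - d) = kernel_norm K (d - c)"
  by (simp add: kernel_norm_def inner_diff_left inner_diff_right keys_closed)

lemma norm_triangle_rev:
  assumes c: "c \<in> combs" and d: "d \<in> combs"
  shows "\<bar>kernel_norm K c - kernel_norm K d\<bar> \<le> kernel_norm K (c - d)"
proof -
  have m: "c - d \<in> combs" "d - c \<in> combs" using c d by (simp_all add: keys_closed)
  have "kernel_norm K (d + (c - d)) \<le> kernel_norm K d + kernel_norm K (c - d)"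
    "kernel_norm K (c + (d - c)) \<le> kernel_norm K c + kernel_norm K (d - c)"
    using norm_triangle c d m by blast+
  then show ?thesis using norm_diff_swap[OF c d] by simp
qed

lemma norm_parallelogram:
  assumes c: "c \<in> combs" and d: "d \<in> combs"
  shows "(kernel_norm K (scale_pm (1/2) (c + d)))\<^sup>2 =
    ((kernel_norm K c)\<^sup>2 + (kernel_norm K d)\<^sup>2) / 2 - (kernel_norm K (c - d))\<^sup>2 / 4"
proof -
  have m: "c - d \<in> combs" "c + d \<in> combs" "scale_pm (1/2) (c + d) \<in> combs"
    using c d by (simp_all add: keys_closed)
  show ?thesis using c d m inner_sym[OF c d]
    by (simp add: norm_sq inner_diff_left inner_diff_right kernel_inner_add_left inner_add_right
        kernel_inner_scale_left inner_scale_right field_simps)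
qed

lemma comb_bound:
  assumes c: "c \<in> combs" and x: "x \<in> X"
  shows "\<bar>kernel_comb K c x\<bar> \<le> kernel_norm K c * sqrt (K x x)"
proof -
  have "Poly_Mapping.single x 1 \<in> combs" using x by simp
  from inner_cauchy_schwarz[OF c this] show ?thesis
    by (simp add: kernel_inner_single_right kernel_norm_def kernel_comb_single)
qed

lemma kernel_diag_nonneg: "x \<in> X \<Longrightarrow> 0 \<le> K x x"
  using kernel_psd[of "Poly_Mapping.single x 1"]
  by (simp add: kernel_inner_single_right kernel_comb_single)

lemma comb_tendsto_if_norm_tendsto_0:
  assumes c: "\<And>n. c n \<in> combs" and d: "\<And>n. d n \<in> combs" and x: "x \<in> X"
    and lim: "(\<lambda>n. kernel_norm K (c n - d n)) \<longlonglongrightarrow> 0"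
  shows "(\<lambda>n. kernel_comb K (c n) x - kernel_comb K (d n) x) \<longlonglongrightarrow> 0"
proof (rule Lim_null_comparison)
  have "c n - d n \<in> combs" for n using c d by (simp add: keys_closed)
  then show "\<forall>\<^sub>F n in sequentially. norm (kernel_comb K (c n) x - kernel_comb K (d n) x)
      \<le> kernel_norm K (c n - d n) * sqrt (K x x)"
    using comb_bound[OF _ x] by (simp flip: kernel_comb_diff)
  show "(\<lambda>n. kernel_norm K (c n - d n) * sqrt (K x x)) \<longlonglongrightarrow> 0"
    using tendsto_mult_right[OF lim, of "sqrt (K x x)"] by simp
qed

lemma rkhs_approxD:
  assumes "rkhs_approx X K c f"
  shows "c n \<in> combs" "x \<in> X \<Longrightarrow> (\<lambda>n. kernel_comb K (c n) x) \<longlonglongrightarrow> f x"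
    "e > 0 \<Longrightarrow> \<exists>N. \<forall>m\<ge>N. \<forall>n\<ge>N. kernel_norm K (c m - c n) < e"
  using assms by (auto simp: rkhs_approx_def)

text \<open>The inner product of \<open>e n\<close> with a fixed member \<open>e m\<close> is a finite combination of point values of \<open>e n\<close> and
so tends to zero, while the Cauchy property makes \<open>e n\<close> close to \<open>e m\<close> for late \<open>m\<close>.  Together they bound
\<open>\<langle>e n, e n\<rangle>\<close>.  This is what makes the norm of a function independent of its approximating sequence.\<close>

lemma norm_tendsto_0_if_pointwise_0:
  assumes e: "\<And>n. e n \<in> combs"
    and cauchy: "\<And>r. r > 0 \<Longrightarrow> \<exists>N. \<forall>m\<ge>N. \<forall>n\<ge>N. kernel_norm K (e m - e n) < r"
    and lim: "\<And>x. x \<in> X \<Longrightarrow> (\<lambda>n. kernel_comb K (e n) x) \<longlonglongrightarrow> 0"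
  shows "(\<lambda>n. kernel_norm K (e n)) \<longlonglongrightarrow> 0"
proof (rule LIMSEQ_I)
  fix r :: real assume r: "r > 0"
  obtain N0 where N0: "\<forall>m\<ge>N0. \<forall>n\<ge>N0. kernel_norm K (e m - e n) < 1" using cauchy[of 1] by auto
  define B where "B = kernel_norm K (e N0) + 1"
  have B: "kernel_norm K (e n) \<le> B" "B > 0" if "n \<ge> N0" for n
    using N0 that norm_triangle_rev[OF e e, of n N0] norm_nonneg[OF e, of N0]
    unfolding B_def by (smt (verit) order_refl)+
  \<comment> \<open>With this \<open>s\<close> the part \<open>\<langle>e n, e n - e m\<rangle>\<close> is at most \<open>B * s = r\<^sup>2 / 2\<close>.\<close>
  define s where "s = r\<^sup>2 / (2 * B)"
  have s: "s > 0" using r B(2)[OF order_refl] by (simp add: s_def)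
  obtain N1 where N1: "\<forall>m\<ge>N1. \<forall>n\<ge>N1. kernel_norm K (e m - e n) < s" using cauchy[OF s] by auto
  define m where "m = max N0 N1"
  have "(\<lambda>n. \<Sum>u\<in>Poly_Mapping.keys (e m). Poly_Mapping.lookup (e m) u * kernel_comb K (e n) u)
      \<longlonglongrightarrow> (\<Sum>u\<in>Poly_Mapping.keys (e m). Poly_Mapping.lookup (e m) u * 0)"
    using e[of m] by (intro tendsto_sum tendsto_mult tendsto_const lim) auto
  then have "(\<lambda>n. kernel_inner K (e n) (e m)) \<longlonglongrightarrow> 0"
    by (simp add: kernel_inner_eq_comb)
  then obtain N2 where N2: "\<forall>n\<ge>N2. \<bar>kernel_inner K (e n) (e m)\<bar> < r\<^sup>2 / 2"
    using r unfolding LIMSEQ_iff by (metis diff_zero half_gt_zero real_norm_def zero_less_power)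
  show "\<exists>no. \<forall>n\<ge>no. norm (kernel_norm K (e n) - 0) < r"
  proof (intro exI allI impI)
    fix n assume n: "n \<ge> max m N2"
    have d: "e n - e m \<in> combs" using e by (simp add: keys_closed)
    have "(kernel_norm K (e n))\<^sup>2 = kernel_inner K (e n) (e n - e m) + kernel_inner K (e n) (e m)"
      using e[of n] e[of m] d by (simp add: norm_sq inner_diff_right)
    also have "kernel_inner K (e n) (e n - e m) \<le> kernel_norm K (e n) * kernel_norm K (e n - e m)"
      using inner_cauchy_schwarz[OF e d] by (meson abs_ge_self order_trans)
    also have "\<dots> \<le> B * s"
      using B[of n] N1 n norm_nonneg[OF d] norm_nonneg[OF e] unfolding m_def
      by (intro mult_mono) (auto simp: less_imp_le)
    also have "B * s = r\<^sup>2 / 2" using B(2)[OF order_refl] by (simp add: s_def)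
    finally have "(kernel_norm K (e n))\<^sup>2 < r\<^sup>2" using N2 n by (smt (verit) field_sum_of_halves max.boundedE)
    then show "norm (kernel_norm K (e n) - 0) < r"
      using r norm_nonneg[OF e] by (simp add: power_less_imp_less_base)
  qed
qed

lemma rkhs_approx_unique:
  assumes c: "rkhs_approx X K c f" and d: "rkhs_approx X K d f"
  shows "(\<lambda>n. kernel_norm K (c n - d n)) \<longlonglongrightarrow> 0"
proof (rule norm_tendsto_0_if_pointwise_0)
  note C = rkhs_approxD[OF c] and D = rkhs_approxD[OF d]
  show "c n - d n \<in> combs" for n using C(1) D(1) by (simp add: keys_closed)
  show "(\<lambda>n. kernel_comb K (c n - d n) x) \<longlonglongrightarrow> 0" if "x \<in> X" for x
    using tendsto_diff[OF C(2)[OF that] D(2)[OF that]] by (simp add: kernel_comb_diff)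
  fix r :: real assume "r > 0"
  then have "r/2 > 0" by simp
  obtain N1 where N1: "\<forall>m\<ge>N1. \<forall>n\<ge>N1. kernel_norm K (c m - c n) < r/2" using C(3) \<open>r/2 > 0\<close> by blast
  obtain N2 where N2: "\<forall>m\<ge>N2. \<forall>n\<ge>N2. kernel_norm K (d m - d n) < r/2" using D(3) \<open>r/2 > 0\<close> by blast
  show "\<exists>N. \<forall>m\<ge>N. \<forall>n\<ge>N. kernel_norm K ((c m - d m) - (c n - d n)) < r"
  proof (intro exI allI impI)
    fix m n assume mn: "m \<ge> max N1 N2" "n \<ge> max N1 N2"
    have "kernel_norm K ((c m - d m) - (c n - d n)) = kernel_norm K ((c m - c n) + (d n - d m))"
      by (simp add: algebra_simps)
    also have "\<dots> \<le> kernel_norm K (c m - c n) + kernel_norm K (d n - d m)"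
      using C(1) D(1) by (intro norm_triangle) (simp_all add: keys_closed)
    also have "\<dots> < r/2 + r/2" using N1 N2 mn by (intro add_strict_mono) auto
    finally show "kernel_norm K ((c m - d m) - (c n - d n)) < r" by simp
  qed
qed

lemma rkhs_norm_limit:
  assumes c: "rkhs_approx X K c f"
  shows "(\<lambda>n. kernel_norm K (c n)) \<longlonglongrightarrow> rkhs_norm X K f"
proof -
  note C = rkhs_approxD[OF c]
  have "Cauchy (\<lambda>n. kernel_norm K (c n))"
    unfolding Cauchy_def dist_real_def using C(3) norm_triangle_rev[OF C(1) C(1)]
    by (meson le_less_trans)
  then obtain r where r: "(\<lambda>n. kernel_norm K (c n)) \<longlonglongrightarrow> r"
    using Cauchy_convergent convergent_def by blast
  have "rkhs_norm X K f = r" unfolding rkhs_norm_def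
  proof (rule the_equality)
    show "\<exists>c. rkhs_approx X K c f \<and> (\<lambda>n. kernel_norm K (c n)) \<longlonglongrightarrow> r" using c r by blast
    fix r' assume "\<exists>c. rkhs_approx X K c f \<and> (\<lambda>n. kernel_norm K (c n)) \<longlonglongrightarrow> r'"
    then obtain d where d: "rkhs_approx X K d f" and r': "(\<lambda>n. kernel_norm K (d n)) \<longlonglongrightarrow> r'" by blast
    have "(\<lambda>n. kernel_norm K (c n) - kernel_norm K (d n)) \<longlonglongrightarrow> 0"
      by (rule Lim_null_comparison[OF _ rkhs_approx_unique[OF c d]])
        (use norm_triangle_rev[OF C(1) rkhs_approxD(1)[OF d]] in simp)
    moreover have "(\<lambda>n. kernel_norm K (c n) - kernel_norm K (d n)) \<longlonglongrightarrow> r - r'"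
      using r r' by (rule tendsto_diff)
    ultimately show "r' = r" using LIMSEQ_unique by fastforce
  qed
  then show ?thesis using r by simp
qed

lemma rkhs_norm_nonneg:
  assumes "f \<in> rkhs X K" shows "0 \<le> rkhs_norm X K f"
proof -
  obtain c where c: "rkhs_approx X K c f" using assms by (auto simp: rkhs_def)
  show ?thesis
    by (rule LIMSEQ_le_const[OF rkhs_norm_limit[OF c]]) (use rkhs_approxD(1)[OF c] in auto)
qed

lemma rkhs_approx_const:
  assumes "c \<in> combs" shows "rkhs_approx X K (\<lambda>_. c) (kernel_comb K c)"
  using assms by (auto simp: rkhs_approx_def kernel_norm_def kernel_inner_def)

lemma comb_in_rkhs: "c \<in> combs \<Longrightarrow> kernel_comb K c \<in> rkhs X K"
  using rkhs_approx_const by (auto simp: rkhs_def)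

lemma rkhs_norm_comb: "c \<in> combs \<Longrightarrow> rkhs_norm X K (kernel_comb K c) = kernel_norm K c"
  using rkhs_norm_limit[OF rkhs_approx_const] LIMSEQ_unique tendsto_const by blast

end

section \<open>Regularized risk minimization\<close>

lemma tendsto_if_within_inverse_Suc:
  fixes f :: "nat \<Rightarrow> real"
  assumes "\<And>n. \<bar>f n - m\<bar> \<le> 1 / real (Suc n)"
  shows "f \<longlonglongrightarrow> m"
proof -
  have "(\<lambda>n. f n - m) \<longlonglongrightarrow> 0"
    by (rule Lim_null_comparison[OF _ LIMSEQ_inverse_real_of_nat])
      (use assms in \<open>simp add: inverse_eq_divide\<close>)
  then show ?thesis by (rule LIM_zero_cancel)
qed

text \<open>Existence and uniqueness of the minimizer rest on three properties of the data term \<open>L\<close>: it is bounded below,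
convex along midpoints, and continuous under pointwise convergence on \<open>X\<close>.\<close>

locale regularized_problem = pd_kernel X K for X :: "'a set" and K :: "'a \<Rightarrow> 'a \<Rightarrow> real" +
  fixes L :: "('a \<Rightarrow> real) \<Rightarrow> real" and lam :: real
  assumes lam_pos: "lam > 0"
    and L_nonneg: "\<And>f. L f \<ge> 0"
    and L_midpoint: "\<And>f g. L (\<lambda>x. (f x + g x) / 2) \<le> (L f + L g) / 2"
    and L_cont: "\<And>f g. (\<And>x. x \<in> X \<Longrightarrow> (\<lambda>n. f n x) \<longlonglongrightarrow> g x) \<Longrightarrow> (\<lambda>n::nat. L (f n)) \<longlonglongrightarrow> L g"
begin

definition risk :: "('a \<Rightarrow> real) \<Rightarrow> real" where
  "risk f = L f + lam * (rkhs_norm X K f)\<^sup>2"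

text \<open>The infimum is taken over the span, not over its completion: a minimizing sequence in the span is itself an
approximating sequence of the kind that defines the completion.\<close>

definition min_risk :: real where
  "min_risk = (INF c\<in>combs. risk (kernel_comb K c))"

lemma risk_comb: "c \<in> combs \<Longrightarrow> risk (kernel_comb K c) = L (kernel_comb K c) + lam * (kernel_norm K c)\<^sup>2"
  by (simp add: risk_def rkhs_norm_comb)

lemma risk_nonneg: "0 \<le> risk f"
  using L_nonneg[of f] lam_pos by (simp add: risk_def)

lemma min_risk_le: "c \<in> combs \<Longrightarrow> min_risk \<le> risk (kernel_comb K c)"
  unfolding min_risk_def by (intro cINF_lower bdd_belowI2[where m = 0]) (auto simp: risk_nonneg)

lemma risk_approx_limit:
  assumes c: "rkhs_approx X K c f"
  shows "(\<lambda>n. risk (kernel_comb K (c n))) \<longlonglongrightarrow> risk f"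
proof -
  have "(\<lambda>n. L (kernel_comb K (c n)) + lam * (kernel_norm K (c n))\<^sup>2)
      \<longlonglongrightarrow> L f + lam * (rkhs_norm X K f)\<^sup>2"
    by (intro tendsto_intros L_cont rkhs_approxD(2)[OF c] rkhs_norm_limit[OF c])
  then show ?thesis using rkhs_approxD(1)[OF c] by (simp add: risk_comb) (simp add: risk_def)
qed

lemma min_risk_le_risk:
  assumes "f \<in> rkhs X K" shows "min_risk \<le> risk f"
proof -
  obtain c where c: "rkhs_approx X K c f" using assms by (auto simp: rkhs_def)
  show ?thesis
    by (rule LIMSEQ_le_const[OF risk_approx_limit[OF c]])
      (use min_risk_le rkhs_approxD(1)[OF c] in blast)
qed

text \<open>The midpoint of \<open>c\<close> and \<open>d\<close> has risk at least the infimum.  By the parallelogram law its penalty falls short of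
the mean penalty by a multiple of the squared distance, so this distance is paid for by the two excess risks.\<close>

lemma near_minimizers_close:
  assumes c: "c \<in> combs" and d: "d \<in> combs"
  shows "(kernel_norm K (c - d))\<^sup>2 \<le>
    2 / lam * ((risk (kernel_comb K c) - min_risk) + (risk (kernel_comb K d) - min_risk))"
proof -
  have m: "scale_pm (1/2) (c + d) \<in> combs" using c d by (simp add: keys_closed)
  have mid: "kernel_comb K (scale_pm (1/2) (c + d)) =
      (\<lambda>x. (kernel_comb K c x + kernel_comb K d x) / 2)"
    by (simp add: fun_eq_iff kernel_comb_scale kernel_comb_add)
  have "min_risk \<le> risk (kernel_comb K (scale_pm (1/2) (c + d)))" by (rule min_risk_le[OF m])
  also have "\<dots> = L (\<lambda>x. (kernel_comb K c x + kernel_comb K d x) / 2) +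
      lam * (((kernel_norm K c)\<^sup>2 + (kernel_norm K d)\<^sup>2) / 2 - (kernel_norm K (c - d))\<^sup>2 / 4)"
    by (subst risk_comb[OF m]) (simp only: norm_parallelogram[OF c d] mid)
  also have "\<dots> \<le> (risk (kernel_comb K c) + risk (kernel_comb K d)) / 2
      - lam * (kernel_norm K (c - d))\<^sup>2 / 4"
    using L_midpoint[of "kernel_comb K c" "kernel_comb K d"]
    by (simp add: risk_comb[OF c] risk_comb[OF d] field_simps)
  finally show ?thesis using lam_pos by (simp add: field_simps)
qed

lemma minimizing_sequences_close:
  assumes c: "\<And>n. c n \<in> combs" and d: "\<And>n. d n \<in> combs"
    and lc: "(\<lambda>n. risk (kernel_comb K (c n))) \<longlonglongrightarrow> min_risk"
    and ld: "(\<lambda>n. risk (kernel_comb K (d n))) \<longlonglongrightarrow> min_risk"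
  shows "(\<lambda>n. kernel_norm K (c n - d n)) \<longlonglongrightarrow> 0"
proof -
  have "(\<lambda>n. 2 / lam * ((risk (kernel_comb K (c n)) - min_risk) + (risk (kernel_comb K (d n)) - min_risk)))
      \<longlonglongrightarrow> 2 / lam * ((min_risk - min_risk) + (min_risk - min_risk))"
    by (intro tendsto_intros lc ld)
  then have "(\<lambda>n. (kernel_norm K (c n - d n))\<^sup>2) \<longlonglongrightarrow> 0"
    by (intro Lim_null_comparison[of "\<lambda>n. (kernel_norm K (c n - d n))\<^sup>2"])
      (use near_minimizers_close[OF c d] in auto)
  then have "(\<lambda>n. sqrt ((kernel_norm K (c n - d n))\<^sup>2)) \<longlonglongrightarrow> sqrt 0" by (rule tendsto_real_sqrt)
  moreover have "sqrt ((kernel_norm K (c n - d n))\<^sup>2) = kernel_norm K (c n - d n)" for n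
    using c d by (simp add: keys_closed)
  ultimately show ?thesis by simp
qed

text \<open>Near-minimizers are close, so the sequence is Cauchy in norm; point evaluations are bounded, so it converges
pointwise; the only completeness involved is that of the real numbers.\<close>

lemma minimizing_sequence_limit:
  assumes c: "\<And>n. c n \<in> combs" and lc: "(\<lambda>n. risk (kernel_comb K (c n))) \<longlonglongrightarrow> min_risk"
  shows "\<exists>f. rkhs_approx X K c f"
proof -
  have cauchy: "\<exists>N. \<forall>m\<ge>N. \<forall>n\<ge>N. kernel_norm K (c m - c n) < e" if e: "e > 0" for e
  proof -
    have "lam * e\<^sup>2 / 4 > 0" using e lam_pos by simp
    then obtain N where N: "\<forall>n\<ge>N. \<bar>risk (kernel_comb K (c n)) - min_risk\<bar> < lam * e\<^sup>2 / 4"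
      using lc unfolding LIMSEQ_iff real_norm_def by blast
    show ?thesis
    proof (intro exI allI impI)
      fix m n assume mn: "m \<ge> N" "n \<ge> N"
      have "(kernel_norm K (c m - c n))\<^sup>2 \<le>
          2 / lam * ((risk (kernel_comb K (c m)) - min_risk) + (risk (kernel_comb K (c n)) - min_risk))"
        by (rule near_minimizers_close[OF c c])
      also have "\<dots> < 2 / lam * (lam * e\<^sup>2 / 4 + lam * e\<^sup>2 / 4)"
        using N[rule_format, OF mn(1)] N[rule_format, OF mn(2)] lam_pos
        by (intro mult_strict_left_mono add_strict_mono divide_pos_pos) linarith+
      also have "\<dots> = e\<^sup>2" using lam_pos by simp
      finally show "kernel_norm K (c m - c n) < e" using e by (simp add: power_less_imp_less_base)
    qed
  qed
  have "convergent (\<lambda>n. kernel_comb K (c n) x)" if x: "x \<in> X" for x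
  proof (rule Cauchy_convergent, rule CauchyI)
    fix e :: real assume e: "e > 0"
    have pos: "e / (sqrt (K x x) + 1) > 0"
      using e kernel_diag_nonneg[OF x] by (intro divide_pos_pos add_nonneg_pos) auto
    obtain N where N: "\<forall>m\<ge>N. \<forall>n\<ge>N. kernel_norm K (c m - c n) < e / (sqrt (K x x) + 1)"
      using cauchy[OF pos] by auto
    show "\<exists>M. \<forall>m\<ge>M. \<forall>n\<ge>M. norm (kernel_comb K (c m) x - kernel_comb K (c n) x) < e"
    proof (intro exI allI impI)
      fix m n assume mn: "m \<ge> N" "n \<ge> N"
      have d: "c m - c n \<in> combs" using c by (simp add: keys_closed)
      have "norm (kernel_comb K (c m) x - kernel_comb K (c n) x) \<le> kernel_norm K (c m - c n) * sqrt (K x x)"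
        using comb_bound[OF d x] by (simp add: kernel_comb_diff)
      also have "\<dots> \<le> kernel_norm K (c m - c n) * (sqrt (K x x) + 1)"
        using norm_nonneg[OF d] by (intro mult_left_mono) auto
      also have "\<dots> < e" using N mn kernel_diag_nonneg[OF x]
        by (metis add_nonneg_pos pos_less_divide_eq real_sqrt_ge_zero zero_less_one)
      finally show "norm (kernel_comb K (c m) x - kernel_comb K (c n) x) < e" .
    qed
  qed
  then have "rkhs_approx X K c (\<lambda>x. lim (\<lambda>n. kernel_comb K (c n) x))"
    using c cauchy by (auto simp: rkhs_approx_def convergent_LIMSEQ_iff)
  then show ?thesis by blast
qed

lemma minimizing_sequence_exists:
  obtains c where "\<And>n. c n \<in> combs" "(\<lambda>n. risk (kernel_comb K (c n))) \<longlonglongrightarrow> min_risk"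
proof -
  have "\<exists>c. c \<in> combs \<and> risk (kernel_comb K c) < min_risk + 1 / real (Suc n)" for n
  proof -
    have "(INF c\<in>combs. risk (kernel_comb K c)) < min_risk + 1 / real (Suc n)"
      by (simp add: min_risk_def)
    moreover have "combs \<noteq> {}" using keys_zero by (metis (mono_tags) empty_iff empty_subsetI mem_Collect_eq)
    ultimately show ?thesis by (subst (asm) cINF_less_iff) (auto intro!: bdd_belowI2[where m = 0] simp: risk_nonneg)
  qed
  then obtain c where c: "\<And>n. c n \<in> combs \<and> risk (kernel_comb K (c n)) < min_risk + 1 / real (Suc n)"
    by metis
  have "(\<lambda>n. risk (kernel_comb K (c n))) \<longlonglongrightarrow> min_risk"
  proof (rule tendsto_if_within_inverse_Suc)
    fix n
    have "min_risk \<le> risk (kernel_comb K (c n))" "risk (kernel_comb K (c n)) < min_risk + 1 / real (Suc n)"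
      using c min_risk_le by auto
    then show "\<bar>risk (kernel_comb K (c n)) - min_risk\<bar> \<le> 1 / real (Suc n)" by linarith
  qed
  with c show ?thesis using that by blast
qed

lemma minimizer_properties:
  defines "F \<equiv> arg_min_on risk (rkhs X K)"
  shows "F \<in> rkhs X K" "risk F = min_risk" "g \<in> rkhs X K \<Longrightarrow> risk F \<le> risk g"
proof -
  obtain c where c: "\<And>n. c n \<in> combs" "(\<lambda>n. risk (kernel_comb K (c n))) \<longlonglongrightarrow> min_risk"
    using minimizing_sequence_exists by blast
  obtain f where f: "rkhs_approx X K c f" using minimizing_sequence_limit[OF c] by blast
  have "risk f = min_risk" using risk_approx_limit[OF f] c(2) LIMSEQ_unique by blast
  moreover have "f \<in> rkhs X K" using f by (auto simp: rkhs_def)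
  ultimately have "is_arg_min risk (\<lambda>g. g \<in> rkhs X K) f"
    using min_risk_le_risk by (auto simp: is_arg_min_def not_less)
  then have F: "is_arg_min risk (\<lambda>g. g \<in> rkhs X K) F"
    unfolding F_def arg_min_on_def arg_min_def by (rule someI[of "is_arg_min risk (\<lambda>g. g \<in> rkhs X K)"])
  then show FH: "F \<in> rkhs X K" by (simp add: is_arg_min_def)
  have le: "risk F \<le> risk g" if "g \<in> rkhs X K" for g
    using F that by (auto simp: is_arg_min_def not_less)
  then show "g \<in> rkhs X K \<Longrightarrow> risk F \<le> risk g" .
  show "risk F = min_risk"
    using le[OF \<open>f \<in> rkhs X K\<close>] \<open>risk f = min_risk\<close> min_risk_le_risk[OF FH] by simp
qed

text \<open>Applied to an arbitrary minimizer, this shows that any two minimizers agree on \<open>X\<close>; applied to near-minimizers that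
depend measurably on the data, it gives measurability of the minimizer.\<close>

lemma minimizing_sequence_tendsto_minimizer:
  assumes c: "\<And>n. c n \<in> combs" "(\<lambda>n. risk (kernel_comb K (c n))) \<longlonglongrightarrow> min_risk" and x: "x \<in> X"
  shows "(\<lambda>n. kernel_comb K (c n) x) \<longlonglongrightarrow> arg_min_on risk (rkhs X K) x"
proof -
  let ?F = "arg_min_on risk (rkhs X K)"
  obtain d where d: "rkhs_approx X K d ?F" using minimizer_properties(1) by (auto simp: rkhs_def)
  have "(\<lambda>n. risk (kernel_comb K (d n))) \<longlonglongrightarrow> min_risk"
    using risk_approx_limit[OF d] by (simp add: minimizer_properties(2))
  note minimizing_sequences_close[OF c(1) rkhs_approxD(1)[OF d] c(2) this]
  note comb_tendsto_if_norm_tendsto_0[OF c(1) rkhs_approxD(1)[OF d] x this]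
  from tendsto_add[OF this rkhs_approxD(2)[OF d x]] show ?thesis by simp
qed

end

section \<open>The insensitive loss\<close>

text \<open>The insensitive zone produces the boundary point \<open>0\<close>, where the convexity of the power on the open half-line is
replaced by a direct estimate.\<close>

lemma midpoint_powr_le:
  fixes a b p :: real
  assumes "0 \<le> a" "0 \<le> b" "1 \<le> p"
  shows "((a + b) / 2) powr p \<le> (a powr p + b powr p) / 2"
proof -
  have half: "(c / 2) powr p \<le> c powr p / 2" if "0 \<le> c" for c :: real
  proof -
    have "2 powr 1 \<le> 2 powr p" using assms by (intro powr_mono) auto
    then have "c powr p / 2 powr p \<le> c powr p / 2"
      by (intro divide_left_mono) auto
    then show ?thesis using that by (simp add: powr_divide)
  qed
  consider "a = 0" | "b = 0" | "0 < a \<and> 0 < b" using assms by linarith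
  then show ?thesis
  proof cases
    case 3
    then show ?thesis
      using convex_onD[OF powr_convex[OF \<open>1 \<le> p\<close>], of "1/2" a b]
      by (simp add: field_simps)
  qed (use half assms in auto)
qed

lemma insensitive_loss_eq: "insensitive_loss q \<epsilon> u = (max 0 (\<bar>u\<bar> - \<epsilon>)) powr q"
  by (auto simp: insensitive_loss_def max_def)

lemma insensitive_loss_nonneg: "0 \<le> insensitive_loss q \<epsilon> u"
  by (simp add: insensitive_loss_eq)

lemma insensitive_loss_mono:
  assumes "\<bar>u\<bar> \<le> \<bar>v\<bar>" "0 \<le> q" shows "insensitive_loss q \<epsilon> u \<le> insensitive_loss q \<epsilon> v"
  unfolding insensitive_loss_eq using assms by (intro powr_mono2) auto

lemma insensitive_loss_midpoint:
  assumes "1 \<le> q"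
  shows "insensitive_loss q \<epsilon> ((u + v) / 2) \<le> (insensitive_loss q \<epsilon> u + insensitive_loss q \<epsilon> v) / 2"
proof -
  have aux: "max 0 (w - \<epsilon>) \<le> (A + B) / 2"
    if "w \<le> (a + b) / 2" "a - \<epsilon> \<le> A" "b - \<epsilon> \<le> B" "0 \<le> A" "0 \<le> B" for w a b A B :: real
    using that by (simp add: max_def)
  have "\<bar>(u + v) / 2\<bar> \<le> (\<bar>u\<bar> + \<bar>v\<bar>) / 2" by simp
  then have "max 0 (\<bar>(u + v) / 2\<bar> - \<epsilon>) \<le> (max 0 (\<bar>u\<bar> - \<epsilon>) + max 0 (\<bar>v\<bar> - \<epsilon>)) / 2"
    by (intro aux) auto
  then have "insensitive_loss q \<epsilon> ((u + v) / 2) \<le>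
      ((max 0 (\<bar>u\<bar> - \<epsilon>) + max 0 (\<bar>v\<bar> - \<epsilon>)) / 2) powr q"
    unfolding insensitive_loss_eq using assms by (intro powr_mono2) auto
  also have "\<dots> \<le> (insensitive_loss q \<epsilon> u + insensitive_loss q \<epsilon> v) / 2"
    unfolding insensitive_loss_eq using assms by (intro midpoint_powr_le) auto
  finally show ?thesis .
qed

lemma tendsto_insensitive_loss:
  assumes "0 < q" "(f \<longlongrightarrow> l) F"
  shows "((\<lambda>x. insensitive_loss q \<epsilon> (f x)) \<longlongrightarrow> insensitive_loss q \<epsilon> l) F"
  unfolding insensitive_loss_eq using assms by (intro tendsto_powr2 tendsto_intros) auto

lemma measurable_insensitive_loss [measurable]: "insensitive_loss q \<epsilon> \<in> borel_measurable borel"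
  unfolding insensitive_loss_eq[abs_def] by measurable

definition empirical_risk where
  "empirical_risk q \<epsilon> T z f = (1 / real T) * (\<Sum>t=1..T. insensitive_loss q \<epsilon> (f (fst (z t)) - snd (z t)))"

lemma mercer_imp_pd_kernel: "mercer_kernel X K \<Longrightarrow> pd_kernel X K"
  by (simp add: mercer_kernel_def pd_kernel_def)

lemma regularized_problem_empirical:
  assumes "mercer_kernel X K" "0 < lam" "1 < q" "\<And>t. t \<in> {1..T} \<Longrightarrow> fst (z t) \<in> X"
  shows "regularized_problem X K (empirical_risk q \<epsilon> T z) lam"
    and "regularized_problem.risk X K (empirical_risk q \<epsilon> T z) lam = regularized_risk X K q \<epsilon> lam T z"
proof -
  interpret pd_kernel X K using assms(1) by (rule mercer_imp_pd_kernel)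
  show 1: "regularized_problem X K (empirical_risk q \<epsilon> T z) lam"
  proof unfold_locales
    fix f g :: "'a \<Rightarrow> real"
    have "insensitive_loss q \<epsilon> ((f x + g x) / 2 - y) \<le>
        (insensitive_loss q \<epsilon> (f x - y) + insensitive_loss q \<epsilon> (g x - y)) / 2" for x y
      using insensitive_loss_midpoint[of q \<epsilon> "f x - y" "g x - y"] assms by (simp add: field_simps)
    then have "(\<Sum>t=1..T. insensitive_loss q \<epsilon> ((f (fst (z t)) + g (fst (z t))) / 2 - snd (z t))) \<le>
        (\<Sum>t=1..T. (insensitive_loss q \<epsilon> (f (fst (z t)) - snd (z t)) +
          insensitive_loss q \<epsilon> (g (fst (z t)) - snd (z t))) / 2)"
      by (intro sum_mono)
    also have "\<dots> = ((\<Sum>t=1..T. insensitive_loss q \<epsilon> (f (fst (z t)) - snd (z t))) +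
        (\<Sum>t=1..T. insensitive_loss q \<epsilon> (g (fst (z t)) - snd (z t)))) / 2"
      by (simp only: sum.distrib flip: sum_divide_distrib)
    finally have "1 / real T * (\<Sum>t=1..T. insensitive_loss q \<epsilon> ((f (fst (z t)) + g (fst (z t))) / 2 - snd (z t))) \<le>
        1 / real T * (((\<Sum>t=1..T. insensitive_loss q \<epsilon> (f (fst (z t)) - snd (z t))) +
        (\<Sum>t=1..T. insensitive_loss q \<epsilon> (g (fst (z t)) - snd (z t)))) / 2)"
      by (rule mult_left_mono) simp
    then show "empirical_risk q \<epsilon> T z (\<lambda>x. (f x + g x) / 2) \<le>
        (empirical_risk q \<epsilon> T z f + empirical_risk q \<epsilon> T z g) / 2"
      unfolding empirical_risk_def by (simp only: distrib_left times_divide_eq_right)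
  next
    fix f :: "nat \<Rightarrow> 'a \<Rightarrow> real" and g
    assume "\<And>x. x \<in> X \<Longrightarrow> (\<lambda>n. f n x) \<longlonglongrightarrow> g x"
    then show "(\<lambda>n. empirical_risk q \<epsilon> T z (f n)) \<longlonglongrightarrow> empirical_risk q \<epsilon> T z g"
      unfolding empirical_risk_def using assms
      by (intro tendsto_intros tendsto_insensitive_loss) auto
  qed (use assms in \<open>auto simp: empirical_risk_def insensitive_loss_nonneg sum_nonneg\<close>)
  show "regularized_problem.risk X K (empirical_risk q \<epsilon> T z) lam = regularized_risk X K q \<epsilon> lam T z"
    by (intro ext) (simp add: regularized_problem.risk_def[OF 1] regularized_risk_def empirical_risk_def)
qed

section \<open>Measurable dependence of the estimator on the sample\<close>

lemma kernel_inner_single_single: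
  "kernel_inner K (Poly_Mapping.single x a) (Poly_Mapping.single y b) = a * b * K x y"
  by (simp add: kernel_inner_eq_comb kernel_comb_single)

lemma poly_mapping_eq_sum_single:
  "c = (\<Sum>x\<in>Poly_Mapping.keys c. Poly_Mapping.single x (Poly_Mapping.lookup c x))"
proof (rule poly_mapping_eqI)
  fix k
  have "(\<Sum>x\<in>Poly_Mapping.keys c. if x = k then Poly_Mapping.lookup c x else 0) = Poly_Mapping.lookup c k"
    by (subst sum.delta) (simp_all add: in_keys_iff)
  then show "Poly_Mapping.lookup c k =
      Poly_Mapping.lookup (\<Sum>x\<in>Poly_Mapping.keys c. Poly_Mapping.single x (Poly_Mapping.lookup c x)) k"
    by (simp only: lookup_sum lookup_single when_def)
qed

text \<open>The image of a set of lists, so that countability is immediate and adding one more term is a list operation.\<close>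

definition rational_combs :: "'a set \<Rightarrow> ('a \<Rightarrow>\<^sub>0 real) set" where
  "rational_combs A = (\<lambda>l. sum_list (map (\<lambda>(x, a). Poly_Mapping.single x a) l)) ` lists (A \<times> \<rat>)"

lemma countable_rational_combs: "countable A \<Longrightarrow> countable (rational_combs A)"
  unfolding rational_combs_def by (intro countable_image countable_lists countable_SIGMA countable_rat)

lemma zero_in_rational_combs: "0 \<in> rational_combs A"
  unfolding rational_combs_def by (rule image_eqI[of _ _ "[]"]) auto

lemma single_add_in_rational_combs:
  assumes "x \<in> A" "a \<in> \<rat>" "d \<in> rational_combs A"
  shows "Poly_Mapping.single x a + d \<in> rational_combs A"
proof -
  obtain l where "l \<in> lists (A \<times> \<rat>)" "d = sum_list (map (\<lambda>(x, a). Poly_Mapping.single x a) l)"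
    using assms(3) by (auto simp: rational_combs_def)
  then show ?thesis using assms unfolding rational_combs_def
    by (intro image_eqI[of _ _ "(x, a) # l"]) auto
qed

lemma keys_rational_combs:
  assumes "d \<in> rational_combs A" shows "Poly_Mapping.keys d \<subseteq> A"
proof -
  obtain l where "l \<in> lists (A \<times> \<rat>)" and d: "d = sum_list (map (\<lambda>(x, a). Poly_Mapping.single x a) l)"
    using assms by (auto simp: rational_combs_def)
  have "Poly_Mapping.keys (sum_list (map (\<lambda>(x, a). Poly_Mapping.single x a :: 'a \<Rightarrow>\<^sub>0 real) l)) \<subseteq> A"
    using \<open>l \<in> lists (A \<times> \<rat>)\<close>
  proof (induction l)
    case (Cons p l)
    then have "fst p \<in> A" by auto
    then have "Poly_Mapping.keys (Poly_Mapping.single (fst p) (snd p)) \<subseteq> A" by simp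
    from keys_add_subset[OF this Cons.IH] show ?case by (simp add: case_prod_beta)
  qed simp
  then show ?thesis using d by simp
qed

text \<open>Term by term: \<open>\<parallel>a K\<^sub>x - b K\<^sub>y\<parallel>\<^sup>2\<close> is a continuous function of \<open>(y, b)\<close> that vanishes at
\<open>(x, a)\<close>.\<close>

lemma rational_combs_dense:
  fixes X :: "'a::{metric_space, second_countable_topology} set"
  assumes K: "mercer_kernel X K" and A: "A \<subseteq> X" "X \<subseteq> closure A"
    and c: "Poly_Mapping.keys c \<subseteq> X" and e: "e > 0"
  shows "\<exists>d\<in>rational_combs A. kernel_norm K (c - d) < e"
proof -
  interpret pd_kernel X K using K by (rule mercer_imp_pd_kernel)
  have single: "\<exists>y\<in>A. \<exists>b\<in>\<rat>. kernel_norm K (Poly_Mapping.single x a - Poly_Mapping.single y b) < e"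
    if x: "x \<in> X" and e: "e > 0" for x a and e :: real
  proof -
    obtain y where y: "\<And>n. y n \<in> A" "y \<longlonglongrightarrow> x" using A x closure_sequential by blast
    have "\<exists>b\<in>\<rat>. a < b \<and> b < a + 1 / real (Suc n)" for n by (rule Rats_dense_in_real) simp
    then obtain b where b: "\<And>n. b n \<in> \<rat>" "\<And>n. a < b n \<and> b n < a + 1 / real (Suc n)" by metis
    have blim: "b \<longlonglongrightarrow> a"
    proof (rule tendsto_if_within_inverse_Suc)
      show "\<bar>b n - a\<bar> \<le> 1 / real (Suc n)" for n using b(2)[of n] by linarith
    qed
    have Kc: "continuous_on (X \<times> X) (\<lambda>(x, u). K x u)" using K by (simp add: mercer_kernel_def)
    have Klim: "(\<lambda>n. K (s n) (t n)) \<longlonglongrightarrow> K x x"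
      if "s \<longlonglongrightarrow> x" "t \<longlonglongrightarrow> x" "\<And>n. s n \<in> X" "\<And>n. t n \<in> X" for s t
      using continuous_on_tendsto_compose[OF Kc tendsto_Pair[OF that(1,2)]] that(3,4) x by simp
    have yX: "y n \<in> X" for n using y A by auto
    let ?d = "\<lambda>n. Poly_Mapping.single x a - Poly_Mapping.single (y n) (b n)"
    have "kernel_inner K (?d n) (?d n) =
        a * a * K x x - a * b n * K x (y n) - (b n * a * K (y n) x - b n * b n * K (y n) (y n))" for n
      using x yX by (simp add: inner_diff_left inner_diff_right kernel_inner_single_single keys_closed)
    moreover have "(\<lambda>n. a * a * K x x - a * b n * K x (y n) - (b n * a * K (y n) x - b n * b n * K (y n) (y n)))
        \<longlonglongrightarrow> a * a * K x x - a * a * K x x - (a * a * K x x - a * a * K x x)"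
      by (intro tendsto_intros blim Klim y yX x)
    ultimately have "(\<lambda>n. kernel_norm K (?d n)) \<longlonglongrightarrow> sqrt 0"
      unfolding kernel_norm_def by (intro tendsto_real_sqrt) simp
    then have "\<forall>\<^sub>F n in sequentially. kernel_norm K (?d n) < e"
      using e by (intro order_tendstoD(2)) auto
    then obtain n where "kernel_norm K (?d n) < e" by (auto simp: eventually_sequentially)
    then show ?thesis using y b by blast
  qed
  have "\<exists>d\<in>rational_combs A. kernel_norm K ((\<Sum>x\<in>F. Poly_Mapping.single x (a x)) - d) < e"
    if "finite F" "F \<subseteq> X" "e > 0" for F a and e :: real
    using that
  proof (induction F arbitrary: e rule: finite_induct)
    case empty
    then show ?case by (intro bexI[of _ 0] zero_in_rational_combs) (simp add: kernel_norm_def kernel_inner_def)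
  next
    case (insert x F)
    obtain d where d: "d \<in> rational_combs A" "kernel_norm K ((\<Sum>x\<in>F. Poly_Mapping.single x (a x)) - d) < e/2"
      using insert.IH[of "e/2"] insert.prems by auto
    obtain y b where yb: "y \<in> A" "b \<in> \<rat>"
      "kernel_norm K (Poly_Mapping.single x (a x) - Poly_Mapping.single y b) < e/2"
      using single[of x "e/2" "a x"] insert.prems by auto
    let ?u = "Poly_Mapping.single x (a x) - Poly_Mapping.single y b"
    let ?v = "(\<Sum>x\<in>F. Poly_Mapping.single x (a x)) - d"
    have s: "(\<Sum>x\<in>F. Poly_Mapping.single x (a x)) \<in> combs"
      using insert.prems keys_sum[of "\<lambda>x. Poly_Mapping.single x (a x)" F] by (auto split: if_splits)
    have "?u \<in> combs"
      unfolding mem_Collect_eq by (rule keys_diff_subset) (use yb A insert.prems in auto)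
    moreover have "?v \<in> combs" 
      unfolding mem_Collect_eq by (rule keys_diff_subset) (use s keys_rational_combs[OF d(1)] A in auto)
    ultimately have "kernel_norm K (?u + ?v) \<le> kernel_norm K ?u + kernel_norm K ?v" by (rule norm_triangle)
    also have "\<dots> < e" using d yb by simp
    also have "?u + ?v = (\<Sum>x\<in>insert x F. Poly_Mapping.single x (a x)) - (Poly_Mapping.single y b + d)"
      using insert.hyps by simp
    finally show ?case using single_add_in_rational_combs[OF yb(1,2) d(1)] by blast
  qed
  from this[of "Poly_Mapping.keys c" e "Poly_Mapping.lookup c"] show ?thesis
    using c e by (simp only: finite_keys poly_mapping_eq_sum_single[of c, symmetric])
qed

context regularized_problem
begin

text \<open>The risk is continuous on the span in the kernel norm, so a dense sequence already attains the infimum.  The left-hand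
side involves only countably many functions of the data and is therefore measurable in them.\<close>

lemma min_risk_dense:
  assumes d: "\<And>n. d n \<in> combs"
    and dense: "\<And>c e. c \<in> combs \<Longrightarrow> e > 0 \<Longrightarrow> \<exists>n::nat. kernel_norm K (c - d n) < e"
  shows "(INF n. risk (kernel_comb K (d n))) = min_risk"
proof (rule antisym)
  have bdd: "bdd_below (range (\<lambda>n. risk (kernel_comb K (d n))))"
    by (intro bdd_belowI2[where m = 0]) (simp add: risk_nonneg)
  show "min_risk \<le> (INF n. risk (kernel_comb K (d n)))"
    by (intro cINF_greatest) (use d min_risk_le in auto)
  obtain c where c: "\<And>n. c n \<in> combs" "(\<lambda>n. risk (kernel_comb K (c n))) \<longlonglongrightarrow> min_risk"
    using minimizing_sequence_exists by blast
  show "(INF n. risk (kernel_comb K (d n))) \<le> min_risk"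
  proof (rule LIMSEQ_le_const[OF c(2)], intro exI allI impI)
    fix k :: nat
    obtain s where s: "\<And>n. kernel_norm K (c k - d (s n)) < 1 / real (Suc n)"
    proof -
      have "\<exists>j. kernel_norm K (c k - d j) < 1 / real (Suc n)" for n
        by (intro dense c) simp
      then show thesis using that by metis
    qed
    have lim: "(\<lambda>n. kernel_norm K (c k - d (s n))) \<longlonglongrightarrow> 0"
    proof (rule tendsto_if_within_inverse_Suc)
      fix n
      have "0 \<le> kernel_norm K (c k - d (s n))" using c d by (simp add: keys_closed)
      then show "\<bar>kernel_norm K (c k - d (s n)) - 0\<bar> \<le> 1 / real (Suc n)" using s[of n] by linarith
    qed
    have "(\<lambda>n. kernel_norm K (c k) - kernel_norm K (d (s n))) \<longlonglongrightarrow> 0"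
      by (rule Lim_null_comparison[OF _ lim]) (use norm_triangle_rev[OF c(1) d] in simp)
    from tendsto_diff[OF tendsto_const[of "kernel_norm K (c k)"] this]
    have 1: "(\<lambda>n. kernel_norm K (d (s n))) \<longlonglongrightarrow> kernel_norm K (c k)" by simp
    have 2: "(\<lambda>n. kernel_comb K (d (s n)) x) \<longlonglongrightarrow> kernel_comb K (c k) x" if "x \<in> X" for x
      using tendsto_diff[OF tendsto_const[of "kernel_comb K (c k) x"]
          comb_tendsto_if_norm_tendsto_0[of "\<lambda>_. c k" "\<lambda>n. d (s n)", OF c(1) d that lim]] by simp
    have "(\<lambda>n. L (kernel_comb K (d (s n))) + lam * (kernel_norm K (d (s n)))\<^sup>2)
        \<longlonglongrightarrow> L (kernel_comb K (c k)) + lam * (kernel_norm K (c k))\<^sup>2"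
      by (intro tendsto_intros L_cont 1 2)
    then have "(\<lambda>n. risk (kernel_comb K (d (s n)))) \<longlonglongrightarrow> risk (kernel_comb K (c k))"
      using c(1) d by (simp add: risk_comb)
    then show "(INF n. risk (kernel_comb K (d n))) \<le> risk (kernel_comb K (c k))"
      by (rule LIMSEQ_le_const) (use bdd in \<open>auto intro!: cINF_lower\<close>)
  qed
qed

text \<open>Choosing the least admissible index turns the selection of a near-minimizer into a measurable operation.\<close>

lemma least_near_minimizer_tendsto:
  assumes d: "\<And>n. d n \<in> combs"
    and dense: "\<And>c e. c \<in> combs \<Longrightarrow> e > 0 \<Longrightarrow> \<exists>n::nat. kernel_norm K (c - d n) < e"
    and x: "x \<in> X"
  shows "(\<lambda>k. kernel_comb K (d (LEAST n. risk (kernel_comb K (d n)) <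
      (INF n. risk (kernel_comb K (d n))) + 1 / real (Suc k))) x)
    \<longlonglongrightarrow> arg_min_on risk (rkhs X K) x"
proof (rule minimizing_sequence_tendsto_minimizer[OF _ _ x])
  let ?m = "INF n. risk (kernel_comb K (d n))"
  let ?N = "\<lambda>k. LEAST n. risk (kernel_comb K (d n)) < ?m + 1 / real (Suc k)"
  have m: "?m = min_risk" by (rule min_risk_dense[OF d dense])
  show "d (?N n) \<in> combs" for n by (rule d)
  have bdd: "bdd_below (range (\<lambda>n. risk (kernel_comb K (d n))))"
    by (intro bdd_belowI2[where m = 0]) (simp add: risk_nonneg)
  have N: "risk (kernel_comb K (d (?N k))) < ?m + 1 / real (Suc k)" for k
  proof (rule LeastI_ex)
    have "?m < ?m + 1 / real (Suc k)" by simp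
    then show "\<exists>n. risk (kernel_comb K (d n)) < ?m + 1 / real (Suc k)"
      by (subst (asm) cINF_less_iff[OF _ bdd]) auto
  qed
  show "(\<lambda>k. risk (kernel_comb K (d (?N k)))) \<longlonglongrightarrow> min_risk"
  proof (rule tendsto_if_within_inverse_Suc)
    show "\<bar>risk (kernel_comb K (d (?N k))) - min_risk\<bar> \<le> 1 / real (Suc k)" for k
      using N[of k] min_risk_le[OF d, of "?N k"] unfolding m by linarith
  qed
qed

end

lemma kernel_comb_measurable:
  fixes X :: "'a::euclidean_space set"
  assumes K: "mercer_kernel X K" and c: "Poly_Mapping.keys c \<subseteq> X"
  shows "kernel_comb K c \<in> borel_measurable (restrict_space borel X)"
proof -
  have Kc: "continuous_on (X \<times> X) (\<lambda>(x, u). K x u)" using K by (simp add: mercer_kernel_def)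
  have "continuous_on X (K x)" if "x \<in> X" for x
    using continuous_on_compose2[OF Kc continuous_on_Pair[OF continuous_on_const[of X x] continuous_on_id]]
      that by auto
  then have "continuous_on X (kernel_comb K c)"
    unfolding kernel_comb_def using c by (intro continuous_intros) auto
  then show ?thesis by (rule borel_measurable_continuous_on_restrict)
qed

lemma rkhs_measurable:
  fixes X :: "'a::euclidean_space set"
  assumes K: "mercer_kernel X K" and f: "f \<in> rkhs X K"
  shows "f \<in> borel_measurable (restrict_space borel X)"
proof -
  obtain c where c: "rkhs_approx X K c f" using f by (auto simp: rkhs_def)
  show ?thesis
    by (rule borel_measurable_LIMSEQ_real[where u = "\<lambda>n. kernel_comb K (c n)"])
      (use c in \<open>auto simp: rkhs_approx_def space_restrict_space intro!: kernel_comb_measurable[OF K]\<close>)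
qed

lemma sample_components_measurable:
  fixes \<rho> :: "('a::euclidean_space \<times> real) measure"
  assumes "sets \<rho> = sets (restrict_space borel (X \<times> UNIV))"
  shows "fst \<in> \<rho> \<rightarrow>\<^sub>M restrict_space borel X" "snd \<in> borel_measurable \<rho>"
proof -
  have "fst \<in> restrict_space borel (X \<times> (UNIV :: real set)) \<rightarrow>\<^sub>M restrict_space borel X"
    by (intro measurable_restrict_space3 borel_measurable_continuous_onI continuous_intros) auto
  then show "fst \<in> \<rho> \<rightarrow>\<^sub>M restrict_space borel X" by (subst measurable_cong_sets[OF assms refl])
  have "snd \<in> restrict_space borel (X \<times> (UNIV :: real set)) \<rightarrow>\<^sub>M borel"
    by (intro measurable_restrict_space1 borel_measurable_continuous_onI continuous_intros)
  then show "snd \<in> borel_measurable \<rho>" by (subst measurable_cong_sets[OF assms refl])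
qed

text \<open>Joint measurability in the sample and the point is needed, because the error integrates over the point.\<close>

lemma svr_estimator_measurable:
  fixes X :: "'a::euclidean_space set"
  assumes K: "mercer_kernel X K" and sets: "sets \<rho> = sets (restrict_space borel (X \<times> UNIV))"
    and par: "0 < lam" "1 < q"
  shows "(\<lambda>(z, x). svr_estimator X K q \<epsilon> lam T z x) \<in>
    borel_measurable (PiM {1..T} (\<lambda>_. \<rho>) \<Otimes>\<^sub>M restrict_space borel X)"
proof -
  note [measurable] = sample_components_measurable[OF sets]
  let ?P = "PiM {1..T} (\<lambda>_. \<rho>)"
  obtain A where A: "countable A" "A \<subseteq> X" "X \<subseteq> closure A" by (rule separable)
  define d where "d = from_nat_into (rational_combs A)"
  have ne: "rational_combs A \<noteq> {}" using zero_in_rational_combs by blast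
  have dX: "Poly_Mapping.keys (d n) \<subseteq> X" for n
    using keys_rational_combs from_nat_into[OF ne] A(2) unfolding d_def by blast
  have dense: "\<exists>n. kernel_norm K (c - d n) < e" if ce: "Poly_Mapping.keys c \<subseteq> X" "e > 0" for c e
  proof -
    obtain c' where "c' \<in> rational_combs A" "kernel_norm K (c - c') < e"
      using rational_combs_dense[OF K A(2,3) ce] by blast
    then show ?thesis unfolding d_def
      using from_nat_into_surj[OF countable_rational_combs[OF A(1)]] by metis
  qed
  have [measurable]: "kernel_comb K (d n) \<in> borel_measurable (restrict_space borel X)" for n
    by (rule kernel_comb_measurable[OF K dX])
  define R where "R z n = regularized_risk X K q \<epsilon> lam T z (kernel_comb K (d n))" for z n
  have [measurable]: "(\<lambda>z. R z n) \<in> borel_measurable ?P" for n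
    unfolding R_def regularized_risk_def by measurable
  define N where "N k z = (LEAST n. R z n < (INF n. R z n) + 1 / real (Suc k))" for k z
  have [measurable]: "N k \<in> ?P \<rightarrow>\<^sub>M count_space UNIV" for k
    unfolding N_def[abs_def] by measurable
  define G where "G k = (\<lambda>(z, x). kernel_comb K (d (N k z)) x)" for k
  have "G k \<in> borel_measurable (?P \<Otimes>\<^sub>M restrict_space borel X)" for k
    unfolding G_def case_prod_beta
    by (rule measurable_compose_countable[where f = "\<lambda>n w. kernel_comb K (d n) (snd w)" and g = "\<lambda>w. N k (fst w)"]) measurable
  then show ?thesis
  proof (rule borel_measurable_LIMSEQ_real[rotated])
    fix w assume w: "w \<in> space (?P \<Otimes>\<^sub>M restrict_space borel X)"
    obtain z x where zx: "w = (z, x)" by force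
    have x: "x \<in> X" and z: "z \<in> space ?P" using w zx by (auto simp: space_pair_measure space_restrict_space)
    have "space \<rho> = X \<times> UNIV" using sets_eq_imp_space_eq[OF sets] by (simp add: space_restrict_space)
    then have zt: "fst (z t) \<in> X" if "t \<in> {1..T}" for t using z that by (auto simp: space_PiM PiE_iff mem_Times_iff)
    interpret regularized_problem X K "empirical_risk q \<epsilon> T z" lam
      using regularized_problem_empirical(1)[OF K par zt] .
    have risk: "risk = regularized_risk X K q \<epsilon> lam T z"
      using regularized_problem_empirical(2)[OF K par zt] .
    show "(\<lambda>k. G k w) \<longlonglongrightarrow> (case w of (z, x) \<Rightarrow> svr_estimator X K q \<epsilon> lam T z x)"
      using least_near_minimizer_tendsto[of d x] dX dense x
      by (simp add: zx G_def N_def R_def svr_estimator_def risk)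
  qed
qed

section \<open>Interpolation of kernel functions from local samples\<close>

text \<open>The nodes \<open>P\<close> and weights \<open>w\<close> come from Gaussian elimination with pivoting: a point
\<open>y\<close> where \<open>\<bar>p i\<bar>\<close> nearly attains its supremum eliminates \<open>p i\<close> from the remaining functions, and since the
pivot loses at most a factor \<open>2\<close>, each step multiplies one plus the total weight by at most \<open>3\<close>.  The bound must not depend
on the size or shape of \<open>S\<close>, because it is applied to arbitrarily small pieces of an arbitrary compact set.\<close>

lemma bounded_interpolation:
  fixes p :: "'i \<Rightarrow> 'a \<Rightarrow> real"
  assumes "finite I" "\<forall>i\<in>I. \<forall>x\<in>S. \<bar>p i x\<bar> \<le> B"
  shows "\<exists>P w. finite P \<and> P \<subseteq> S \<and> card P \<le> card I \<and>
    (\<forall>x\<in>S. (\<forall>i\<in>I. p i x = (\<Sum>y\<in>P. w x y * p i y)) \<and> 1 + (\<Sum>y\<in>P. \<bar>w x y\<bar>) \<le> 3 ^ card I)"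
  using assms
proof (induction I arbitrary: p B rule: finite_induct)
  case empty
  show ?case by (intro exI[of _ "{}"]) auto
next
  case (insert i I)
  show ?case
  proof (cases "\<forall>x\<in>S. p i x = 0")
    case True
    have "\<forall>j\<in>I. \<forall>x\<in>S. \<bar>p j x\<bar> \<le> B" using insert.prems by blast
    from insert.IH[OF this] obtain P w where P: "finite P" "P \<subseteq> S" "card P \<le> card I"
      "\<forall>x\<in>S. (\<forall>j\<in>I. p j x = (\<Sum>y\<in>P. w x y * p j y)) \<and> 1 + (\<Sum>y\<in>P. \<bar>w x y\<bar>) \<le> 3 ^ card I"
      by (elim exE conjE)
    have zero: "(\<Sum>y\<in>P. w x y * p i y) = 0" for x using P(2) True by (intro sum.neutral) auto
    have "p j x = (\<Sum>y\<in>P. w x y * p j y)" if "x \<in> S" "j \<in> insert i I" for x j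
    proof (cases "j = i")
      case True
      then show ?thesis using zero \<open>\<forall>x\<in>S. p i x = 0\<close> that by simp
    next
      case False
      then show ?thesis using P(4) that by blast
    qed
    moreover have "1 + (\<Sum>y\<in>P. \<bar>w x y\<bar>) \<le> 3 ^ card (insert i I)" if "x \<in> S" for x
    proof -
      have "1 + (\<Sum>y\<in>P. \<bar>w x y\<bar>) \<le> 3 ^ card I" using P(4) that by blast
      also have "\<dots> \<le> 3 ^ card (insert i I)" using insert.hyps by simp
      finally show ?thesis .
    qed
    moreover have "card P \<le> card (insert i I)" using P(3) insert.hyps by simp
    ultimately show ?thesis using P(1,2) by blast
  next
    case False
    then obtain x0 where x0: "x0 \<in> S" "p i x0 \<noteq> 0" by blast
    define s where "s = (SUP x\<in>S. \<bar>p i x\<bar>)"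
    have bdd: "bdd_above ((\<lambda>x. \<bar>p i x\<bar>) ` S)" using insert.prems by (intro bdd_aboveI2[of _ _ B]) auto
    have up: "\<bar>p i x\<bar> \<le> s" if "x \<in> S" for x unfolding s_def using that bdd by (rule cSUP_upper)
    have "0 < s" using up[OF x0(1)] x0(2) by linarith
    then have "s / 2 < s" by simp
    obtain y where y: "y \<in> S" "s / 2 < \<bar>p i y\<bar>"
    proof (rule ccontr)
      assume "\<not> thesis"
      then have "s \<le> s / 2" unfolding s_def using x0(1) that
        by (intro cSUP_least) (auto simp: s_def not_less[symmetric])
      then show False using \<open>s / 2 < s\<close> by simp
    qed
    have y0: "p i y \<noteq> 0" using y \<open>0 < s\<close> by auto
    have piv: "\<bar>p i x\<bar> \<le> 2 * \<bar>p i y\<bar>" if "x \<in> S" for x using up[OF that] y by linarith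
    define p' where "p' j x = p j x - p j y * p i x / p i y" for j x
    have "\<bar>p' j x\<bar> \<le> B + B * 2" if "j \<in> I" "x \<in> S" for j x
    proof -
      have "\<bar>p j y * p i x / p i y\<bar> = \<bar>p j y\<bar> * (\<bar>p i x\<bar> / \<bar>p i y\<bar>)" by (simp add: abs_mult)
      also have "\<dots> \<le> B * 2"
        using piv[OF that(2)] y0 insert.prems that y(1) by (intro mult_mono) (auto simp: field_simps)
      finally show ?thesis using insert.prems that unfolding p'_def
        by (intro order_trans[OF abs_triangle_ineq4] add_mono) auto
    qed
    then have "\<forall>j\<in>I. \<forall>x\<in>S. \<bar>p' j x\<bar> \<le> B + B * 2" by blast
    from insert.IH[OF this] obtain P w where P: "finite P" "P \<subseteq> S" "card P \<le> card I"
      "\<forall>x\<in>S. (\<forall>j\<in>I. p' j x = (\<Sum>v\<in>P. w x v * p' j v)) \<and> 1 + (\<Sum>v\<in>P. \<bar>w x v\<bar>) \<le> 3 ^ card I"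
      by (elim exE conjE)
    \<comment> \<open>The weight at the new node removes the error \<open>r\<close> that the nodes of the reduced problem make on \<open>p i\<close>.\<close>
    define r where "r x = p i x - (\<Sum>v\<in>P. w x v * p i v)" for x
    define w' where "w' x v = (if v \<in> P then w x v else 0) + (if v = y then r x / p i y else 0)" for x v
    have sum_w': "(\<Sum>v\<in>insert y P. w' x v * f v) = (\<Sum>v\<in>P. w x v * f v) + r x / p i y * f y" for x and f :: "'a \<Rightarrow> real"
    proof -
      have "(\<Sum>v\<in>insert y P. w' x v * f v) = (\<Sum>v\<in>insert y P. (if v \<in> P then w x v * f v else 0)) +
          (\<Sum>v\<in>insert y P. if v = y then r x / p i y * f y else 0)"
        unfolding sum.distrib[symmetric] by (intro sum.cong) (auto simp: w'_def algebra_simps)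
      also have "(\<Sum>v\<in>insert y P. (if v \<in> P then w x v * f v else 0)) = (\<Sum>v\<in>P. w x v * f v)"
        using P(1) by (intro sum.mono_neutral_cong_right) auto
      also have "(\<Sum>v\<in>insert y P. if v = y then r x / p i y * f y else 0) = r x / p i y * f y"
        using P(1) by (simp add: sum.delta)
      finally show ?thesis .
    qed
    have "card (insert y P) \<le> card (insert i I)"
      using P(1,3) insert.hyps by (simp add: card_insert_if)
    moreover have "p j x = (\<Sum>v\<in>insert y P. w' x v * p j v)" if x: "x \<in> S" and j: "j \<in> insert i I" for x j
    proof (cases "j = i")
      case True
      then show ?thesis unfolding sum_w' using y0 by (simp add: r_def)
    next
      case False
      then have "p' j x = (\<Sum>v\<in>P. w x v * p' j v)" using P(4) x j by blast
      also have "\<dots> = (\<Sum>v\<in>P. w x v * p j v) - (\<Sum>v\<in>P. w x v * p i v) * (p j y / p i y)"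
        by (simp add: p'_def sum_distrib_left sum_distrib_right sum_divide_distrib sum_subtractf
            right_diff_distrib mult_ac)
      finally show ?thesis unfolding sum_w' by (simp add: p'_def r_def diff_divide_distrib algebra_simps)
    qed
    moreover have "1 + (\<Sum>v\<in>insert y P. \<bar>w' x v\<bar>) \<le> 3 ^ card (insert i I)" if x: "x \<in> S" for x
    proof -
      define W where "W = (\<Sum>v\<in>P. \<bar>w x v\<bar>)"
      have "(\<Sum>v\<in>insert y P. \<bar>w' x v\<bar>) \<le>
          (\<Sum>v\<in>insert y P. (if v \<in> P then \<bar>w x v\<bar> else 0) + (if v = y then \<bar>r x / p i y\<bar> else 0))"
        by (intro sum_mono) (auto simp: w'_def simp flip: abs_divide intro: abs_triangle_ineq)
      also have "\<dots> = W + \<bar>r x / p i y\<bar>"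
        unfolding sum.distrib W_def using P(1)
        by (intro arg_cong2[of _ _ _ _ "(+)"] sum.mono_neutral_cong_right) (auto simp: sum.delta)
      also have "\<bar>r x / p i y\<bar> \<le> 2 * (1 + W)"
      proof -
        have "\<bar>\<Sum>v\<in>P. w x v * p i v\<bar> \<le> (\<Sum>v\<in>P. \<bar>w x v\<bar> * (2 * \<bar>p i y\<bar>))"
          using P(2) piv by (intro order_trans[OF sum_abs] sum_mono) (auto simp: abs_mult intro!: mult_left_mono)
        also have "\<dots> = W * (2 * \<bar>p i y\<bar>)" by (simp add: W_def sum_distrib_right)
        finally have "\<bar>r x\<bar> \<le> 2 * (1 + W) * \<bar>p i y\<bar>"
          using piv[OF x] unfolding r_def by (simp add: algebra_simps)
        then show ?thesis using y0 by (simp add: field_simps)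
      qed
      finally have "1 + (\<Sum>v\<in>insert y P. \<bar>w' x v\<bar>) \<le> 3 * (1 + W)" by simp
      also have "1 + W \<le> 3 ^ card I" using P(4) x unfolding W_def by blast
      then have "3 * (1 + W) \<le> 3 * 3 ^ card I" by simp
      finally show ?thesis using insert.hyps by simp
    qed
    moreover have "finite (insert y P)" "insert y P \<subseteq> S" using P(1,2) y(1) by auto
    ultimately show ?thesis by blast
  qed
qed

text \<open>Only derivatives in the first of the two arguments occur.  A word of basis vectors records in which directions, and in
which order, the derivatives are taken.\<close>

fun iter_partial :: "'a::euclidean_space list \<Rightarrow> ('a \<times> 'a \<Rightarrow> real) \<Rightarrow> 'a \<times> 'a \<Rightarrow> real" where
  "iter_partial [] G = G"
| "iter_partial (b # l) G = iter_partial l (\<lambda>p. frechet_derivative G (at p) (b, 0))"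

definition basis_words :: "nat \<Rightarrow> 'a::euclidean_space list set" where
  "basis_words k = {l. set l \<subseteq> Basis \<and> length l = k}"

definition word_monomial :: "'a::euclidean_space list \<Rightarrow> 'a \<Rightarrow> real" where
  "word_monomial l v = prod_list (map ((\<bullet>) v) l)"

text \<open>The \<open>k\<close>-th derivative of \<open>t \<mapsto> G (x + t v, u)\<close>, written as a polynomial in \<open>v\<close> with coefficients that depend
on the base point only.\<close>

definition taylor_form :: "nat \<Rightarrow> ('a::euclidean_space \<times> 'a \<Rightarrow> real) \<Rightarrow> 'a \<Rightarrow> 'a \<times> 'a \<Rightarrow> real" where
  "taylor_form k G v p = (\<Sum>l\<in>basis_words k. word_monomial l v * iter_partial l G p)"

lemma finite_basis_words: "finite (basis_words k)"
  unfolding basis_words_def by (rule finite_lists_length_eq) simp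

lemma iter_partial_snoc:
  "iter_partial (l @ [b]) G p = frechet_derivative (iter_partial l G) (at p) (b, 0)"
  by (induction l arbitrary: G) auto

lemma Ck_on_iter_partial:
  "Ck_on (length l + k) G U \<Longrightarrow> set l \<subseteq> Basis \<Longrightarrow> Ck_on k (iter_partial l G) U"
proof (induction l arbitrary: G)
  case (Cons b l)
  have b: "(b, 0) \<in> Basis" using Cons.prems by (auto simp: Basis_prod_def)
  have "\<forall>b\<in>Basis. Ck_on (length l + k) (\<lambda>p. frechet_derivative G (at p) b) U" using Cons.prems by simp
  from bspec[OF this b] have "Ck_on (length l + k) (\<lambda>p. frechet_derivative G (at p) (b, 0)) U" .
  then show ?case using Cons.IH Cons.prems by simp
qed simp

lemma word_monomial_bound:
  assumes "set l \<subseteq> Basis" shows "\<bar>word_monomial l v\<bar> \<le> norm v ^ length l"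
  using assms unfolding word_monomial_def
proof (induction l)
  case (Cons b l)
  then show ?case using Basis_le_norm[of b v]
    by (simp add: abs_mult) (intro mult_mono, auto)
qed simp

lemma taylor_form_0: "taylor_form 0 G v p = G p"
proof -
  have "basis_words 0 = {[] :: 'a list}" by (auto simp: basis_words_def)
  then show ?thesis by (simp add: taylor_form_def word_monomial_def)
qed

lemma taylor_form_deriv:
  fixes c v u :: "'a::euclidean_space"
  assumes G: "Ck_on (Suc k) G U" and U: "open U" "(c + t *\<^sub>R v, u) \<in> U"
  shows "((\<lambda>t. taylor_form k G v (c + t *\<^sub>R v, u)) has_real_derivative
    taylor_form (Suc k) G v (c + t *\<^sub>R v, u)) (at t)"
proof -
  let ?p = "(c + t *\<^sub>R v, u)"
  have d1: "((\<lambda>t. iter_partial l G (c + t *\<^sub>R v, u)) has_real_derivative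
      (\<Sum>b\<in>Basis. (v \<bullet> b) * iter_partial (l @ [b]) G ?p)) (at t)" if l: "l \<in> basis_words k" for l
  proof -
    let ?H = "iter_partial l G"
    have "Ck_on 1 ?H U" using Ck_on_iter_partial[of l 1 G U] G l by (auto simp: basis_words_def)
    then have "?H differentiable_on U" by simp
    then have "?H differentiable (at ?p within U)" using U(2) unfolding differentiable_on_def by blast
    then have "?H differentiable (at ?p)" by (simp only: at_within_open[OF U(2,1)])
    then have H: "(?H has_derivative frechet_derivative ?H (at ?p)) (at ?p)"
      by (simp add: frechet_derivative_works)
    then have lin: "linear (frechet_derivative ?H (at ?p))" by (rule has_derivative_linear)
    have line: "((\<lambda>t. (c + t *\<^sub>R v, u)) has_derivative (\<lambda>s. (0 + s *\<^sub>R v, 0))) (at t)"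
      by (intro has_derivative_Pair has_derivative_add has_derivative_const
          has_derivative_scaleR_left has_derivative_ident)
    have "((\<lambda>t. ?H (c + t *\<^sub>R v, u)) has_derivative (\<lambda>s. frechet_derivative ?H (at ?p) (s *\<^sub>R v, 0))) (at t)"
      using has_derivative_compose[OF line H] by simp
    moreover have "frechet_derivative ?H (at ?p) (s *\<^sub>R v, 0) =
        (\<Sum>b\<in>Basis. (v \<bullet> b) * iter_partial (l @ [b]) G ?p) * s" for s
    proof -
      have "(s *\<^sub>R v, 0 :: 'a) = s *\<^sub>R (\<Sum>b\<in>Basis. (v \<bullet> b) *\<^sub>R (b, 0))"
      proof -
        have "(\<Sum>b\<in>Basis. (v \<bullet> b) *\<^sub>R (b, 0 :: 'a)) = ((\<Sum>b\<in>Basis. (v \<bullet> b) *\<^sub>R b), 0)"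
          by (simp add: prod_eq_iff fst_sum snd_sum)
        then show ?thesis by (simp add: euclidean_representation)
      qed
      then show ?thesis
        by (simp only: linear_scale[OF lin] linear_sum[OF lin] iter_partial_snoc)
          (simp add: mult.commute)
    qed
    ultimately show ?thesis by (simp add: has_field_derivative_def)
  qed
  have "((\<lambda>t. taylor_form k G v (c + t *\<^sub>R v, u)) has_real_derivative
      (\<Sum>l\<in>basis_words k. word_monomial l v * (\<Sum>b\<in>Basis. (v \<bullet> b) * iter_partial (l @ [b]) G ?p))) (at t)"
    unfolding taylor_form_def by (intro DERIV_sum DERIV_cmult d1)
  also have "(\<Sum>l\<in>basis_words k. word_monomial l v * (\<Sum>b\<in>Basis. (v \<bullet> b) * iter_partial (l @ [b]) G ?p)) =
      (\<Sum>(l, b)\<in>basis_words k \<times> Basis. word_monomial (l @ [b]) v * iter_partial (l @ [b]) G ?p)"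
    by (simp add: sum.cartesian_product[symmetric] sum_distrib_left word_monomial_def mult_ac)
  also have "\<dots> = taylor_form (Suc k) G v ?p"
    unfolding taylor_form_def
  proof (rule sum.reindex_bij_witness[where i = "\<lambda>l. (butlast l, last l)" and j = "\<lambda>(l, b). l @ [b]"])
    fix l :: "'a list" assume l: "l \<in> basis_words (Suc k)"
    then have "l \<noteq> []" by (auto simp: basis_words_def)
    then show "(butlast l, last l) \<in> basis_words k \<times> Basis" "(case (butlast l, last l) of (l, b) \<Rightarrow> l @ [b]) = l"
      using l by (auto simp: basis_words_def dest: in_set_butlastD)
  qed (auto simp: basis_words_def)
  finally show ?thesis .
qed

lemma taylor_form_bound:
  fixes G :: "'a::euclidean_space \<times> 'a \<Rightarrow> real"
  assumes G: "\<And>k. Ck_on k G U" and C: "compact C" "C \<subseteq> U"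
  shows "\<exists>B\<ge>0. \<forall>p\<in>C. \<forall>v. \<bar>taylor_form k G v p\<bar> \<le> B * norm v ^ k"
proof -
  have "\<exists>B. \<forall>p\<in>C. \<bar>iter_partial l G p\<bar> \<le> B" if "l \<in> basis_words k" for l
  proof -
    have "Ck_on 0 (iter_partial l G) U" using Ck_on_iter_partial[of l 0 G U] G that by (auto simp: basis_words_def)
    then have "continuous_on C (iter_partial l G)" using C continuous_on_subset by auto
    then have "bounded (iter_partial l G ` C)" using C compact_continuous_image compact_imp_bounded by blast
    then show ?thesis unfolding bounded_iff by auto
  qed
  then obtain B where B: "\<And>l p. l \<in> basis_words k \<Longrightarrow> p \<in> C \<Longrightarrow> \<bar>iter_partial l G p\<bar> \<le> B l" by metis
  have "\<bar>taylor_form k G v p\<bar> \<le> (\<Sum>l\<in>basis_words k. \<bar>B l\<bar>) * norm v ^ k" if p: "p \<in> C" for p v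
  proof -
    have "\<bar>taylor_form k G v p\<bar> \<le> (\<Sum>l\<in>basis_words k. norm v ^ k * \<bar>B l\<bar>)"
      unfolding taylor_form_def
    proof (intro order_trans[OF sum_abs] sum_mono)
      fix l :: "'a list" assume l: "l \<in> basis_words k"
      then show "\<bar>word_monomial l v * iter_partial l G p\<bar> \<le> norm v ^ k * \<bar>B l\<bar>"
        using word_monomial_bound[of l v] B[OF l p] unfolding abs_mult
        by (intro mult_mono) (auto simp: basis_words_def)
    qed
    then show ?thesis by (simp add: sum_distrib_left mult.commute)
  qed
  then show ?thesis by (intro exI[of _ "\<Sum>l\<in>basis_words k. \<bar>B l\<bar>"]) (auto intro: sum_nonneg)
qed

text \<open>Taylor's formula along the segment from \<open>(c, u)\<close> to \<open>(x, u)\<close>.  For \<open>x\<close> near \<open>c\<close> the segment stays in a compact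
neighbourhood of \<open>X \<times> X\<close> inside the domain of the smooth extension, which makes the constants uniform although \<open>X\<close>
itself need not contain the segment.\<close>

lemma kernel_taylor:
  fixes X :: "'a::euclidean_space set"
  assumes X: "compact X" and K: "smooth_kernel_on X K" and m: "m > 0"
  shows "\<exists>h0>0. \<exists>B\<ge>0. \<exists>a. \<forall>c\<in>X. \<forall>x\<in>X. \<forall>u\<in>X. dist x c \<le> h0 \<longrightarrow>
    \<bar>K x u - (\<Sum>k<m. \<Sum>l\<in>basis_words k. word_monomial l (x - c) * a c u l)\<bar> \<le> B * dist x c ^ m"
proof -
  obtain U G where U: "open U" "X \<times> X \<subseteq> U" and G: "\<And>k. Ck_on k G U"
    and GK: "\<And>x u. x \<in> X \<Longrightarrow> u \<in> X \<Longrightarrow> G (x, u) = K x u"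
    using K unfolding smooth_kernel_on_def by blast
  have XX: "compact (X \<times> X)" using X by (intro compact_Times)
  obtain h0 where h0: "h0 > 0" "(\<Union>p\<in>X \<times> X. cball p h0) \<subseteq> U"
    using compact_subset_open_imp_cball_epsilon_subset[OF XX U] by blast
  define C where "C = {p + y | p y. p \<in> X \<times> X \<and> y \<in> cball 0 h0}"
  have C: "compact C" unfolding C_def by (intro compact_sums XX compact_cball)
  have "C \<subseteq> U"
  proof
    fix z assume "z \<in> C"
    then obtain p y where "z = p + y" "p \<in> X \<times> X" "norm y \<le> h0" by (auto simp: C_def)
    then have "z \<in> cball p h0" by (simp add: dist_norm)
    then show "z \<in> U" using h0 \<open>p \<in> X \<times> X\<close> by blast
  qed
  obtain B where B: "B \<ge> 0" "\<And>p v. p \<in> C \<Longrightarrow> \<bar>taylor_form m G v p\<bar> \<le> B * norm v ^ m"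
    using taylor_form_bound[OF G C \<open>C \<subseteq> U\<close>] by metis
  define a where "a c u l = iter_partial l G (c, u) / fact (length l)" for c u l
  have "\<bar>K x u - (\<Sum>k<m. \<Sum>l\<in>basis_words k. word_monomial l (x - c) * a c u l)\<bar> \<le> B * dist x c ^ m"
    if "c \<in> X" "x \<in> X" "u \<in> X" "dist x c \<le> h0" for c x u
  proof -
    define v where "v = x - c"
    have seg: "(c + t *\<^sub>R v, u) \<in> C" if t: "0 \<le> t" "t \<le> 1" for t
    proof -
      have "\<bar>t\<bar> * norm v \<le> 1 * h0"
        using t \<open>dist x c \<le> h0\<close> by (intro mult_mono) (auto simp: v_def dist_norm)
      then have "(t *\<^sub>R v, 0 :: 'a) \<in> cball 0 h0" by (simp add: norm_Pair)
      moreover have "(c + t *\<^sub>R v, u) = (c, u) + (t *\<^sub>R v, 0)" by simp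
      ultimately show ?thesis unfolding C_def using \<open>c \<in> X\<close> \<open>u \<in> X\<close> by blast
    qed
    have "\<exists>t. 0 < t \<and> t < 1 \<and> G (c + 1 *\<^sub>R v, u) =
        (\<Sum>k<m. taylor_form k G v (c + 0 *\<^sub>R v, u) / fact k * 1 ^ k) +
        taylor_form m G v (c + t *\<^sub>R v, u) / fact m * 1 ^ m"
    proof (rule Maclaurin[where diff = "\<lambda>k t. taylor_form k G v (c + t *\<^sub>R v, u)"])
      show "\<forall>k t. k < m \<and> 0 \<le> t \<and> t \<le> 1 \<longrightarrow>
          ((\<lambda>t. taylor_form k G v (c + t *\<^sub>R v, u)) has_real_derivative
            taylor_form (Suc k) G v (c + t *\<^sub>R v, u)) (at t)"
        using seg \<open>C \<subseteq> U\<close> by (intro allI impI taylor_form_deriv[OF G U(1)]) auto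
    qed (use m in \<open>auto simp: taylor_form_0\<close>)
    then obtain t where t: "0 < t" "t < 1" and
      eq: "G (c + v, u) = (\<Sum>k<m. taylor_form k G v (c, u) / fact k) + taylor_form m G v (c + t *\<^sub>R v, u) / fact m"
      by auto
    have "(\<Sum>k<m. taylor_form k G v (c, u) / fact k) = (\<Sum>k<m. \<Sum>l\<in>basis_words k. word_monomial l v * a c u l)"
      by (intro sum.cong refl) (simp add: taylor_form_def sum_divide_distrib a_def basis_words_def)
    then have "K x u - (\<Sum>k<m. \<Sum>l\<in>basis_words k. word_monomial l v * a c u l) =
        taylor_form m G v (c + t *\<^sub>R v, u) / fact m"
      using eq GK[OF \<open>x \<in> X\<close> \<open>u \<in> X\<close>] by (simp add: v_def)
    also have "\<bar>\<dots>\<bar> \<le> \<bar>taylor_form m G v (c + t *\<^sub>R v, u)\<bar>"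
    proof -
      have "(1::real) \<le> fact m" by (rule fact_ge_1)
      then show ?thesis by (simp add: divide_le_eq mult_le_cancel_left1)
    qed
    also have "\<dots> \<le> B * norm v ^ m" using t by (intro B seg) auto
    finally show ?thesis by (simp add: v_def dist_norm)
  qed
  then show ?thesis using h0(1) B(1) by blast
qed

lemma (in pd_kernel) inner_sum_single:
  assumes "c \<in> combs" "finite P" "P \<subseteq> X"
  shows "(\<Sum>y\<in>P. Poly_Mapping.single y (w y)) \<in> combs"
    and "kernel_inner K c (\<Sum>y\<in>P. Poly_Mapping.single y (w y)) = (\<Sum>y\<in>P. w y * kernel_comb K c y)"
proof -
  have s: "Poly_Mapping.single y (w y) \<in> combs" if "y \<in> X" for y using that by simp
  have "(\<Sum>y\<in>P. Poly_Mapping.single y (w y)) \<in> combs \<and>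
      kernel_inner K c (\<Sum>y\<in>P. Poly_Mapping.single y (w y)) = (\<Sum>y\<in>P. w y * kernel_comb K c y)"
    using assms(2,3)
  proof (induction P rule: finite_induct)
    case empty
    then show ?case by (simp add: kernel_inner_def)
  next
    case (insert y P)
    have "kernel_inner K c (Poly_Mapping.single y (w y)) = w y * kernel_comb K c y"
      by (simp add: kernel_inner_eq_comb)
    then show ?case using insert s assms(1) inner_add_right[of c "Poly_Mapping.single y (w y)"]
      by (simp add: keys_add_subset)
  qed
  then show "(\<Sum>y\<in>P. Poly_Mapping.single y (w y)) \<in> combs"
    "kernel_inner K c (\<Sum>y\<in>P. Poly_Mapping.single y (w y)) = (\<Sum>y\<in>P. w y * kernel_comb K c y)" by auto
qed

text \<open>The representer of the interpolation error \<open>f x - (\<Sum>y\<in>P. w y * f y)\<close>; its kernel norm is the norm of that functional.\<close>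

definition residual :: "'a \<Rightarrow> 'a set \<Rightarrow> ('a \<Rightarrow> real) \<Rightarrow> 'a \<Rightarrow>\<^sub>0 real" where
  "residual x P w = Poly_Mapping.single x 1 - (\<Sum>y\<in>P. Poly_Mapping.single y (w y))"

context pd_kernel
begin

lemma residual_in_combs: "x \<in> X \<Longrightarrow> finite P \<Longrightarrow> P \<subseteq> X \<Longrightarrow> residual x P w \<in> combs"
  using inner_sum_single(1)[of 0 P w] by (simp add: residual_def keys_closed)

lemma inner_residual:
  assumes "c \<in> combs" "x \<in> X" "finite P" "P \<subseteq> X"
  shows "kernel_inner K c (residual x P w) = kernel_comb K c x - (\<Sum>y\<in>P. w y * kernel_comb K c y)"
proof -
  have "Poly_Mapping.single x 1 \<in> combs" using assms(2) by simp
  from inner_diff_right[OF assms(1) this inner_sum_single(1)[OF assms(1,3,4)]] show ?thesis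
    by (simp only: residual_def inner_sum_single(2)[OF assms(1,3,4)] kernel_inner_single_right)
qed

lemma interpolation_error:
  assumes f: "f \<in> rkhs X K" and P: "x \<in> X" "finite P" "P \<subseteq> X"
  shows "\<bar>f x - (\<Sum>y\<in>P. w y * f y)\<bar> \<le> rkhs_norm X K f * kernel_norm K (residual x P w)"
proof -
  obtain c where c: "rkhs_approx X K c f" using f by (auto simp: rkhs_def)
  have "(\<lambda>n. \<bar>kernel_comb K (c n) x - (\<Sum>y\<in>P. w y * kernel_comb K (c n) y)\<bar>)
      \<longlonglongrightarrow> \<bar>f x - (\<Sum>y\<in>P. w y * f y)\<bar>"
    using P by (intro tendsto_intros rkhs_approxD(2)[OF c]) auto
  moreover have "(\<lambda>n. kernel_norm K (c n) * kernel_norm K (residual x P w))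
      \<longlonglongrightarrow> rkhs_norm X K f * kernel_norm K (residual x P w)"
    by (intro tendsto_intros rkhs_norm_limit[OF c])
  ultimately show ?thesis
    by (rule LIMSEQ_le)
      (use inner_cauchy_schwarz[OF rkhs_approxD(1)[OF c] residual_in_combs[OF P]]
        inner_residual[OF rkhs_approxD(1)[OF c] P] in auto)
qed

lemma rkhs_bound:
  assumes f: "f \<in> rkhs X K" and x: "x \<in> X"
  shows "\<bar>f x\<bar> \<le> rkhs_norm X K f * sqrt (K x x)"
  using interpolation_error[OF f x, of "{}"]
  by (simp add: residual_def kernel_norm_def kernel_inner_single_right kernel_comb_single)

lemma kernel_comb_residual:
  assumes "finite P"
  shows "kernel_comb K (residual x P w) u = K x u - (\<Sum>y\<in>P. w y * K y u)"
proof -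
  have "kernel_comb K (\<Sum>y\<in>P. Poly_Mapping.single y (w y)) u = (\<Sum>y\<in>P. w y * K y u)"
    using assms by (induction P rule: finite_induct) (auto simp: kernel_comb_add kernel_comb_single)
  then show ?thesis by (simp add: residual_def kernel_comb_diff kernel_comb_single)
qed

end

text \<open>The squared norm of the residual functional is obtained by applying the functional to the kernel in each of the two
variables.  In the first variable it annihilates the Taylor polynomial and leaves the remainder, of order \<open>h ^ m\<close>; in
the second variable only the bound on the weights is used.  The bounds on the number of nodes and on the
weights depend on \<open>m\<close> but not on the cell.\<close>

lemma local_interpolation:
  fixes X :: "'a::euclidean_space set"
  assumes X: "compact X" and K: "smooth_kernel_on X K" "pd_kernel X K" and m: "m > 0"
  shows "\<exists>h0>0. \<exists>C\<ge>0. \<exists>D::nat. \<forall>S h. S \<subseteq> X \<longrightarrow> 0 < h \<longrightarrow> h \<le> h0 \<longrightarrow> (\<forall>x\<in>S. \<forall>y\<in>S. dist x y \<le> h) \<longrightarrow>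
    (\<exists>P w. finite P \<and> P \<subseteq> S \<and> card P \<le> D \<and>
      (\<forall>x\<in>S. (\<Sum>y\<in>P. \<bar>w x y\<bar>) \<le> 3 ^ D \<and> (kernel_norm K (residual x P (w x)))\<^sup>2 \<le> C * h ^ m))"
proof -
  interpret pd_kernel X K by fact
  obtain h0 B a where h0: "h0 > 0" and B: "B \<ge> 0"
    and taylor_all: "\<forall>c\<in>X. \<forall>x\<in>X. \<forall>u\<in>X. dist x c \<le> h0 \<longrightarrow>
      \<bar>K x u - (\<Sum>k<m. \<Sum>l\<in>basis_words k. word_monomial l (x - c) * a c u l)\<bar> \<le> B * dist x c ^ m"
    using kernel_taylor[OF X K(1) m] by (elim exE conjE)
  have taylor: "\<bar>K x u - (\<Sum>k<m. \<Sum>l\<in>basis_words k. word_monomial l (x - c) * a c u l)\<bar> \<le> B * dist x c ^ m"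
    if "c \<in> X" "x \<in> X" "u \<in> X" "dist x c \<le> h0" for c x u
    using taylor_all that by blast
  define I where "I = (\<Union>k<m. basis_words k :: 'a list set)"
  have I: "finite I" by (simp add: I_def finite_basis_words)
  define E :: real where "E = 3 ^ card I"
  have key: "\<exists>P w. finite P \<and> P \<subseteq> S \<and> card P \<le> card I \<and>
      (\<forall>x\<in>S. (\<Sum>y\<in>P. \<bar>w x y\<bar>) \<le> E \<and> (kernel_norm K (residual x P (w x)))\<^sup>2 \<le> (E * E * B) * h ^ m)"
    if S: "S \<subseteq> X" and h: "0 < h" "h \<le> h0" and diam: "\<And>x y. x \<in> S \<Longrightarrow> y \<in> S \<Longrightarrow> dist x y \<le> h" for S h
  proof (cases "S = {}")
    case True
    then show ?thesis by (intro exI[of _ "{}"]) auto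
  next
    case False
    then obtain c where c: "c \<in> S" by blast
    have "\<bar>word_monomial l (x - c)\<bar> \<le> max 1 h ^ m" if "l \<in> I" "x \<in> S" for l x
    proof -
      have l: "set l \<subseteq> Basis" "length l \<le> m" using that by (auto simp: I_def basis_words_def)
      have "\<bar>word_monomial l (x - c)\<bar> \<le> norm (x - c) ^ length l" by (rule word_monomial_bound[OF l(1)])
      also have "\<dots> \<le> max 1 h ^ length l"
        using diam[OF that(2) c] by (intro power_mono) (auto simp: dist_norm)
      also have "\<dots> \<le> max 1 h ^ m" using l by (intro power_increasing) auto
      finally show ?thesis .
    qed
    then have "\<forall>l\<in>I. \<forall>x\<in>S. \<bar>word_monomial l (x - c)\<bar> \<le> max 1 h ^ m" by blast
    from bounded_interpolation[OF I this]
    obtain P w where P: "finite P" "P \<subseteq> S" "card P \<le> card I"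
      and Pw: "\<forall>x\<in>S. (\<forall>l\<in>I. word_monomial l (x - c) = (\<Sum>y\<in>P. w x y * word_monomial l (y - c))) \<and>
        1 + (\<Sum>y\<in>P. \<bar>w x y\<bar>) \<le> 3 ^ card I"
      by (elim exE conjE)
    have ann: "word_monomial l (x - c) = (\<Sum>y\<in>P. w x y * word_monomial l (y - c))" if "x \<in> S" "l \<in> I" for x l
      using Pw that by blast
    have w: "1 + (\<Sum>y\<in>P. \<bar>w x y\<bar>) \<le> E" if "x \<in> S" for x
      using Pw that unfolding E_def by blast
    have PX: "P \<subseteq> X" using P S by auto
    have "(kernel_norm K (residual x P (w x)))\<^sup>2 \<le> (E * E * B) * h ^ m" if x: "x \<in> S" for x
    proof -
      have xX: "x \<in> X" using x S by auto
      let ?r = "residual x P (w x)"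
      \<comment> \<open>Boundedness of the functional in the supremum norm over the cell; it is used once in each variable.\<close>
      have bound: "\<bar>g x - (\<Sum>y\<in>P. w x y * g y)\<bar> \<le> E * M"
        if g: "\<And>y. y \<in> S \<Longrightarrow> \<bar>g y\<bar> \<le> M" for g :: "'a \<Rightarrow> real" and M
      proof -
        have M: "0 \<le> M" using g[OF c] by linarith
        have "\<bar>g x - (\<Sum>y\<in>P. w x y * g y)\<bar> \<le> \<bar>g x\<bar> + (\<Sum>y\<in>P. \<bar>w x y * g y\<bar>)"
          using sum_abs[of "\<lambda>y. w x y * g y" P] by linarith
        also have "\<dots> \<le> M + (\<Sum>y\<in>P. \<bar>w x y\<bar> * M)"
          using g x P by (intro add_mono sum_mono) (auto simp: abs_mult intro!: mult_left_mono)
        also have "\<dots> = (1 + (\<Sum>y\<in>P. \<bar>w x y\<bar>)) * M" by (simp add: distrib_right flip: sum_distrib_right)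
        also have "\<dots> \<le> E * M" using w[OF x] M by (rule mult_right_mono)
        finally show ?thesis .
      qed
      have comb: "\<bar>kernel_comb K ?r u\<bar> \<le> E * (B * h ^ m)" if u: "u \<in> X" for u
      proof -
        define T where "T y = (\<Sum>k<m. \<Sum>l\<in>basis_words k. word_monomial l (y - c) * a c u l)" for y
        have "T x = (\<Sum>y\<in>P. w x y * T y)"
        proof -
          have "T x = (\<Sum>k<m. \<Sum>l\<in>basis_words k. \<Sum>y\<in>P. w x y * (word_monomial l (y - c) * a c u l))"
            unfolding T_def
          proof (intro sum.cong refl)
            fix k and l :: "'a list" assume "k \<in> {..<m}" "l \<in> basis_words k"
            then have "l \<in> I" by (auto simp: I_def)
            from ann[OF x this] show "word_monomial l (x - c) * a c u l =
                (\<Sum>y\<in>P. w x y * (word_monomial l (y - c) * a c u l))"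
              by (simp add: sum_distrib_right mult.assoc)
          qed
          also have "\<dots> = (\<Sum>k<m. \<Sum>y\<in>P. \<Sum>l\<in>basis_words k. w x y * (word_monomial l (y - c) * a c u l))"
            by (intro sum.cong refl sum.swap)
          also have "\<dots> = (\<Sum>y\<in>P. w x y * T y)"
            unfolding T_def by (subst sum.swap) (simp add: sum_distrib_left)
          finally show ?thesis .
        qed
        then have "kernel_comb K ?r u = (K x u - T x) - (\<Sum>y\<in>P. w x y * (K y u - T y))"
          by (simp add: kernel_comb_residual[OF P(1)] right_diff_distrib sum_subtractf)
        also have "\<bar>\<dots>\<bar> \<le> E * (B * h ^ m)"
        proof (rule bound)
          fix y assume y: "y \<in> S"
          have "\<bar>K y u - T y\<bar> \<le> B * dist y c ^ m"
            unfolding T_def using y c S u diam[OF y c] h by (intro taylor) auto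
          also have "\<dots> \<le> B * h ^ m" using B diam[OF y c] by (intro mult_left_mono power_mono) auto
          finally show "\<bar>K y u - T y\<bar> \<le> B * h ^ m" .
        qed
        finally show ?thesis .
      qed
      have r: "?r \<in> combs" by (rule residual_in_combs[OF xX P(1) PX])
      have "(kernel_norm K ?r)\<^sup>2 = kernel_comb K ?r x - (\<Sum>y\<in>P. w x y * kernel_comb K ?r y)"
        using inner_residual[OF r xX P(1) PX] r by (simp add: norm_sq)
      also have "\<dots> \<le> E * (E * (B * h ^ m))"
        using bound[of "kernel_comb K ?r" "E * (B * h ^ m)"] comb S by fastforce
      finally show ?thesis by (simp add: mult_ac)
    qed
    moreover have "(\<Sum>y\<in>P. \<bar>w x y\<bar>) \<le> E" if "x \<in> S" for x using w[OF that] by simp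
    ultimately show ?thesis using P by blast
  qed
  have main: "\<forall>S h. S \<subseteq> X \<longrightarrow> 0 < h \<longrightarrow> h \<le> h0 \<longrightarrow> (\<forall>x\<in>S. \<forall>y\<in>S. dist x y \<le> h) \<longrightarrow>
    (\<exists>P w. finite P \<and> P \<subseteq> S \<and> card P \<le> card I \<and>
      (\<forall>x\<in>S. (\<Sum>y\<in>P. \<bar>w x y\<bar>) \<le> E \<and> (kernel_norm K (residual x P (w x)))\<^sup>2 \<le> (E * E * B) * h ^ m))"
    by (intro allI impI key) auto
  have "E * E * B \<ge> 0" using B by (simp add: E_def)
  then show ?thesis using h0 main[unfolded E_def] unfolding E_def by blast
qed

section \<open>Finite nets in balls of the Hilbert space\<close>

lemma floor_mem_interval:
  fixes t r :: real
  assumes "\<bar>t\<bar> \<le> r" "r \<le> real_of_int N"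
  shows "\<lfloor>t\<rfloor> \<in> {-N..N}"
proof -
  have "real_of_int (-N) \<le> t" "t \<le> real_of_int N" using assms by auto
  then show ?thesis by (auto simp: le_floor_iff) linarith
qed

text \<open>Cells of a cubic grid with side \<open>h / DIM('a)\<close>, intersected with \<open>X\<close>.\<close>

lemma grid_cover:
  fixes X :: "'a::euclidean_space set"
  assumes "bounded X"
  shows "\<exists>A>0. \<forall>h. 0 < h \<longrightarrow> h \<le> 1 \<longrightarrow> (\<exists>Q. finite Q \<and> real (card Q) \<le> (A / h) ^ DIM('a) \<and>
    \<Union>Q = X \<and> (\<forall>S\<in>Q. \<forall>x\<in>S. \<forall>y\<in>S. dist x y \<le> h))"
proof -
  obtain B where B: "B > 0" "\<And>x. x \<in> X \<Longrightarrow> norm x \<le> B" using assms bounded_pos by blast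
  define n where "n = real DIM('a)"
  have n: "n \<ge> 1" using DIM_positive[where 'a='a] unfolding n_def by linarith
  define A where "A = 2 * B * n + 5"
  have "\<exists>Q. finite Q \<and> real (card Q) \<le> (A / h) ^ DIM('a) \<and>
    \<Union>Q = X \<and> (\<forall>S\<in>Q. \<forall>x\<in>S. \<forall>y\<in>S. dist x y \<le> h)" if h: "0 < h" "h \<le> 1" for h
  proof -
    define s where "s = h / n"
    have s: "s > 0" using h n by (simp add: s_def)
    define cell where "cell x = restrict (\<lambda>b. \<lfloor>(x \<bullet> b) / s\<rfloor>) Basis" for x :: 'a
    define N where "N = \<lceil>B / s\<rceil> + 1"
    define G where "G = (Basis :: 'a set) \<rightarrow>\<^sub>E {-N..N}"
    have G: "finite G" unfolding G_def by (intro finite_PiE) auto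
    have N: "0 \<le> B / s" "real_of_int N \<le> B / s + 2" "B / s + 1 \<le> real_of_int N" unfolding N_def using B s by (simp, linarith+)
    have cell: "cell x \<in> G" if x: "x \<in> X" for x
    proof -
      have "\<lfloor>(x \<bullet> b) / s\<rfloor> \<in> {-N..N}" if b: "b \<in> Basis" for b
      proof -
        have "\<bar>x \<bullet> b\<bar> \<le> B" using Basis_le_norm[OF b, of x] B(2)[OF x] by linarith
        then have "\<bar>(x \<bullet> b) / s\<bar> \<le> B / s" using s by (simp add: divide_right_mono)
        then show ?thesis by (rule floor_mem_interval) (use N in linarith)
      qed
      then show ?thesis by (auto simp: cell_def G_def)
    qed
    define Q where "Q = (\<lambda>g. {x \<in> X. cell x = g}) ` G"
    have "card Q \<le> card G" unfolding Q_def by (rule card_image_le[OF G])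
    also have "card G = nat (2 * N + 1) ^ DIM('a)" unfolding G_def by (subst card_PiE) (auto simp: algebra_simps)
    finally have "real (card Q) \<le> real (nat (2 * N + 1) ^ DIM('a))" by (rule of_nat_mono)
    also have "\<dots> = real (nat (2 * N + 1)) ^ DIM('a)" by simp
    also have "\<dots> \<le> (A / h) ^ DIM('a)"
    proof (rule power_mono)
      have "real (nat (2 * N + 1)) = 2 * real_of_int N + 1" using N by simp
      also have "\<dots> \<le> 2 * (B / s) + 5" using N by simp
      also have "\<dots> \<le> A / h" using h n B by (simp add: s_def A_def field_simps)
      finally show "real (nat (2 * N + 1)) \<le> A / h" .
    qed simp
    finally have "real (card Q) \<le> (A / h) ^ DIM('a)" .
    moreover have "\<Union>Q = X" using cell by (auto simp: Q_def)
    moreover have "dist x y \<le> h" if S: "S \<in> Q" "x \<in> S" "y \<in> S" for S x y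
    proof -
      have eq: "cell x = cell y" using S by (auto simp: Q_def)
      have "\<bar>(x - y) \<bullet> b\<bar> \<le> s" if b: "b \<in> Basis" for b
      proof -
        have "\<lfloor>(x \<bullet> b) / s\<rfloor> = \<lfloor>(y \<bullet> b) / s\<rfloor>" using fun_cong[OF eq, of b] b by (simp add: cell_def)
        then have "\<bar>(x \<bullet> b) / s - (y \<bullet> b) / s\<bar> \<le> 1" by linarith
        then have "\<bar>(x - y) \<bullet> b\<bar> / s \<le> 1" using s by (simp add: inner_diff_left flip: diff_divide_distrib)
        then show ?thesis using s by simp
      qed
      then have "(\<Sum>b\<in>Basis. \<bar>(x - y) \<bullet> b\<bar>) \<le> (\<Sum>b\<in>(Basis :: 'a set). s)" by (rule sum_mono)
      also have "\<dots> = h" using n by (simp add: s_def n_def)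
      finally show ?thesis using norm_le_l1[of "x - y"] by (simp add: dist_norm)
    qed
    ultimately show ?thesis using G by (intro exI[of _ Q]) (auto simp: Q_def)
  qed
  moreover have "A > 0" using B n by (simp add: A_def add_pos_pos)
  ultimately show ?thesis by blast
qed

definition rkhs_ball :: "'a set \<Rightarrow> ('a \<Rightarrow> 'a \<Rightarrow> real) \<Rightarrow> real \<Rightarrow> ('a \<Rightarrow> real) set" where
  "rkhs_ball X K R = {f \<in> rkhs X K. rkhs_norm X K f \<le> R}"

text \<open>Two functions of the ball whose values at all nodes round to the same multiples of \<open>\<eta>\<close> differ little
everywhere: each is within \<open>R * e\<close> of its interpolant, and the interpolants differ by at most \<open>W * \<eta>\<close>.
One representative per attained code forms the net; being an element of the ball, it is a measurable function.\<close>

lemma (in pd_kernel) net_from_interpolation: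
  assumes Q: "finite Q" "X \<subseteq> \<Union>Q"
    and P: "\<And>S. S \<in> Q \<Longrightarrow> finite (P S)" "\<And>S. S \<in> Q \<Longrightarrow> P S \<subseteq> X" "\<And>S. S \<in> Q \<Longrightarrow> card (P S) \<le> D"
    and w: "\<And>S x. S \<in> Q \<Longrightarrow> x \<in> S \<Longrightarrow> (\<Sum>y\<in>P S. \<bar>w S x y\<bar>) \<le> W"
    and res: "\<And>S x. S \<in> Q \<Longrightarrow> x \<in> S \<Longrightarrow> kernel_norm K (residual x (P S) (w S x)) \<le> e"
    and diag: "\<And>x. x \<in> X \<Longrightarrow> sqrt (K x x) \<le> \<kappa>" and par: "0 \<le> \<kappa>" "0 \<le> R" "0 < \<eta>"
  shows "\<exists>\<N>. finite \<N> \<and> \<N> \<subseteq> rkhs_ball X K R \<and> real (card \<N>) \<le> (2 * (\<kappa> * R / \<eta>) + 5) ^ (card Q * D) \<and>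
    (\<forall>f\<in>rkhs_ball X K R. \<exists>g\<in>\<N>. \<forall>x\<in>X. \<bar>f x - g x\<bar> \<le> 2 * R * e + W * \<eta>)"
proof -
  let ?F = "rkhs_ball X K R"
  define pts where "pts = (\<Union>S\<in>Q. P S)"
  have pts: "finite pts" "pts \<subseteq> X" using P Q by (auto simp: pts_def)
  have "card pts \<le> (\<Sum>S\<in>Q. card (P S))" unfolding pts_def by (rule card_UN_le[OF Q(1)])
  also have "\<dots> \<le> card Q * D" using P(3) sum_bounded_above[of Q "\<lambda>S. card (P S)" D] by simp
  finally have card_pts: "card pts \<le> card Q * D" .
  define code where "code f = restrict (\<lambda>y. \<lfloor>f y / \<eta>\<rfloor>) pts" for f :: "'a \<Rightarrow> real"
  define L where "L = \<lceil>\<kappa> * R / \<eta>\<rceil> + 1"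
  have L: "0 \<le> \<kappa> * R / \<eta>" "real_of_int L \<le> \<kappa> * R / \<eta> + 2" "\<kappa> * R / \<eta> + 1 \<le> real_of_int L"
    unfolding L_def using par by (simp, linarith+)
  define G where "G = pts \<rightarrow>\<^sub>E {-L..L}"
  have G: "finite G" unfolding G_def by (intro finite_PiE) (use pts in auto)
  have code: "code f \<in> G" if f: "f \<in> ?F" for f
  proof -
    have "\<lfloor>f y / \<eta>\<rfloor> \<in> {-L..L}" if y: "y \<in> pts" for y
    proof -
      have yX: "y \<in> X" using y pts by auto
      have fK: "f \<in> rkhs X K" "rkhs_norm X K f \<le> R" using f by (auto simp: rkhs_ball_def)
      have "\<bar>f y\<bar> \<le> rkhs_norm X K f * sqrt (K y y)" by (rule rkhs_bound[OF fK(1) yX])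
      also have "\<dots> \<le> R * \<kappa>" using fK diag[OF yX] par rkhs_norm_nonneg[OF fK(1)] kernel_diag_nonneg[OF yX]
        by (intro mult_mono) auto
      finally have "\<bar>f y / \<eta>\<bar> \<le> \<kappa> * R / \<eta>" using par by (simp add: divide_right_mono mult.commute)
      then show ?thesis by (rule floor_mem_interval) (use L in linarith)
    qed
    then show ?thesis by (auto simp: code_def G_def)
  qed
  define rep where "rep k = (SOME f. f \<in> ?F \<and> code f = k)" for k
  have rep: "rep (code f) \<in> ?F" "code (rep (code f)) = code f" if "f \<in> ?F" for f
    using someI[of "\<lambda>g. g \<in> ?F \<and> code g = code f" f] that unfolding rep_def by auto
  define \<N> where "\<N> = rep ` code ` ?F"
  have fin: "finite (code ` ?F)" using code G by (meson finite_subset image_subsetI)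
  have "card \<N> \<le> card (code ` ?F)" unfolding \<N>_def by (rule card_image_le[OF fin])
  also have "\<dots> \<le> card G" using code G by (intro card_mono) auto
  also have "\<dots> = nat (2 * L + 1) ^ card pts" unfolding G_def by (subst card_PiE[OF pts(1)]) (auto simp: algebra_simps)
  also have "\<dots> \<le> nat (2 * L + 1) ^ (card Q * D)" using card_pts L by (intro power_increasing) linarith+
  finally have "real (card \<N>) \<le> real (nat (2 * L + 1) ^ (card Q * D))" by (rule of_nat_mono)
  also have "\<dots> = real (nat (2 * L + 1)) ^ (card Q * D)" by simp
  also have "\<dots> \<le> (2 * (\<kappa> * R / \<eta>) + 5) ^ (card Q * D)" using L by (intro power_mono) auto
  finally have card: "real (card \<N>) \<le> (2 * (\<kappa> * R / \<eta>) + 5) ^ (card Q * D)" .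
  have "\<bar>f x - rep (code f) x\<bar> \<le> 2 * R * e + W * \<eta>" if f: "f \<in> ?F" and x: "x \<in> X" for f x
  proof -
    obtain S where S: "S \<in> Q" "x \<in> S" using Q x by auto
    have err: "\<bar>h x - (\<Sum>y\<in>P S. w S x y * h y)\<bar> \<le> R * e" if h: "h \<in> ?F" for h
    proof -
      have hK: "h \<in> rkhs X K" "rkhs_norm X K h \<le> R" using h by (auto simp: rkhs_ball_def)
      have "\<bar>h x - (\<Sum>y\<in>P S. w S x y * h y)\<bar> \<le> rkhs_norm X K h * kernel_norm K (residual x (P S) (w S x))"
        by (rule interpolation_error[OF hK(1) x P(1,2)[OF S(1)]])
      also have "\<dots> \<le> R * e"
        using hK res[OF S] par norm_nonneg[OF residual_in_combs[OF x P(1,2)[OF S(1)]]]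
        by (intro mult_mono) auto
      finally show ?thesis .
    qed
    have "\<bar>(\<Sum>y\<in>P S. w S x y * f y) - (\<Sum>y\<in>P S. w S x y * rep (code f) y)\<bar>
        = \<bar>\<Sum>y\<in>P S. w S x y * (f y - rep (code f) y)\<bar>"
      by (simp add: right_diff_distrib sum_subtractf)
    also have "\<dots> \<le> (\<Sum>y\<in>P S. \<bar>w S x y\<bar> * \<eta>)"
    proof (intro order_trans[OF sum_abs] sum_mono)
      fix y assume y: "y \<in> P S"
      then have "y \<in> pts" using S by (auto simp: pts_def)
      then have "\<lfloor>f y / \<eta>\<rfloor> = \<lfloor>rep (code f) y / \<eta>\<rfloor>"
        using fun_cong[OF rep(2)[OF f], of y] by (simp add: code_def)
      then have "\<bar>f y / \<eta> - rep (code f) y / \<eta>\<bar> \<le> 1" by linarith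
      then have "\<bar>f y - rep (code f) y\<bar> / \<eta> \<le> 1" using par by (simp flip: diff_divide_distrib)
      then show "\<bar>w S x y * (f y - rep (code f) y)\<bar> \<le> \<bar>w S x y\<bar> * \<eta>"
        using par by (simp add: abs_mult mult_left_mono)
    qed
    also have "\<dots> = (\<Sum>y\<in>P S. \<bar>w S x y\<bar>) * \<eta>" by (simp add: sum_distrib_right)
    also have "\<dots> \<le> W * \<eta>" using w[OF S] par by (intro mult_right_mono) auto
    finally show ?thesis using err[OF f] err[OF rep(1)[OF f]] by linarith
  qed
  then show ?thesis using card fin rep(1)
    by (intro exI[of _ \<N>]) (auto simp: \<N>_def)
qed

text \<open>The mesh is \<open>h = a * T powr (-\<gamma>)\<close>.  A small exponent \<open>\<gamma>\<close> keeps the number of cells below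
\<open>T powr (p/2)\<close> up to a constant, and a correspondingly large order \<open>m\<close> of interpolation still makes the error
\<open>sqrt T * h powr (m/2)\<close> smaller than \<open>1/T\<close>.  The logarithm of the number of values per node is absorbed by the
other half \<open>T powr (p/2)\<close>.\<close>

theorem rkhs_ball_net:
  fixes X :: "'a::euclidean_space set"
  assumes X: "compact X" and M: "mercer_kernel X K" and K: "smooth_kernel_on X K" and p: "p > 0"
  shows "\<exists>C\<ge>0. \<forall>T\<ge>1. \<exists>\<N>. finite \<N> \<and> \<N> \<subseteq> rkhs_ball X K (sqrt T) \<and> real (card \<N>) \<le> exp (C * T powr p) \<and>
    (\<forall>f\<in>rkhs_ball X K (sqrt T). \<exists>g\<in>\<N>. \<forall>x\<in>X. \<bar>f x - g x\<bar> \<le> 1 / T)"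
proof -
  have pd: "pd_kernel X K" using M by (simp add: mercer_kernel_def pd_kernel_def)
  interpret pd_kernel X K by (rule pd)
  define n where "n = DIM('a)"
  have n: "n \<ge> 1" using DIM_positive[where 'a='a] unfolding n_def by linarith
  define \<gamma> where "\<gamma> = p / (2 * real n)"
  have \<gamma>: "\<gamma> > 0" using p n by (simp add: \<gamma>_def)
  define m where "m = Suc (nat \<lceil>3 / \<gamma>\<rceil>)"
  have m: "m > 0" "3 \<le> \<gamma> * real m"
  proof -
    have "3 / \<gamma> \<le> real m" unfolding m_def by linarith
    then show "3 \<le> \<gamma> * real m" using \<gamma> by (simp add: field_simps)
  qed (simp add: m_def)
  obtain h0 C2 D where h0: "h0 > 0" and C2: "C2 \<ge> 0" and
    interp: "\<forall>S h. S \<subseteq> X \<longrightarrow> 0 < h \<longrightarrow> h \<le> h0 \<longrightarrow> (\<forall>x\<in>S. \<forall>y\<in>S. dist x y \<le> h) \<longrightarrow>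
    (\<exists>P w. finite P \<and> P \<subseteq> S \<and> card P \<le> D \<and>
      (\<forall>x\<in>S. (\<Sum>y\<in>P. \<bar>w x y\<bar>) \<le> 3 ^ D \<and> (kernel_norm K (residual x P (w x)))\<^sup>2 \<le> C2 * h ^ m))"
    using local_interpolation[OF X K pd m(1)] by (elim exE conjE)
  obtain A where A: "A > 0" and cover: "\<forall>h. 0 < h \<longrightarrow> h \<le> 1 \<longrightarrow> (\<exists>Q. finite Q \<and> real (card Q) \<le> (A / h) ^ DIM('a) \<and>
    \<Union>Q = X \<and> (\<forall>S\<in>Q. \<forall>x\<in>S. \<forall>y\<in>S. dist x y \<le> h))"
    using grid_cover[OF compact_imp_bounded[OF X]] by (elim exE conjE)
  obtain \<kappa> where \<kappa>: "\<kappa> \<ge> 0" "\<And>x. x \<in> X \<Longrightarrow> sqrt (K x x) \<le> \<kappa>"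
  proof -
    have "continuous_on (X \<times> X) (\<lambda>(x, u). K x u)" using M by (simp add: mercer_kernel_def)
    then have "bounded ((\<lambda>(x, u). K x u) ` (X \<times> X))"
      using X by (intro compact_imp_bounded compact_continuous_image compact_Times)
    then obtain b where b: "b > 0" "\<And>x u. x \<in> X \<Longrightarrow> u \<in> X \<Longrightarrow> \<bar>K x u\<bar> \<le> b" unfolding bounded_pos by force
    show thesis
    proof (rule that[of "sqrt b"])
      show "sqrt (K x x) \<le> sqrt b" if "x \<in> X" for x using b(2)[OF that that] by simp
    qed (use b in simp)
  qed
  \<comment> \<open>The last entry gives \<open>C2 * a \<le> 1/16\<close>, so that the two interpolation errors use up at most half of \<open>1/T\<close>.\<close>
  define a where "a = min 1 (min h0 (1 / (16 * C2 + 16)))"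
  have a: "0 < a" "a \<le> 1" "a \<le> h0" "C2 * a \<le> 1 / 16"
  proof -
    show "0 < a" using h0 C2 by (simp add: a_def)
    have "C2 * a \<le> C2 * (1 / (16 * C2 + 16))" using C2 by (intro mult_left_mono) (auto simp: a_def)
    also have "\<dots> \<le> 1 / 16" using C2 by (simp add: field_simps)
    finally show "C2 * a \<le> 1 / 16" .
  qed (simp_all add: a_def)
  define W :: real where "W = 3 ^ D"
  have W: "W > 0" by (simp add: W_def)
  define C3 where "C3 = 4 * \<kappa> * W + 5"
  have C3: "C3 \<ge> 1" using \<kappa> W by (simp add: C3_def)
  define C4 where "C4 = ln C3 + 4 / p"
  have C4: "C4 \<ge> 0" using C3 p by (simp add: C4_def)
  define C5 where "C5 = (A / a) ^ n"
  have C5: "C5 \<ge> 0" using A a by (simp add: C5_def)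
  have "\<exists>\<N>. finite \<N> \<and> \<N> \<subseteq> rkhs_ball X K (sqrt T) \<and> real (card \<N>) \<le> exp ((C5 * real D * C4) * T powr p) \<and>
    (\<forall>f\<in>rkhs_ball X K (sqrt T). \<exists>g\<in>\<N>. \<forall>x\<in>X. \<bar>f x - g x\<bar> \<le> 1 / T)" if T: "T \<ge> 1" for T
  proof -
    define h where "h = a * T powr (- \<gamma>)"
    have "T powr (- \<gamma>) \<le> T powr 0" using T \<gamma> by (intro powr_mono) auto
    then have Tg: "T powr (- \<gamma>) \<le> 1" using T by simp
    have "h \<le> a * 1" unfolding h_def using a Tg by (intro mult_left_mono) auto
    moreover have "0 < h" using a T by (simp add: h_def)
    ultimately have h: "0 < h" "h \<le> 1" "h \<le> h0" using a by linarith+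
    obtain Q where Q: "finite Q" "real (card Q) \<le> (A / h) ^ n" "\<Union>Q = X"
      "\<forall>S\<in>Q. \<forall>x\<in>S. \<forall>y\<in>S. dist x y \<le> h"
      using cover h(1,2) unfolding n_def by blast
    have "\<forall>S\<in>Q. \<exists>P w. finite P \<and> P \<subseteq> S \<and> card P \<le> D \<and>
      (\<forall>x\<in>S. (\<Sum>y\<in>P. \<bar>w x y\<bar>) \<le> 3 ^ D \<and> (kernel_norm K (residual x P (w x)))\<^sup>2 \<le> C2 * h ^ m)"
    proof
      fix S assume S: "S \<in> Q"
      then have SX: "S \<subseteq> X" using Q(3) by blast
      have diam: "\<forall>x\<in>S. \<forall>y\<in>S. dist x y \<le> h" using Q(4) S by blast
      show "\<exists>P w. finite P \<and> P \<subseteq> S \<and> card P \<le> D \<and>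
          (\<forall>x\<in>S. (\<Sum>y\<in>P. \<bar>w x y\<bar>) \<le> 3 ^ D \<and> (kernel_norm K (residual x P (w x)))\<^sup>2 \<le> C2 * h ^ m)"
        by (rule interp[THEN spec, THEN spec, THEN mp, THEN mp, THEN mp, THEN mp, OF SX h(1) h(3) diam])
    qed
    from bchoice[OF this] obtain P where P: "\<forall>S\<in>Q. \<exists>w. finite (P S) \<and> P S \<subseteq> S \<and> card (P S) \<le> D \<and>
      (\<forall>x\<in>S. (\<Sum>y\<in>P S. \<bar>w x y\<bar>) \<le> 3 ^ D \<and> (kernel_norm K (residual x (P S) (w x)))\<^sup>2 \<le> C2 * h ^ m)"
      by (elim exE)
    from bchoice[OF this] obtain w where Pw: "\<forall>S\<in>Q. finite (P S) \<and> P S \<subseteq> S \<and> card (P S) \<le> D \<and>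
      (\<forall>x\<in>S. (\<Sum>y\<in>P S. \<bar>w S x y\<bar>) \<le> 3 ^ D \<and> (kernel_norm K (residual x (P S) (w S x)))\<^sup>2 \<le> C2 * h ^ m)"
      by (elim exE)
    define e where "e = sqrt (C2 * h ^ m)"
    \<comment> \<open>Rounding uses up the other half of \<open>1/T\<close>.\<close>
    define \<eta> where "\<eta> = 1 / (2 * W * T)"
    have \<eta>: "\<eta> > 0" using W T by (simp add: \<eta>_def)
    have hm: "h ^ m \<le> a * T powr (-3)"
    proof -
      have "h ^ m = a ^ m * T powr (- \<gamma> * real m)"
        using T by (simp add: h_def power_mult_distrib powr_powr flip: powr_realpow)
      also have "\<dots> \<le> a * T powr (-3)"
      proof (rule mult_mono)
        show "a ^ m \<le> a" using power_decreasing[of 1 m a] a m by simp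
        show "T powr (- \<gamma> * real m) \<le> T powr (-3)" using T m by (intro powr_mono) auto
      qed (use a in auto)
      finally show ?thesis .
    qed
    have "sqrt T * e = sqrt (T * (C2 * h ^ m))" by (simp add: e_def real_sqrt_mult)
    also have "\<dots> \<le> sqrt (1 / (4 * T) ^ 2)"
    proof (rule real_sqrt_le_mono)
      have "T * (C2 * h ^ m) \<le> T * (C2 * (a * T powr (-3)))"
        using T C2 hm by (intro mult_left_mono) auto
      also have "\<dots> = (C2 * a) * (T * T powr (-3))" by simp
      also have "\<dots> \<le> (1 / 16) * (T * T powr (-3))" using a T by (intro mult_right_mono) auto
      also have "T * T powr (-3) = T powr (1 + (-3))" using T by (subst powr_add) simp
      also have "\<dots> = 1 / T ^ 2" using T by (simp add: powr_minus powr_numeral inverse_eq_divide)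
      finally show "T * (C2 * h ^ m) \<le> 1 / (4 * T) ^ 2" by (simp add: power_mult_distrib)
    qed
    also have "\<dots> = 1 / (4 * T)"
      using T by (simp only: real_sqrt_divide real_sqrt_one real_sqrt_abs)
    finally have e: "2 * sqrt T * e + W * \<eta> \<le> 1 / T" using T W by (simp add: \<eta>_def field_simps)
    have "\<exists>\<N>. finite \<N> \<and> \<N> \<subseteq> rkhs_ball X K (sqrt T) \<and>
      real (card \<N>) \<le> (2 * (\<kappa> * sqrt T / \<eta>) + 5) ^ (card Q * D) \<and>
      (\<forall>f\<in>rkhs_ball X K (sqrt T). \<exists>g\<in>\<N>. \<forall>x\<in>X. \<bar>f x - g x\<bar> \<le> 2 * sqrt T * e + W * \<eta>)"
    proof (rule net_from_interpolation[where P = P and w = w])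
      show "P S \<subseteq> X" if "S \<in> Q" for S using Pw that Q(3) by blast
      show "(\<Sum>y\<in>P S. \<bar>w S x y\<bar>) \<le> W" if "S \<in> Q" "x \<in> S" for S x
        using Pw that unfolding W_def by blast
      show "kernel_norm K (residual x (P S) (w S x)) \<le> e" if "S \<in> Q" "x \<in> S" for S x
      proof -
        have "(kernel_norm K (residual x (P S) (w S x)))\<^sup>2 \<le> C2 * h ^ m" using Pw that by blast
        then show ?thesis unfolding e_def by (rule real_le_rsqrt)
      qed
    qed (use Q Pw \<kappa> T \<eta> in auto)
    then obtain \<N> where N: "finite \<N>" "\<N> \<subseteq> rkhs_ball X K (sqrt T)"
      "real (card \<N>) \<le> (2 * (\<kappa> * sqrt T / \<eta>) + 5) ^ (card Q * D)"
      "\<forall>f\<in>rkhs_ball X K (sqrt T). \<exists>g\<in>\<N>. \<forall>x\<in>X. \<bar>f x - g x\<bar> \<le> 2 * sqrt T * e + W * \<eta>" by blast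
    have base: "2 * (\<kappa> * sqrt T / \<eta>) + 5 \<le> C3 * T ^ 2"
    proof -
      have "sqrt T \<le> sqrt (T ^ 2)" using T by (intro real_sqrt_le_mono) (simp add: power2_eq_square)
      then have "sqrt T \<le> T" using T by simp
      then have "4 * \<kappa> * W * (sqrt T * T) \<le> 4 * \<kappa> * W * (T * T)"
        using \<kappa> W T by (intro mult_left_mono mult_right_mono) auto
      moreover have "2 * (\<kappa> * sqrt T / \<eta>) = 4 * \<kappa> * W * (sqrt T * T)" by (simp add: \<eta>_def)
      moreover have "5 \<le> 5 * T ^ 2" using T by simp
      ultimately show ?thesis by (simp add: C3_def power2_eq_square algebra_simps)
    qed
    have base0: "0 < 2 * (\<kappa> * sqrt T / \<eta>) + 5" using \<kappa> T \<eta> by (intro add_nonneg_pos) auto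
    have lnb: "ln (2 * (\<kappa> * sqrt T / \<eta>) + 5) \<le> C4 * T powr (p / 2)"
    proof -
      have "ln (2 * (\<kappa> * sqrt T / \<eta>) + 5) \<le> ln (C3 * T ^ 2)" using base base0 by (rule ln_mono)
      also have "\<dots> = ln C3 + 2 * ln T" using C3 T by (simp add: ln_mult ln_realpow)
      also have "\<dots> \<le> ln C3 * T powr (p / 2) + 2 * (T powr (p / 2) / (p / 2))"
      proof (intro add_mono mult_left_mono ln_powr_bound)
        have "1 \<le> T powr (p / 2)" using T p by (intro ge_one_powr_ge_zero) auto
        then show "ln C3 \<le> ln C3 * T powr (p / 2)" using C3 by (simp add: mult_le_cancel_left1)
      qed (use T p in auto)
      also have "\<dots> = C4 * T powr (p / 2)" by (simp add: C4_def algebra_simps)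
      finally show ?thesis .
    qed
    have Qb: "real (card Q) \<le> C5 * T powr (p / 2)"
    proof -
      have "(A / h) ^ n = (A / a) ^ n * (T powr \<gamma>) ^ n"
        by (simp add: h_def powr_minus power_mult_distrib[symmetric] divide_inverse mult.assoc)
      also have "(T powr \<gamma>) ^ n = T powr (p / 2)"
        using T n by (simp add: powr_powr \<gamma>_def flip: powr_realpow)
      finally show ?thesis using Q(2) by (simp add: C5_def)
    qed
    have "real (card \<N>) \<le> (2 * (\<kappa> * sqrt T / \<eta>) + 5) ^ (card Q * D)" by (rule N(3))
    also have "\<dots> = exp (real (card Q * D) * ln (2 * (\<kappa> * sqrt T / \<eta>) + 5))"
      using base0 by (simp add: powr_def flip: powr_realpow)
    also have "\<dots> \<le> exp ((C5 * real D * C4) * T powr p)"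
    proof -
      have "real (card Q * D) * ln (2 * (\<kappa> * sqrt T / \<eta>) + 5) \<le>
          (C5 * T powr (p / 2) * real D) * (C4 * T powr (p / 2))"
      proof (rule mult_mono)
        show "real (card Q * D) \<le> C5 * T powr (p / 2) * real D" using Qb by (simp add: mult_right_mono)
        have "0 \<le> \<kappa> * sqrt T / \<eta>" using \<kappa> T \<eta> by auto
        then show "0 \<le> ln (2 * (\<kappa> * sqrt T / \<eta>) + 5)" by (intro ln_ge_zero) linarith
      qed (use lnb C5 in auto)
      also have "\<dots> = (C5 * real D * C4) * (T powr (p / 2) * T powr (p / 2))" by simp
      also have "T powr (p / 2) * T powr (p / 2) = T powr p" by (simp flip: powr_add)
      finally show ?thesis by simp
    qed
    finally have "real (card \<N>) \<le> exp ((C5 * real D * C4) * T powr p)" .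
    moreover have "\<forall>f\<in>rkhs_ball X K (sqrt T). \<exists>g\<in>\<N>. \<forall>x\<in>X. \<bar>f x - g x\<bar> \<le> 1 / T"
      using N(4) e by (meson order_trans)
    ultimately show ?thesis using N(1,2) by blast
  qed
  moreover have "0 \<le> C5 * real D * C4" using C4 C5 by simp
  ultimately show ?thesis by blast
qed

section \<open>Curvature of the noise-averaged loss\<close>

lemma powr_MVT:
  fixes a b q :: real
  assumes "0 \<le> a" "a < b" "0 < q"
  obtains z where "a < z" "z < b" "b powr q - a powr q = (b - a) * (q * z powr (q - 1))"
proof -
  have "\<exists>l z. a < z \<and> z < b \<and> DERIV (\<lambda>x. x powr q) z :> l \<and> b powr q - a powr q = (b - a) * l"
  proof (rule MVT[OF \<open>a < b\<close>])
    show "continuous_on {a..b} (\<lambda>x. x powr q)"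
      using assms by (intro continuous_on_powr' continuous_intros) auto
    show "(\<lambda>x. x powr q) differentiable (at x)" if "a < x" for x
      using has_real_derivative_powr[of x q] assms that by (auto simp: real_differentiable_def)
  qed
  then obtain l z where z: "a < z" "z < b" "DERIV (\<lambda>x. x powr q) z :> l" "b powr q - a powr q = (b - a) * l"
    by blast
  have "DERIV (\<lambda>x. x powr q) z :> q * z powr (q - 1)"
    using assms z by (intro has_real_derivative_powr) auto
  then have "l = q * z powr (q - 1)" using z(3) DERIV_unique by blast
  then show thesis using that z by blast
qed

lemma powr_lipschitz:
  fixes a b q B :: real
  assumes "0 \<le> a" "a \<le> B" "0 \<le> b" "b \<le> B" "1 \<le> q"
  shows "\<bar>a powr q - b powr q\<bar> \<le> q * B powr (q - 1) * \<bar>a - b\<bar>"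
proof -
  have *: "\<bar>v powr q - u powr q\<bar> \<le> q * B powr (q - 1) * \<bar>v - u\<bar>" if uv: "0 \<le> u" "u < v" "v \<le> B" for u v
  proof -
    obtain z where z: "u < z" "z < v" "v powr q - u powr q = (v - u) * (q * z powr (q - 1))"
      using powr_MVT[of u v q] uv assms by auto
    have "z powr (q - 1) \<le> B powr (q - 1)" using z uv assms by (intro powr_mono2) auto
    then have "(v - u) * (q * z powr (q - 1)) \<le> (v - u) * (q * B powr (q - 1))"
      using uv assms by (intro mult_left_mono) auto
    moreover have "0 \<le> (v - u) * (q * z powr (q - 1))" using uv assms by simp
    ultimately show ?thesis using z uv by (simp add: mult_ac)
  qed
  consider "a < b" | "a = b" | "b < a" by linarith
  then show ?thesis using *[of a b] *[of b a] assms by cases (auto simp: abs_minus_commute)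
qed

lemma powr_above_tangent:
  fixes v y q :: real
  assumes "0 \<le> v" "0 < y" "1 \<le> q"
  shows "y powr q + q * y powr (q - 1) * (v - y) \<le> v powr q"
proof -
  consider "v < y" | "v = y" | "y < v" by linarith
  then show ?thesis
  proof cases
    case 1
    then obtain z where z: "v < z" "z < y" "y powr q - v powr q = (y - v) * (q * z powr (q - 1))"
      using powr_MVT[of v y q] assms by auto
    have "(y - v) * (q * z powr (q - 1)) \<le> (y - v) * (q * y powr (q - 1))"
      using z assms 1 by (intro mult_left_mono powr_mono2) auto
    then show ?thesis using z by (simp add: algebra_simps)
  next
    case 3
    then obtain z where z: "y < z" "z < v" "v powr q - y powr q = (v - y) * (q * z powr (q - 1))"
      using powr_MVT[of y v q] assms by auto
    have "(v - y) * (q * y powr (q - 1)) \<le> (v - y) * (q * z powr (q - 1))"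
      using z assms 3 by (intro mult_left_mono powr_mono2) auto
    then show ?thesis using z by (simp add: algebra_simps)
  qed simp
qed

text \<open>The derivative of \<open>u \<mapsto> \<bar>u\<bar> powr q\<close>.\<close>

definition loss_slope :: "real \<Rightarrow> real \<Rightarrow> real" where
  "loss_slope q u = q * sgn u * \<bar>u\<bar> powr (q - 1)"

lemma abs_powr_above_tangent:
  fixes u t q :: real
  assumes "1 < q"
  shows "\<bar>u\<bar> powr q - t * loss_slope q u \<le> \<bar>u - t\<bar> powr q"
proof (cases "u = 0")
  case False
  have "q * \<bar>u\<bar> powr (q - 1) * (- t * sgn u) \<le> q * \<bar>u\<bar> powr (q - 1) * (\<bar>u - t\<bar> - \<bar>u\<bar>)"
    using assms by (intro mult_left_mono) (auto simp: sgn_if)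
  moreover have "\<bar>u\<bar> powr q + q * \<bar>u\<bar> powr (q - 1) * (\<bar>u - t\<bar> - \<bar>u\<bar>) \<le> \<bar>u - t\<bar> powr q"
    using False assms by (intro powr_above_tangent) auto
  ultimately show ?thesis by (simp add: loss_slope_def mult_ac)
qed (use assms in \<open>simp add: loss_slope_def\<close>)

text \<open>A lower bound for half the second derivative \<open>q * (q - 1) * z powr (q - 2)\<close> on \<open>1/8 \<le> z \<le> 2\<close>.  The minimum
covers both \<open>q \<ge> 2\<close>, where the second derivative is smallest at \<open>1/8\<close>, and \<open>q < 2\<close>, where it is smallest at
\<open>2\<close>.\<close>

definition curvature :: "real \<Rightarrow> real" where
  "curvature q = q * (q - 1) * min ((1/8) powr (q - 2)) (2 powr (q - 2)) / 2"

lemma curvature_pos: "1 < q \<Longrightarrow> 0 < curvature q"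
  by (simp add: curvature_def)

lemma powr_quadratic_growth:
  fixes a s q :: real
  assumes q: "1 < q" and a: "1/8 \<le> a" "a + s \<le> 2" and s: "0 \<le> s"
  shows "a powr q + q * a powr (q - 1) * s + curvature q * s\<^sup>2 \<le> (a + s) powr q"
proof (cases "s = 0")
  case False
  then have s: "s > 0" using s by simp
  define diff where "diff m t = (if m = 0 then (a + t) powr q else if m = 1 then q * (a + t) powr (q - 1)
      else q * (q - 1) * (a + t) powr (q - 2))" for m :: nat and t :: real
  have "\<exists>t. 0 < t \<and> t < s \<and> diff 0 s = (\<Sum>m<2. diff m 0 / fact m * s ^ m) + diff 2 t / fact 2 * s ^ 2"
  proof (rule Maclaurin[OF s])
    show "\<forall>m t. m < 2 \<and> 0 \<le> t \<and> t \<le> s \<longrightarrow> (diff m has_real_derivative diff (Suc m) t) (at t)"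
    proof (intro allI impI)
      fix m :: nat and t :: real assume mt: "m < 2 \<and> 0 \<le> t \<and> t \<le> s"
      have p: "((\<lambda>t. (a + t) powr r) has_real_derivative r * (a + t) powr (r - 1)) (at t)" for r
      proof -
        have "((\<lambda>t. (a + t) powr r) has_real_derivative r * (a + t) powr (r - 1) * 1) (at t)"
          by (rule DERIV_chain2[where f = "\<lambda>z. z powr r" and g = "\<lambda>t. a + t"])
            (use mt a in \<open>auto intro!: derivative_eq_intros has_real_derivative_powr\<close>)
        then show ?thesis by simp
      qed
      consider "m = 0" | "m = 1" using mt by linarith
      then show "(diff m has_real_derivative diff (Suc m) t) (at t)"
      proof cases
        case 1
        then show ?thesis using p[of q] by (simp add: diff_def[abs_def])
      next
        case 2
        then show ?thesis using DERIV_cmult[OF p[of "q - 1"], of q] by (simp add: diff_def[abs_def] mult.assoc)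
      qed
    qed
  qed auto
  then obtain t where t: "0 < t" "t < s" and
    eq: "(a + s) powr q = a powr q + q * a powr (q - 1) * s + q * (q - 1) * (a + t) powr (q - 2) / 2 * s\<^sup>2"
    by (auto simp: diff_def numeral_2_eq_2)
  have "min ((1/8) powr (q - 2)) (2 powr (q - 2)) \<le> (a + t) powr (q - 2)"
  proof (cases "q \<ge> 2")
    case True
    then have "(1/8) powr (q - 2) \<le> (a + t) powr (q - 2)" using a t by (intro powr_mono2) auto
    then show ?thesis by simp
  next
    case False
    then have "2 powr (q - 2) \<le> (a + t) powr (q - 2)" using a t by (intro powr_mono2') auto
    then show ?thesis by simp
  qed
  then have "q * (q - 1) * min ((1/8) powr (q - 2)) (2 powr (q - 2)) \<le> q * (q - 1) * (a + t) powr (q - 2)"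
    using q by (intro mult_left_mono) auto
  then have "curvature q * s\<^sup>2 \<le> q * (q - 1) * (a + t) powr (q - 2) / 2 * s\<^sup>2"
    unfolding curvature_def by (intro mult_right_mono) auto
  then show ?thesis using eq by linarith
qed simp

text \<open>When \<open>t\<close> and \<open>u\<close> have opposite signs, subtracting \<open>t\<close> moves away from the point \<open>0\<close>, where the loss may be flat or
not twice differentiable, and the expansion stays on a half-line on which the loss is smooth.\<close>

lemma abs_powr_quadratic_growth:
  fixes u t q :: real
  assumes "1 < q" "1/8 \<le> \<bar>u\<bar>" "u * t \<le> 0" "\<bar>u\<bar> + \<bar>t\<bar> \<le> 2"
  shows "\<bar>u\<bar> powr q - t * loss_slope q u + curvature q * t\<^sup>2 \<le> \<bar>u - t\<bar> powr q"
proof -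
  have "\<bar>u - t\<bar> = \<bar>u\<bar> + \<bar>t\<bar>" using assms(3) by (auto simp: mult_le_0_iff abs_if)
  moreover have "- t * sgn u = \<bar>t\<bar>" using assms(2,3) by (auto simp: mult_le_0_iff abs_if sgn_if)
  then have "- (t * loss_slope q u) = q * \<bar>u\<bar> powr (q - 1) * \<bar>t\<bar>"
    unfolding loss_slope_def by (metis (no_types, opaque_lifting) mult.assoc mult.commute mult_minus_right)
  ultimately show ?thesis using powr_quadratic_growth[of q "\<bar>u\<bar>" "\<bar>t\<bar>"] assms by simp
qed

definition noise_density :: "real \<Rightarrow> real \<Rightarrow> real" where
  "noise_density \<phi> u = (if \<bar>u\<bar> \<le> 1/4 then (2 powr (2 * \<phi> + 1) * (\<phi> + 1)) * \<bar>u\<bar> powr \<phi> else 0)"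

lemma noise_density_measurable [measurable]: "noise_density \<phi> \<in> borel_measurable borel"
  unfolding noise_density_def[abs_def] by measurable

lemma loss_slope_measurable [measurable]: "loss_slope q \<in> borel_measurable borel"
  unfolding loss_slope_def[abs_def] by measurable

lemma noise_density_nonneg: "0 < \<phi> \<Longrightarrow> 0 \<le> noise_density \<phi> u"
  by (simp add: noise_density_def)

lemma noise_density_integrable:
  assumes \<phi>: "0 < \<phi>" and g[measurable]: "g \<in> borel_measurable borel" and B: "\<And>u. \<bar>u\<bar> \<le> 1/4 \<Longrightarrow> \<bar>g u\<bar> \<le> B"
  shows "integrable lborel (\<lambda>u. noise_density \<phi> u * g u)"
proof (rule Bochner_Integration.integrable_bound)
  let ?D = "(2 powr (2 * \<phi> + 1) * (\<phi> + 1)) * (1/4) powr \<phi>"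
  show "integrable lborel (\<lambda>u. (?D * B) * indicator {-1/4..1/4 :: real} u)"
    by (intro integrable_mult_right integrable_real_indicator emeasure_bounded_finite) auto
  have B0: "0 \<le> B" using B[of 0] by (simp add: order_trans[OF abs_ge_zero])
  have "\<bar>noise_density \<phi> u * g u\<bar> \<le> \<bar>?D * B * indicator {-1/4..1/4} u\<bar>" for u
  proof (cases "\<bar>u\<bar> \<le> 1/4")
    case True
    have "noise_density \<phi> u \<le> ?D" unfolding noise_density_def using True \<phi>
      by (auto intro!: mult_left_mono powr_mono2)
    then have "\<bar>noise_density \<phi> u * g u\<bar> \<le> ?D * B"
      using B[OF True] noise_density_nonneg[OF \<phi>, of u] unfolding abs_mult by (intro mult_mono) auto
    moreover have "u \<in> {-1/4..1/4}" using True by (auto simp: abs_le_iff)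
    moreover have "0 \<le> ?D * B" using \<phi> B0 by simp
    ultimately show ?thesis by simp
  qed (simp add: noise_density_def)
  then show "AE u in lborel. norm (noise_density \<phi> u * g u) \<le> norm (?D * B * indicator {-1/4..1/4} u)" by simp
qed measurable

text \<open>The density is even and the slope is odd: the centre \<open>f\<^sub>q x\<close> is a critical point of the expected loss.\<close>

lemma noise_slope_integral:
  "(\<integral>u. noise_density \<phi> u * loss_slope q u \<partial>lborel) = 0"
proof -
  let ?I = "\<integral>u. noise_density \<phi> u * loss_slope q u \<partial>lborel"
  have "?I = (\<integral>u. noise_density \<phi> (-u) * loss_slope q (-u) \<partial>lborel)"
    by (subst lborel_integral_real_affine[where c = "-1" and t = 0]) auto
  also have "\<dots> = (\<integral>u. - (noise_density \<phi> u * loss_slope q u) \<partial>lborel)"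
    by (intro Bochner_Integration.integral_cong) (auto simp: noise_density_def loss_slope_def sgn_minus)
  also have "\<dots> = - ?I" by simp
  finally show ?thesis by simp
qed

text \<open>The curvature times a lower bound for the noise mass of \<open>[1/8, 1/4]\<close>, an interval of length \<open>1/8\<close>.\<close>

definition growth_const :: "real \<Rightarrow> real \<Rightarrow> real" where
  "growth_const q \<phi> = curvature q * (2 powr (2 * \<phi> + 1) * (\<phi> + 1) * (1/8) powr \<phi>) / 8"

lemma growth_const_pos: "1 < q \<Longrightarrow> 0 < \<phi> \<Longrightarrow> 0 < growth_const q \<phi>"
  by (simp add: growth_const_def curvature_pos)

text \<open>The tangent inequality holds for every noise value and its linear term averages to zero.  The quadratic gain is
collected on \<open>J\<close>, the noise values with \<open>1/8 \<le> \<bar>u\<bar> \<le> 1/4\<close> whose sign is opposite to that of \<open>t\<close>;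
by symmetry both choices of \<open>J\<close> carry the same mass.\<close>

lemma noise_quadratic_growth:
  assumes q: "1 < q" and \<phi>: "0 < \<phi>" and t: "\<bar>t\<bar> \<le> 5/4"
  shows "growth_const q \<phi> * t\<^sup>2 \<le> (\<integral>u. noise_density \<phi> u * (\<bar>u - t\<bar> powr q - \<bar>u\<bar> powr q) \<partial>lborel)"
proof -
  let ?w = "noise_density \<phi>" and ?D = "2 powr (2 * \<phi> + 1) * (\<phi> + 1) * (1/8) powr \<phi>"
  define J :: "real set" where "J = (if t \<ge> 0 then {-1/4..-1/8} else {1/8..1/4})"
  have J: "J \<in> sets borel" "emeasure lborel J = ennreal (1/8)" "measure lborel J = 1/8"
    by (auto simp: J_def emeasure_lborel_Icc_eq)
  have slope: "integrable lborel (\<lambda>u. ?w u * loss_slope q u)"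
  proof (rule noise_density_integrable[OF \<phi>, where B = "q * (1/4) powr (q - 1)"])
    fix u :: real assume "\<bar>u\<bar> \<le> 1/4"
    then have "q * \<bar>sgn u\<bar> * \<bar>u\<bar> powr (q - 1) \<le> q * 1 * (1/4) powr (q - 1)"
      using q by (intro mult_mono powr_mono2) (auto simp: sgn_if)
    then show "\<bar>loss_slope q u\<bar> \<le> q * (1/4) powr (q - 1)" using q by (simp add: loss_slope_def abs_mult)
  qed measurable
  have int: "integrable lborel (\<lambda>u. ?w u * (\<bar>u - t\<bar> powr q - \<bar>u\<bar> powr q))"
  proof (rule noise_density_integrable[OF \<phi>, where B = "2 powr q + 2 powr q"])
    fix u :: real assume u: "\<bar>u\<bar> \<le> 1/4"
    have "\<bar>u - t\<bar> powr q \<le> 2 powr q" "\<bar>u\<bar> powr q \<le> 2 powr q" using u t q by (auto intro!: powr_mono2)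
    moreover have "0 \<le> \<bar>u - t\<bar> powr q" "0 \<le> \<bar>u\<bar> powr q" by auto
    ultimately show "\<bar>\<bar>u - t\<bar> powr q - \<bar>u\<bar> powr q\<bar> \<le> 2 powr q + 2 powr q" by linarith
  qed measurable
  have indJ: "integrable lborel (indicator J :: real \<Rightarrow> real)" using J by (intro integrable_real_indicator) auto
  have lower: "- t * (?w u * loss_slope q u) + curvature q * t\<^sup>2 * ?D * indicator J u
      \<le> ?w u * (\<bar>u - t\<bar> powr q - \<bar>u\<bar> powr q)" for u
  proof (cases "u \<in> J")
    case True
    then have u: "1/8 \<le> \<bar>u\<bar>" "\<bar>u\<bar> \<le> 1/4" "u * t \<le> 0"
      by (auto simp: J_def mult_le_0_iff split: if_splits)
    have "?D \<le> ?w u" using u \<phi> by (auto simp: noise_density_def intro!: mult_left_mono powr_mono2)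
    then have "?D * (curvature q * t\<^sup>2) \<le> ?w u * (curvature q * t\<^sup>2)"
      using curvature_pos[OF q] by (intro mult_right_mono) auto
    moreover have "?w u * (- t * loss_slope q u + curvature q * t\<^sup>2) \<le> ?w u * (\<bar>u - t\<bar> powr q - \<bar>u\<bar> powr q)"
      using abs_powr_quadratic_growth[OF q u(1,3)] u t noise_density_nonneg[OF \<phi>, of u]
      by (intro mult_left_mono) auto
    ultimately show ?thesis using True by (simp add: algebra_simps)
  next
    case False
    have "?w u * (- t * loss_slope q u) \<le> ?w u * (\<bar>u - t\<bar> powr q - \<bar>u\<bar> powr q)"
      using abs_powr_above_tangent[OF q, of u t] noise_density_nonneg[OF \<phi>, of u]
      by (intro mult_left_mono) auto
    then show ?thesis using False by (simp add: algebra_simps)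
  qed
  have "growth_const q \<phi> * t\<^sup>2 =
      (\<integral>u. - t * (?w u * loss_slope q u) + curvature q * t\<^sup>2 * ?D * indicator J u \<partial>lborel)"
    using slope indJ J by (subst Bochner_Integration.integral_add)
      (auto simp: noise_slope_integral growth_const_def)
  also have "\<dots> \<le> (\<integral>u. ?w u * (\<bar>u - t\<bar> powr q - \<bar>u\<bar> powr q) \<partial>lborel)"
    using slope indJ int lower by (intro integral_mono Bochner_Integration.integrable_add) auto
  finally show ?thesis .
qed

lemma density_noise_integral:
  assumes \<phi>: "0 < \<phi>" and g[measurable]: "g \<in> borel_measurable borel"
  shows "(\<integral>y. g y \<partial>density lborel (\<lambda>y. ennreal (noise_density \<phi> (y - a)))) =
    (\<integral>u. noise_density \<phi> u * g (u + a) \<partial>lborel)"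
proof -
  have "(\<integral>y. g y \<partial>density lborel (\<lambda>y. ennreal (noise_density \<phi> (y - a)))) =
      (\<integral>y. noise_density \<phi> (y - a) * g y \<partial>lborel)"
    by (subst integral_density) (auto simp: noise_density_nonneg[OF \<phi>])
  also have "\<dots> = (\<integral>u. noise_density \<phi> u * g (u + a) \<partial>lborel)"
    by (subst lborel_integral_real_affine[where c = 1 and t = a]) (auto simp: add.commute)
  finally show ?thesis .
qed

lemma AE_density_noise:
  "AE y in density lborel (\<lambda>y. ennreal (noise_density \<phi> (y - a))). \<bar>y - a\<bar> \<le> 1/4"
  by (subst AE_density) (auto simp: noise_density_def)

section \<open>Lower tail of empirical means\<close>

lemma exp_le_quadratic:
  fixes v :: real
  assumes "v \<le> 1" shows "exp v \<le> 1 + v + v\<^sup>2"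
proof (cases "0 \<le> v")
  case True
  then show ?thesis using assms by (rule exp_bound)
next
  case False
  then have e: "1 - v + v\<^sup>2 / 2 \<le> exp (- v)" using exp_lower_Taylor_quadratic[of "-v"] by simp
  have "v * v * v \<le> 0" using False by (simp add: mult_nonneg_nonpos mult_nonpos_nonpos)
  then have "v * v * v \<le> v\<^sup>2" using zero_le_power2[of v] by (rule order_trans)
  then have "0 \<le> (v\<^sup>2 - v * v * v) + (v\<^sup>2)\<^sup>2" by (intro add_nonneg_nonneg) simp_all
  then have "1 \<le> 1 + ((v\<^sup>2 - v * v * v) + (v\<^sup>2)\<^sup>2) / 2" by simp
  also have "\<dots> = (1 + v + v\<^sup>2) * (1 - v + v\<^sup>2 / 2)" by (simp add: power2_eq_square field_simps)
  also have "\<dots> \<le> (1 + v + v\<^sup>2) * exp (- v)"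
  proof (rule mult_left_mono[OF e])
    have "0 \<le> (1 + 2 * v)\<^sup>2 + 3" by simp
    then show "0 \<le> 1 + v + v\<^sup>2" by (simp add: power2_eq_square algebra_simps)
  qed
  finally show ?thesis by (simp add: exp_minus field_simps)
qed

text \<open>Because the second moment is at most a multiple of the mean, the quadratic term of the exponential moment is absorbed
by half of the linear one for a step \<open>s\<close> that does not depend on how small the mean is.\<close>

lemma (in prob_space) exp_moment_le:
  assumes [measurable]: "\<xi> \<in> borel_measurable M" and B: "AE z in M. \<bar>\<xi> z\<bar> \<le> B"
    and var: "expectation (\<lambda>z. (\<xi> z)\<^sup>2) \<le> b * expectation \<xi>" and s: "0 < s" "s * B \<le> 1" "s * b \<le> 1/2"
    and pos: "0 \<le> expectation \<xi>"
  shows "(\<integral>\<^sup>+z. ennreal (exp (- s * \<xi> z)) \<partial>M) \<le> ennreal (exp (- s * expectation \<xi> / 2))"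
proof -
  have int: "integrable M \<xi>" using B by (intro integrable_const_bound[of _ B]) auto
  have "AE z in M. (\<xi> z)\<^sup>2 \<le> B\<^sup>2"
    using B by eventually_elim (metis abs_ge_zero power2_abs power_mono)
  then have int2: "integrable M (\<lambda>z. (\<xi> z)\<^sup>2)" by (intro integrable_const_bound[of _ "B\<^sup>2"]) auto
  have ptw: "AE z in M. exp (- s * \<xi> z) \<le> 1 + (- s * \<xi> z) + (- s * \<xi> z)\<^sup>2"
    using B
  proof eventually_elim
    case (elim z)
    have "s * (- \<xi> z) \<le> s * B" using elim s by (intro mult_left_mono) auto
    then show ?case using s by (intro exp_le_quadratic) simp
  qed
  have "(\<integral>\<^sup>+z. ennreal (exp (- s * \<xi> z)) \<partial>M) \<le> (\<integral>\<^sup>+z. ennreal (1 + (- s * \<xi> z) + (- s * \<xi> z)\<^sup>2) \<partial>M)"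
    using ptw by (intro nn_integral_mono_AE) (auto elim!: eventually_mono intro: ennreal_leI)
  also have "\<dots> = ennreal (expectation (\<lambda>z. 1 + (- s * \<xi> z) + (- s * \<xi> z)\<^sup>2))"
  proof (rule nn_integral_eq_integral)
    show "integrable M (\<lambda>z. 1 + (- s * \<xi> z) + (- s * \<xi> z)\<^sup>2)" using int int2 by (simp add: power_mult_distrib)
    show "AE z in M. 0 \<le> 1 + (- s * \<xi> z) + (- s * \<xi> z)\<^sup>2"
      using ptw by eventually_elim (meson exp_ge_zero order_trans)
  qed
  also have "expectation (\<lambda>z. 1 + (- s * \<xi> z) + (- s * \<xi> z)\<^sup>2) = 1 - s * expectation \<xi> + s\<^sup>2 * expectation (\<lambda>z. (\<xi> z)\<^sup>2)"
    using int int2 by (simp add: power_mult_distrib prob_space)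
  also have "\<dots> \<le> 1 - s * expectation \<xi> / 2"
  proof -
    have "s\<^sup>2 * expectation (\<lambda>z. (\<xi> z)\<^sup>2) \<le> s\<^sup>2 * (b * expectation \<xi>)" using var by (intro mult_left_mono) auto
    also have "\<dots> = (s * b) * (s * expectation \<xi>)" by (simp add: power2_eq_square)
    also have "\<dots> \<le> 1/2 * (s * expectation \<xi>)" using s pos by (intro mult_right_mono) auto
    finally show ?thesis by simp
  qed
  also have "\<dots> \<le> exp (- s * expectation \<xi> / 2)" using exp_ge_add_one_self[of "- s * expectation \<xi> / 2"] by simp
  finally show ?thesis by (simp add: ennreal_leI)
qed

text \<open>The exponential moment of the sum compensates exactly the threshold \<open>T E\<xi> / 2\<close>, which leaves only the
additive slack \<open>u\<close>, independent of \<open>T\<close>.\<close>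

lemma (in prob_space) iid_lower_tail:
  assumes [measurable]: "\<xi> \<in> borel_measurable M" and B: "AE z in M. \<bar>\<xi> z\<bar> \<le> B"
    and var: "expectation (\<lambda>z. (\<xi> z)\<^sup>2) \<le> b * expectation \<xi>" and s: "0 < s" "s * B \<le> 1" "s * b \<le> 1/2"
    and pos: "0 \<le> expectation \<xi>"
  shows "measure (PiM {1..T::nat} (\<lambda>_. M)) {z \<in> space (PiM {1..T} (\<lambda>_. M)).
    (\<Sum>t=1..T. \<xi> (z t)) < real T * expectation \<xi> / 2 - u} \<le> exp (- s * u)"
proof -
  let ?P = "PiM {1..T} (\<lambda>_. M)" and ?m = "expectation \<xi>"
  interpret PP: product_prob_space "\<lambda>_. M" "{1..T}" by unfold_locales
  have PS: "prob_space ?P" by (intro prob_space_PiM prob_space_axioms)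
  let ?c = "exp (s * (real T * ?m / 2 - u))"
  let ?E = "{z \<in> space ?P. (\<Sum>t=1..T. \<xi> (z t)) < real T * ?m / 2 - u}"
  have meas [measurable]: "(\<lambda>z. \<Sum>t=1..T. \<xi> (z t)) \<in> borel_measurable ?P" by measurable
  have E: "?E \<in> sets ?P" by measurable
  have "emeasure ?P ?E \<le> emeasure ?P {z \<in> space ?P. 1 \<le> ennreal ?c * (\<Prod>t\<in>{1..T}. ennreal (exp (- s * \<xi> (z t))))}"
  proof (rule emeasure_mono)
    show "?E \<subseteq> {z \<in> space ?P. 1 \<le> ennreal ?c * (\<Prod>t\<in>{1..T}. ennreal (exp (- s * \<xi> (z t))))}"
    proof safe
      fix z assume less: "(\<Sum>t=1..T. \<xi> (z t)) < real T * ?m / 2 - u"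
      have "(\<Prod>t\<in>{1..T}. ennreal (exp (- s * \<xi> (z t)))) = ennreal (exp (- s * (\<Sum>t=1..T. \<xi> (z t))))"
        by (simp add: prod_ennreal exp_sum[symmetric] sum_distrib_left sum_negf)
      moreover have "1 \<le> ?c * exp (- s * (\<Sum>t=1..T. \<xi> (z t)))"
        using less s by (simp add: exp_add[symmetric] mult_le_cancel_left_pos less_imp_le flip: right_diff_distrib)
      ultimately show "1 \<le> ennreal ?c * (\<Prod>t\<in>{1..T}. ennreal (exp (- s * \<xi> (z t))))"
        by (simp add: ennreal_mult[symmetric])
    qed
  qed measurable
  also have "\<dots> \<le> ennreal ?c * (\<integral>\<^sup>+z. (\<Prod>t\<in>{1..T}. ennreal (exp (- s * \<xi> (z t)))) * indicator (space ?P) z \<partial>?P)"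
    by (rule nn_integral_Markov_inequality) measurable
  also have "(\<integral>\<^sup>+z. (\<Prod>t\<in>{1..T}. ennreal (exp (- s * \<xi> (z t)))) * indicator (space ?P) z \<partial>?P) =
      (\<integral>\<^sup>+z. (\<Prod>t\<in>{1..T}. ennreal (exp (- s * \<xi> (z t)))) \<partial>?P)"
    by (intro nn_integral_cong) simp
  also have "\<dots> = (\<Prod>t\<in>{1..T}. \<integral>\<^sup>+z. ennreal (exp (- s * \<xi> z)) \<partial>M)"
    by (rule PP.product_nn_integral_prod) auto
  also have "\<dots> \<le> (\<Prod>t\<in>{1..T}. ennreal (exp (- s * ?m / 2)))"
    by (intro prod_mono_ennreal) (use exp_moment_le[OF assms] in auto)
  also have "\<dots> = ennreal (exp (- s * ?m / 2) ^ T)" by (simp add: ennreal_power)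
  also have "ennreal ?c * \<dots> = ennreal (exp (- s * u))"
    by (simp add: ennreal_mult[symmetric] exp_of_nat_mult[symmetric] exp_add[symmetric])
      (simp add: algebra_simps)
  finally have "emeasure ?P ?E \<le> ennreal (exp (- s * u))" by (simp add: mult_left_mono)
  then show ?thesis unfolding measure_def by (intro enn2real_leI) simp_all
qed

section \<open>The regression model\<close>

locale regression_model =
  fixes X :: "'a::euclidean_space set" and \<rho> :: "('a \<times> real) measure" and \<kappa> :: "'a \<Rightarrow> real measure"
    and f\<^sub>q :: "'a \<Rightarrow> real" and q \<phi> :: real
  assumes borel_prob: "borel_prob_on (X \<times> UNIV) \<rho>"
    and cond: "conditional_distributions X \<rho> \<kappa>"
    and q: "1 < q" and \<phi>: "0 < \<phi>"
    and f\<^sub>q_measurable: "f\<^sub>q \<in> borel_measurable (restrict_space borel X)"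
    and f\<^sub>q_bound: "\<And>x. x \<in> X \<Longrightarrow> \<bar>f\<^sub>q x\<bar> \<le> 1/4"
    and noise: "\<And>x. x \<in> X \<Longrightarrow> \<kappa> x = density lborel (\<lambda>y. ennreal (noise_density \<phi> (y - f\<^sub>q x)))"
begin

sublocale prob_space \<rho> using borel_prob by (simp add: borel_prob_on_def)

abbreviation "\<mu> \<equiv> marginal_X X \<rho>"

lemma sets_\<rho>: "sets \<rho> = sets (restrict_space borel (X \<times> UNIV))"
  using borel_prob by (simp add: borel_prob_on_def)

lemma space_\<rho>: "space \<rho> = X \<times> UNIV"
  using sets_eq_imp_space_eq[OF sets_\<rho>] by (simp add: space_restrict_space)

lemmas fst_measurable [measurable] = sample_components_measurable(1)[OF sets_\<rho>]
lemmas snd_measurable [measurable] = sample_components_measurable(2)[OF sets_\<rho>]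

lemma sets_\<mu> [simp, measurable_cong]: "sets \<mu> = sets (restrict_space borel X)"
  by (simp add: marginal_X_def)

lemma space_\<mu> [simp]: "space \<mu> = X"
  by (simp add: marginal_X_def space_restrict_space)

lemma prob_space_\<mu>: "prob_space \<mu>"
  unfolding marginal_X_def by (rule prob_space_distr) measurable

lemma pair_measurable: "(\<lambda>(x, y). (x, y)) \<in> \<mu> \<Otimes>\<^sub>M borel \<rightarrow>\<^sub>M \<rho>"
proof -
  have "(\<lambda>w. w) \<in> \<mu> \<Otimes>\<^sub>M (borel :: real measure) \<rightarrow>\<^sub>M borel \<Otimes>\<^sub>M borel"
  proof (subst surjective_pairing, intro measurable_Pair)
    have "fst \<in> \<mu> \<Otimes>\<^sub>M (borel :: real measure) \<rightarrow>\<^sub>M restrict_space borel X"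
      by (subst measurable_cong_sets[OF refl sets_\<mu>[symmetric]]) (rule measurable_fst)
    then show "fst \<in> \<mu> \<Otimes>\<^sub>M (borel :: real measure) \<rightarrow>\<^sub>M borel"
      by (simp add: measurable_restrict_space2_iff)
  qed (rule measurable_snd)
  then have "(\<lambda>w. w) \<in> \<mu> \<Otimes>\<^sub>M (borel :: real measure) \<rightarrow>\<^sub>M restrict_space borel (X \<times> UNIV)"
    by (intro measurable_restrict_space2) (auto simp: space_pair_measure borel_prod)
  then show ?thesis by (subst measurable_cong_sets[OF refl sets_\<rho>]) (simp add: case_prod_beta)
qed

lemma \<kappa>_measurable: "\<kappa> \<in> \<mu> \<rightarrow>\<^sub>M prob_algebra borel"
  using cond by (simp add: conditional_distributions_def)

lemma \<kappa>_prob: "x \<in> X \<Longrightarrow> prob_space (\<kappa> x)"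
  using measurable_space[OF \<kappa>_measurable, of x] by (simp add: space_prob_algebra)

lemma \<kappa>_sets: "x \<in> X \<Longrightarrow> sets (\<kappa> x) = sets borel"
  using measurable_space[OF \<kappa>_measurable, of x] by (simp add: space_prob_algebra)

lemma Pair_measurable: "x \<in> X \<Longrightarrow> Pair x \<in> \<kappa> x \<rightarrow>\<^sub>M \<rho>"
proof -
  assume x: "x \<in> X"
  then have "Pair x \<in> borel \<rightarrow>\<^sub>M \<mu> \<Otimes>\<^sub>M (borel :: real measure)" by (intro measurable_Pair1') simp
  from measurable_compose[OF this pair_measurable] show ?thesis
    by (simp add: measurable_cong_sets[OF \<kappa>_sets[OF x] refl])
qed

text \<open>The conditional distributions are given by their values on measurable sets.  Writing \<open>\<rho>\<close> as a monadic composition of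
its marginal with the kernel makes the corresponding formula for integrals available.\<close>

lemma disintegration:
  assumes g: "g \<in> borel_measurable \<rho>"
  shows "(\<integral>\<^sup>+z. g z \<partial>\<rho>) = (\<integral>\<^sup>+x. \<integral>\<^sup>+y. g (x, y) \<partial>\<kappa> x \<partial>\<mu>)"
proof -
  let ?N = "\<lambda>x. distr (\<kappa> x) \<rho> (Pair x)"
  have N: "?N \<in> \<mu> \<rightarrow>\<^sub>M subprob_algebra \<rho>"
    by (rule measurable_distr2[OF _ measurable_prob_algebraD[OF \<kappa>_measurable]])
      (use pair_measurable in simp)
  have ne: "space \<mu> \<noteq> {}" using prob_space.not_empty[OF prob_space_\<mu>] .
  have "\<rho> = \<mu> \<bind> ?N"
  proof (rule measure_eqI)
    show "sets \<rho> = sets (\<mu> \<bind> ?N)" using sets_bind[OF sets_kernel[OF N] ne] by simp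
    fix B assume B: "B \<in> sets \<rho>"
    have "emeasure \<rho> B = (\<integral>\<^sup>+x. emeasure (\<kappa> x) {y. (x, y) \<in> B} \<partial>\<mu>)"
      using cond B by (simp add: conditional_distributions_def)
    also have "\<dots> = (\<integral>\<^sup>+x. emeasure (?N x) B \<partial>\<mu>)"
    proof (rule nn_integral_cong)
      fix x assume "x \<in> space \<mu>"
      then have x: "x \<in> X" by simp
      have "Pair x -` B \<inter> space (\<kappa> x) = {y. (x, y) \<in> B}"
        using sets_eq_imp_space_eq[OF \<kappa>_sets[OF x]] by auto
      then show "emeasure (\<kappa> x) {y. (x, y) \<in> B} = emeasure (?N x) B"
        using emeasure_distr[OF Pair_measurable[OF x] B] by simp
    qed
    also have "\<dots> = emeasure (\<mu> \<bind> ?N) B" by (rule emeasure_bind[OF ne N B, symmetric])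
    finally show "emeasure \<rho> B = emeasure (\<mu> \<bind> ?N) B" .
  qed
  then have "(\<integral>\<^sup>+z. g z \<partial>\<rho>) = (\<integral>\<^sup>+z. g z \<partial>(\<mu> \<bind> ?N))" by simp
  also have "\<dots> = (\<integral>\<^sup>+x. \<integral>\<^sup>+z. g z \<partial>?N x \<partial>\<mu>)" by (rule nn_integral_bind[OF g N])
  also have "\<dots> = (\<integral>\<^sup>+x. \<integral>\<^sup>+y. g (x, y) \<partial>\<kappa> x \<partial>\<mu>)"
    by (intro nn_integral_cong nn_integral_distr Pair_measurable) (simp_all add: g)
  finally show ?thesis .
qed

lemma AE_response_near: "x \<in> X \<Longrightarrow> AE y in \<kappa> x. \<bar>y - f\<^sub>q x\<bar> \<le> 1/4"
  unfolding noise by (rule AE_density_noise)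

lemma AE_response_bounded: "AE z in \<rho>. \<bar>snd z\<bar> \<le> 1/2"
proof -
  have [measurable]: "Measurable.pred \<rho> (\<lambda>z. \<bar>snd z\<bar> \<le> 1/2)" by measurable
  have "(\<integral>\<^sup>+z. indicator {z \<in> space \<rho>. \<not> \<bar>snd z\<bar> \<le> 1/2} z \<partial>\<rho>) =
      (\<integral>\<^sup>+x. \<integral>\<^sup>+y. indicator {z \<in> space \<rho>. \<not> \<bar>snd z\<bar> \<le> 1/2} (x, y) \<partial>\<kappa> x \<partial>\<mu>)"
    by (rule disintegration) measurable
  also have "\<dots> = (\<integral>\<^sup>+x. 0 \<partial>\<mu>)"
  proof (rule nn_integral_cong)
    fix x assume "x \<in> space \<mu>"
    then have x: "x \<in> X" by simp
    have "AE y in \<kappa> x. indicator {z \<in> space \<rho>. \<not> \<bar>snd z\<bar> \<le> 1/2} (x, y) = (0 :: ennreal)"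
      using AE_response_near[OF x]
    proof eventually_elim
      case (elim y)
      then have "\<bar>y\<bar> \<le> 1/2" using f\<^sub>q_bound[OF x] by linarith
      then show ?case by (simp add: indicator_def)
    qed
    then have "(\<integral>\<^sup>+y. indicator {z \<in> space \<rho>. \<not> \<bar>snd z\<bar> \<le> 1/2} (x, y) \<partial>\<kappa> x) = (\<integral>\<^sup>+y. 0 \<partial>\<kappa> x)"
      by (rule nn_integral_cong_AE)
    then show "(\<integral>\<^sup>+y. indicator {z \<in> space \<rho>. \<not> \<bar>snd z\<bar> \<le> 1/2} (x, y) \<partial>\<kappa> x) = 0" by simp
  qed
  finally have "emeasure \<rho> {z \<in> space \<rho>. \<not> \<bar>snd z\<bar> \<le> 1/2} = 0" by simp
  then show ?thesis by (subst AE_iff_measurable[OF _ refl]) auto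
qed

definition excess :: "('a \<Rightarrow> real) \<Rightarrow> 'a \<times> real \<Rightarrow> real" where
  "excess g z = \<bar>snd z - g (fst z)\<bar> powr q - \<bar>snd z - f\<^sub>q (fst z)\<bar> powr q"

text \<open>A Lipschitz constant of \<open>u \<mapsto> \<bar>u\<bar> powr q\<close> on \<open>[-2, 2]\<close>, which contains all residuals \<open>y - g x\<close> with
\<open>\<bar>y\<bar> \<le> 1/2\<close> and \<open>\<bar>g x\<bar> \<le> 1\<close>.\<close>

definition lip :: real where "lip = q * 2 powr (q - 1)"

lemma lip_pos: "0 < lip" using q by (simp add: lip_def)

definition sq_dist :: "('a \<Rightarrow> real) \<Rightarrow> real" where
  "sq_dist g = (\<integral>x. (g x - f\<^sub>q x)\<^sup>2 \<partial>\<mu>)"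

lemma excess_measurable [measurable]:
  assumes [measurable]: "g \<in> borel_measurable (restrict_space borel X)"
  shows "excess g \<in> borel_measurable \<rho>"
proof -
  note [measurable] = f\<^sub>q_measurable
  show ?thesis unfolding excess_def[abs_def] by measurable
qed

lemma abs_loss_diff_le:
  assumes "\<bar>y - a\<bar> \<le> 2" "\<bar>y - b\<bar> \<le> 2"
  shows "\<bar>\<bar>y - a\<bar> powr q - \<bar>y - b\<bar> powr q\<bar> \<le> lip * \<bar>a - b\<bar>"
proof -
  have "\<bar>\<bar>y - a\<bar> powr q - \<bar>y - b\<bar> powr q\<bar> \<le> lip * \<bar>\<bar>y - a\<bar> - \<bar>y - b\<bar>\<bar>"
    unfolding lip_def using assms q by (intro powr_lipschitz) auto
  also have "\<dots> \<le> lip * \<bar>a - b\<bar>" using lip_pos by (intro mult_left_mono) auto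
  finally show ?thesis .
qed

lemma excess_le:
  assumes g: "\<And>x. x \<in> X \<Longrightarrow> \<bar>g x\<bar> \<le> 1" and z: "z \<in> space \<rho>" "\<bar>snd z\<bar> \<le> 1/2"
  shows "\<bar>excess g z\<bar> \<le> lip * \<bar>g (fst z) - f\<^sub>q (fst z)\<bar>"
proof -
  have x: "fst z \<in> X" using z by (auto simp: space_\<rho>)
  show ?thesis unfolding excess_def
    using g[OF x] f\<^sub>q_bound[OF x] z(2) by (intro abs_loss_diff_le) auto
qed

lemma excess_bound:
  assumes g: "\<And>x. x \<in> X \<Longrightarrow> \<bar>g x\<bar> \<le> 1" and z: "z \<in> space \<rho>" "\<bar>snd z\<bar> \<le> 1/2"
  shows "\<bar>excess g z\<bar> \<le> 2 * lip"
proof -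
  have x: "fst z \<in> X" using z by (auto simp: space_\<rho>)
  have "\<bar>excess g z\<bar> \<le> lip * \<bar>g (fst z) - f\<^sub>q (fst z)\<bar>" by (rule excess_le[OF assms])
  also have "\<dots> \<le> lip * 2" using g[OF x] f\<^sub>q_bound[OF x] lip_pos by (intro mult_left_mono) auto
  finally show ?thesis by simp
qed

lemma AE_excess_bound:
  assumes "\<And>x. x \<in> X \<Longrightarrow> \<bar>g x\<bar> \<le> 1"
  shows "AE z in \<rho>. \<bar>excess g z\<bar> \<le> 2 * lip"
  using AE_response_bounded AE_space by eventually_elim (use assms in \<open>auto intro: excess_bound\<close>)

lemma integrable_sq:
  assumes [measurable]: "g \<in> borel_measurable (restrict_space borel X)" and g: "\<And>x. x \<in> X \<Longrightarrow> \<bar>g x\<bar> \<le> 1"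
  shows "integrable \<mu> (\<lambda>x. (g x - f\<^sub>q x)\<^sup>2)"
proof -
  interpret M: prob_space \<mu> by (rule prob_space_\<mu>)
  note [measurable] = f\<^sub>q_measurable
  have "(g x - f\<^sub>q x)\<^sup>2 \<le> 2\<^sup>2" if "x \<in> X" for x
    using g[OF that] f\<^sub>q_bound[OF that] by (intro abs_le_square_iff[THEN iffD1]) auto
  then show ?thesis by (intro M.integrable_const_bound[of _ "2\<^sup>2"]) auto
qed

lemma conditional_excess_ge:
  assumes x: "x \<in> X" and v: "\<bar>v\<bar> \<le> 1"
  shows "growth_const q \<phi> * (v - f\<^sub>q x)\<^sup>2 \<le> (\<integral>y. \<bar>y - v\<bar> powr q - \<bar>y - f\<^sub>q x\<bar> powr q \<partial>\<kappa> x)"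
proof -
  have "\<bar>v - f\<^sub>q x\<bar> \<le> 5/4" using v f\<^sub>q_bound[OF x] by linarith
  then have "growth_const q \<phi> * (v - f\<^sub>q x)\<^sup>2 \<le>
      (\<integral>u. noise_density \<phi> u * (\<bar>u - (v - f\<^sub>q x)\<bar> powr q - \<bar>u\<bar> powr q) \<partial>lborel)"
    by (intro noise_quadratic_growth q \<phi>)
  also have "\<dots> = (\<integral>y. \<bar>y - v\<bar> powr q - \<bar>y - f\<^sub>q x\<bar> powr q \<partial>\<kappa> x)"
    unfolding noise[OF x] by (subst density_noise_integral[OF \<phi>]) (auto simp: algebra_simps)
  finally show ?thesis .
qed

text \<open>Integration of the conditional bound over the marginal.  The constant \<open>2 * lip\<close> is added so that the integrands are
nonnegative and the disintegration formula applies.\<close>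

lemma expectation_excess_ge:
  assumes g_meas [measurable]: "g \<in> borel_measurable (restrict_space borel X)" and g: "\<And>x. x \<in> X \<Longrightarrow> \<bar>g x\<bar> \<le> 1"
  shows "growth_const q \<phi> * sq_dist g \<le> expectation (excess g)"
proof -
  interpret M: prob_space \<mu> by (rule prob_space_\<mu>)
  note [measurable] = f\<^sub>q_measurable
  let ?c = "growth_const q \<phi>" and ?B = "2 * lip"
  have c: "0 < ?c" by (rule growth_const_pos[OF q \<phi>])
  have gAE: "AE z in \<rho>. \<bar>excess g z\<bar> \<le> ?B" by (rule AE_excess_bound) (rule g)
  have int: "integrable \<rho> (excess g)"
    using gAE by (intro integrable_const_bound[of _ ?B]) auto
  have sq: "integrable \<mu> (\<lambda>x. (g x - f\<^sub>q x)\<^sup>2)" by (rule integrable_sq[OF g_meas]) (rule g)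
  have "ennreal (?B + ?c * sq_dist g) = ennreal (\<integral>x. ?B + ?c * (g x - f\<^sub>q x)\<^sup>2 \<partial>\<mu>)"
    using sq by (simp add: sq_dist_def M.prob_space[unfolded space_\<mu>])
  also have "\<dots> = (\<integral>\<^sup>+x. ennreal (?B + ?c * (g x - f\<^sub>q x)\<^sup>2) \<partial>\<mu>)"
    using sq c lip_pos by (intro nn_integral_eq_integral[symmetric]) auto
  also have "\<dots> \<le> (\<integral>\<^sup>+x. \<integral>\<^sup>+y. ennreal (?B + excess g (x, y)) \<partial>\<kappa> x \<partial>\<mu>)"
  proof (rule nn_integral_mono)
    fix x assume "x \<in> space \<mu>"
    then have x: "x \<in> X" by simp
    interpret k: prob_space "\<kappa> x" by (rule \<kappa>_prob[OF x])
    have bd: "AE y in \<kappa> x. \<bar>excess g (x, y)\<bar> \<le> ?B"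
      using AE_response_near[OF x]
    proof eventually_elim
      case (elim y)
      then have "\<bar>y\<bar> \<le> 1/2" using f\<^sub>q_bound[OF x] by linarith
      then show ?case using x by (intro excess_bound[OF g]) (auto simp: space_\<rho>)
    qed
    have meas: "(\<lambda>y. excess g (x, y)) \<in> borel_measurable (\<kappa> x)"
      using measurable_compose[OF Pair_measurable[OF x] excess_measurable[OF g_meas]] by simp
    have ki: "integrable (\<kappa> x) (\<lambda>y. excess g (x, y))"
      using bd meas by (intro k.integrable_const_bound[of _ ?B]) auto
    have "?B + ?c * (g x - f\<^sub>q x)\<^sup>2 \<le> ?B + (\<integral>y. excess g (x, y) \<partial>\<kappa> x)"
      using conditional_excess_ge[OF x g[OF x]] by (simp add: excess_def)
    also have "\<dots> = (\<integral>y. ?B + excess g (x, y) \<partial>\<kappa> x)" using ki by (simp add: k.prob_space)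
    finally have "ennreal (?B + ?c * (g x - f\<^sub>q x)\<^sup>2) \<le> ennreal (\<integral>y. ?B + excess g (x, y) \<partial>\<kappa> x)"
      by (rule ennreal_leI)
    also have "\<dots> = (\<integral>\<^sup>+y. ennreal (?B + excess g (x, y)) \<partial>\<kappa> x)"
    proof (rule nn_integral_eq_integral[symmetric])
      show "AE y in \<kappa> x. 0 \<le> ?B + excess g (x, y)" using bd by eventually_elim auto
    qed (use ki in simp)
    finally show "ennreal (?B + ?c * (g x - f\<^sub>q x)\<^sup>2) \<le> (\<integral>\<^sup>+y. ennreal (?B + excess g (x, y)) \<partial>\<kappa> x)" .
  qed
  also have "\<dots> = (\<integral>\<^sup>+z. ennreal (?B + excess g z) \<partial>\<rho>)" by (rule disintegration[symmetric]) measurable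
  also have "\<dots> = ennreal (expectation (\<lambda>z. ?B + excess g z))"
  proof (rule nn_integral_eq_integral)
    show "AE z in \<rho>. 0 \<le> ?B + excess g z" using gAE by eventually_elim auto
  qed (use int in simp)
  also have "expectation (\<lambda>z. ?B + excess g z) = ?B + expectation (excess g)" using int by (simp add: prob_space)
  finally have le: "ennreal (?B + ?c * sq_dist g) \<le> ennreal (?B + expectation (excess g))" .
  have "\<bar>expectation (excess g)\<bar> \<le> ?B"
  proof -
    have "\<bar>expectation (excess g)\<bar> \<le> expectation (\<lambda>z. \<bar>excess g z\<bar>)" by (rule integral_abs_bound)
    also have "\<dots> \<le> expectation (\<lambda>z. ?B)" using int gAE by (intro integral_mono_AE) auto
    finally show ?thesis by (simp add: prob_space)
  qed
  then show ?thesis using le by (subst (asm) ennreal_le_iff) auto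
qed

text \<open>Together with the previous bound, this gives a second moment of at most \<open>lip\<^sup>2 / growth_const q \<phi>\<close> times the mean.\<close>

lemma expectation_excess_sq_le:
  assumes g_meas [measurable]: "g \<in> borel_measurable (restrict_space borel X)" and g: "\<And>x. x \<in> X \<Longrightarrow> \<bar>g x\<bar> \<le> 1"
  shows "expectation (\<lambda>z. (excess g z)\<^sup>2) \<le> lip\<^sup>2 * sq_dist g"
proof -
  note [measurable] = f\<^sub>q_measurable
  have m: "(\<lambda>x. (g x - f\<^sub>q x)\<^sup>2) \<in> borel_measurable (restrict_space borel X)" by measurable
  have int: "integrable \<rho> (\<lambda>z. (g (fst z) - f\<^sub>q (fst z))\<^sup>2)"
  proof -
    have "integrable \<mu> (\<lambda>x. (g x - f\<^sub>q x)\<^sup>2)" by (rule integrable_sq[OF g_meas]) (rule g)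
    then show ?thesis unfolding marginal_X_def by (subst (asm) integrable_distr_eq[OF fst_measurable m])
  qed
  have ae: "AE z in \<rho>. (excess g z)\<^sup>2 \<le> lip\<^sup>2 * (g (fst z) - f\<^sub>q (fst z))\<^sup>2"
    using AE_response_bounded AE_space
  proof eventually_elim
    case (elim z)
    then have "\<bar>excess g z\<bar> \<le> lip * \<bar>g (fst z) - f\<^sub>q (fst z)\<bar>" using g by (intro excess_le)
    then have "\<bar>excess g z\<bar>\<^sup>2 \<le> (lip * \<bar>g (fst z) - f\<^sub>q (fst z)\<bar>)\<^sup>2" by (intro power_mono) auto
    then show ?case by (simp add: power_mult_distrib)
  qed
  have "expectation (\<lambda>z. (excess g z)\<^sup>2) \<le> expectation (\<lambda>z. lip\<^sup>2 * (g (fst z) - f\<^sub>q (fst z))\<^sup>2)"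
  proof (rule integral_mono_AE[OF _ _ ae])
    show "integrable \<rho> (\<lambda>z. (excess g z)\<^sup>2)"
      by (rule Bochner_Integration.integrable_bound[of _ "\<lambda>z. lip\<^sup>2 * (g (fst z) - f\<^sub>q (fst z))\<^sup>2"])
        (use int ae in auto)
  qed (use int in simp)
  also have "\<dots> = lip\<^sup>2 * sq_dist g"
    unfolding sq_dist_def marginal_X_def by (subst integral_distr[OF fst_measurable m]) simp
  finally show ?thesis .
qed

text \<open>The largest step allowed by both the range \<open>2 * lip\<close> of the excess loss and the ratio of its second moment to its
mean.\<close>

definition chernoff_rate :: real where
  "chernoff_rate = min (1 / (2 * lip)) (growth_const q \<phi> / (2 * lip\<^sup>2))"

lemma chernoff_rate_pos: "0 < chernoff_rate"
  using lip_pos growth_const_pos[OF q \<phi>] by (simp add: chernoff_rate_def)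

lemma excess_lower_tail:
  assumes g_meas: "g \<in> borel_measurable (restrict_space borel X)" and g: "\<And>x. x \<in> X \<Longrightarrow> \<bar>g x\<bar> \<le> 1"
  shows "measure (PiM {1..T::nat} (\<lambda>_. \<rho>)) {z \<in> space (PiM {1..T} (\<lambda>_. \<rho>)).
    (\<Sum>t=1..T. excess g (z t)) < real T * expectation (excess g) / 2 - u} \<le> exp (- chernoff_rate * u)"
proof (rule iid_lower_tail[where B = "2 * lip" and b = "lip\<^sup>2 / growth_const q \<phi>"])
  have c: "0 < growth_const q \<phi>" by (rule growth_const_pos[OF q \<phi>])
  note ge = expectation_excess_ge[OF assms]
  have "0 \<le> sq_dist g" unfolding sq_dist_def by (rule integral_nonneg_AE) simp
  then show "0 \<le> expectation (excess g)" using ge c by (meson mult_nonneg_nonneg less_imp_le order_trans)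
  have "expectation (\<lambda>z. (excess g z)\<^sup>2) \<le> lip\<^sup>2 * sq_dist g" by (rule expectation_excess_sq_le[OF assms])
  also have "\<dots> \<le> lip\<^sup>2 * (expectation (excess g) / growth_const q \<phi>)"
    using ge c by (intro mult_left_mono) (auto simp: field_simps)
  finally show "expectation (\<lambda>z. (excess g z)\<^sup>2) \<le> lip\<^sup>2 / growth_const q \<phi> * expectation (excess g)" by simp
  show "chernoff_rate * (2 * lip) \<le> 1"
  proof -
    have "chernoff_rate * (2 * lip) \<le> 1 / (2 * lip) * (2 * lip)"
      using lip_pos by (intro mult_right_mono) (auto simp: chernoff_rate_def)
    then show ?thesis using lip_pos by simp
  qed
  show "chernoff_rate * (lip\<^sup>2 / growth_const q \<phi>) \<le> 1/2"
  proof -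
    have "chernoff_rate * (lip\<^sup>2 / growth_const q \<phi>) \<le> growth_const q \<phi> / (2 * lip\<^sup>2) * (lip\<^sup>2 / growth_const q \<phi>)"
      using c by (intro mult_right_mono) (auto simp: chernoff_rate_def)
    then show ?thesis using c lip_pos by simp
  qed
qed (use assms AE_excess_bound chernoff_rate_pos in auto)

lemma uniform_lower_tail:
  fixes T :: nat and u :: real
  assumes N: "finite \<N>" "\<And>g. g \<in> \<N> \<Longrightarrow> g \<in> borel_measurable (restrict_space borel X)"
    "\<And>g x. g \<in> \<N> \<Longrightarrow> x \<in> X \<Longrightarrow> \<bar>g x\<bar> \<le> 1"
  defines "P \<equiv> PiM {1..T} (\<lambda>_. \<rho>)"
  shows "\<exists>E\<in>sets P. measure P E \<ge> 1 - real (card \<N>) * exp (- chernoff_rate * u) \<and>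
    (\<forall>z\<in>E. (\<forall>t\<in>{1..T}. \<bar>snd (z t)\<bar> \<le> 1/2) \<and>
      (\<forall>g\<in>\<N>. real T * expectation (excess g) / 2 - u \<le> (\<Sum>t=1..T. excess g (z t))))"
proof -
  interpret P: prob_space P unfolding P_def by (intro prob_space_PiM prob_space_axioms)
  define F where "F g = {z \<in> space P. (\<Sum>t=1..T. excess g (z t)) < real T * expectation (excess g) / 2 - u}" for g
  have F: "F g \<in> sets P" "measure P (F g) \<le> exp (- chernoff_rate * u)" if "g \<in> \<N>" for g
  proof -
    note [measurable] = excess_measurable[OF N(2)[OF that]]
    show "F g \<in> sets P" unfolding F_def P_def by measurable
    show "measure P (F g) \<le> exp (- chernoff_rate * u)"
      unfolding F_def P_def using N(2,3)[OF that] by (rule excess_lower_tail)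
  qed
  define E where "E = {z \<in> space P. \<forall>t\<in>{1..T}. \<bar>snd (z t)\<bar> \<le> 1/2}"
  have E: "E \<in> sets P" unfolding E_def P_def by measurable
  have "AE z in P. \<bar>snd (z t)\<bar> \<le> 1/2" if t: "t \<in> {1..T}" for t
  proof -
    have "AE w in distr P \<rho> (\<lambda>z. z t). \<bar>snd w\<bar> \<le> 1/2"
      unfolding P_def by (subst distr_PiM_component) (use t AE_response_bounded prob_space_axioms in auto)
    then show ?thesis unfolding P_def by (rule AE_distrD[rotated]) (use t in measurable)
  qed
  then have "AE z in P. z \<in> E" unfolding E_def by (simp add: AE_conj_iff AE_finite_all)
  then have PE: "measure P E = 1" using E by (simp add: P.prob_eq_1)
  have "measure P (\<Union>g\<in>\<N>. F g) \<le> (\<Sum>g\<in>\<N>. measure P (F g))"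
    using N(1) F(1) by (intro P.finite_measure_subadditive_finite) auto
  also have "\<dots> \<le> real (card \<N>) * exp (- chernoff_rate * u)" using F(2) by (rule sum_bounded_above)
  finally have U: "measure P (\<Union>g\<in>\<N>. F g) \<le> real (card \<N>) * exp (- chernoff_rate * u)" .
  have Us: "(\<Union>g\<in>\<N>. F g) \<in> sets P" using N(1) F(1) by auto
  have "measure P E - measure P (\<Union>g\<in>\<N>. F g) \<le> measure P (E - (\<Union>g\<in>\<N>. F g))"
  proof -
    have "measure P E \<le> measure P ((E - (\<Union>g\<in>\<N>. F g)) \<union> (\<Union>g\<in>\<N>. F g))"
      using E Us by (intro P.finite_measure_mono) auto
    also have "\<dots> \<le> measure P (E - (\<Union>g\<in>\<N>. F g)) + measure P (\<Union>g\<in>\<N>. F g)"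
      using E Us by (intro measure_Un_le) auto
    finally show ?thesis by simp
  qed
  then have "1 - real (card \<N>) * exp (- chernoff_rate * u) \<le> measure P (E - (\<Union>g\<in>\<N>. F g))"
    using PE U by linarith
  moreover have "E - (\<Union>g\<in>\<N>. F g) \<in> sets P" using E Us by auto
  ultimately show ?thesis
    by (intro bexI[of _ "E - (\<Union>g\<in>\<N>. F g)"]) (auto simp: E_def F_def not_less)
qed

end

section \<open>Learning rate\<close>

lemma insensitive_loss_le_powr:
  assumes "0 \<le> \<epsilon>" "0 \<le> q" shows "insensitive_loss q \<epsilon> u \<le> \<bar>u\<bar> powr q"
  unfolding insensitive_loss_eq using assms by (intro powr_mono2) auto

text \<open>The insensitive zone costs at most the width \<open>\<epsilon>\<close> times the Lipschitz constant of the power on \<open>[0, 2]\<close>.\<close>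

lemma powr_le_insensitive_loss:
  assumes "0 \<le> \<epsilon>" "1 \<le> q" "\<bar>u\<bar> \<le> 2"
  shows "\<bar>u\<bar> powr q \<le> insensitive_loss q \<epsilon> u + q * 2 powr (q - 1) * \<epsilon>"
proof -
  let ?v = "max 0 (\<bar>u\<bar> - \<epsilon>)"
  have "\<bar>\<bar>u\<bar> powr q - ?v powr q\<bar> \<le> q * 2 powr (q - 1) * \<bar>\<bar>u\<bar> - ?v\<bar>"
    using assms by (intro powr_lipschitz) auto
  also have "\<dots> \<le> q * 2 powr (q - 1) * \<epsilon>" using assms by (intro mult_left_mono) auto
  finally show ?thesis by (simp add: insensitive_loss_eq abs_le_iff)
qed

lemma proj_unit_eq: "proj_unit f x = max (-1) (min 1 (f x))"
  by (auto simp: proj_unit_def)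

lemma proj_unit_bound: "\<bar>proj_unit f x\<bar> \<le> 1"
  by (auto simp: proj_unit_def)

lemma proj_unit_contraction: "\<bar>proj_unit f x - proj_unit g x\<bar> \<le> \<bar>f x - g x\<bar>"
  by (auto simp: proj_unit_def)

lemma proj_unit_closer: "\<bar>y\<bar> \<le> 1 \<Longrightarrow> \<bar>proj_unit f x - y\<bar> \<le> \<bar>f x - y\<bar>"
  by (auto simp: proj_unit_def)

lemma proj_unit_measurable [measurable]:
  assumes [measurable]: "f \<in> borel_measurable M"
  shows "proj_unit f \<in> borel_measurable M"
  unfolding proj_unit_eq[abs_def] by measurable

context regression_model
begin

text \<open>Comparison of the regularized risk with that of the zero function bounds the norm, and comparison with that of
\<open>f\<^sub>q\<close> bounds the empirical excess loss.  Projecting to \<open>[-1, 1]\<close> can only decrease the loss because the responses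
lie there.\<close>

lemma estimator_excess_le:
  assumes K: "mercer_kernel X K" and f\<^sub>q: "f\<^sub>q \<in> rkhs X K" and T: "T \<ge> 1" and lam: "0 < lam"
    and sample: "\<forall>t\<in>{1..T}. fst (z t) \<in> X" "\<forall>t\<in>{1..T}. \<bar>snd (z t)\<bar> \<le> 1/2"
  defines "F \<equiv> svr_estimator X K q lam lam T z"
  shows "F \<in> rkhs X K" and "(rkhs_norm X K F)\<^sup>2 \<le> 1 / lam"
    and "(\<Sum>t=1..T. excess (proj_unit F) (z t)) \<le> real T * lam * ((rkhs_norm X K f\<^sub>q)\<^sup>2 + lip)"
proof -
  have z: "fst (z t) \<in> X" "\<bar>snd (z t)\<bar> \<le> 1/2" if "t \<in> {1..T}" for t using sample that by auto
  interpret R: regularized_problem X K "empirical_risk q lam T z" lam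
    using regularized_problem_empirical(1)[OF K lam q] z(1) .
  have risk: "R.risk = regularized_risk X K q lam lam T z"
    using regularized_problem_empirical(2)[OF K lam q] z(1) .
  have F_eq: "F = arg_min_on R.risk (rkhs X K)" by (simp add: F_def svr_estimator_def risk)
  show FH: "F \<in> rkhs X K" unfolding F_eq by (rule R.minimizer_properties)
  have min: "R.risk F \<le> R.risk g" if "g \<in> rkhs X K" for g
    unfolding F_eq using that by (rule R.minimizer_properties)
  let ?emp = "\<lambda>f. empirical_risk q lam T z f"
  have T0: "0 < real T" using T by simp
  have emp_sum: "real T * ?emp f = (\<Sum>t=1..T. insensitive_loss q lam (f (fst (z t)) - snd (z t)))" for f
    using T0 by (simp add: empirical_risk_def)
  show "(rkhs_norm X K F)\<^sup>2 \<le> 1 / lam"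
  proof -
    have zero: "(0 :: 'a \<Rightarrow>\<^sub>0 real) \<in> R.combs" by simp
    have "R.risk F \<le> R.risk (kernel_comb K 0)" by (rule min[OF R.comb_in_rkhs[OF zero]])
    also have "\<dots> = ?emp (kernel_comb K 0)"
      using R.risk_comb[OF zero] by (simp add: kernel_norm_def kernel_inner_def)
    also have "\<dots> \<le> 1"
    proof -
      have "insensitive_loss q lam (kernel_comb K 0 (fst (z t)) - snd (z t)) \<le> 1" if "t \<in> {1..T}" for t
      proof -
        have "insensitive_loss q lam (- snd (z t)) \<le> \<bar>- snd (z t)\<bar> powr q"
          using lam q by (intro insensitive_loss_le_powr) auto
        also have "\<dots> \<le> 1 powr q" using z(2)[OF that] q by (intro powr_mono2) auto
        finally show ?thesis by simp
      qed
      then have "real T * ?emp (kernel_comb K 0) \<le> (\<Sum>t=1..T. 1)" unfolding emp_sum by (rule sum_mono)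
      then show ?thesis using T0 by simp
    qed
    finally have "lam * (rkhs_norm X K F)\<^sup>2 \<le> 1" using R.L_nonneg[of F] by (simp add: R.risk_def)
    then show ?thesis using lam by (simp add: field_simps)
  qed
  have "(\<Sum>t=1..T. \<bar>snd (z t) - proj_unit F (fst (z t))\<bar> powr q) \<le>
      (\<Sum>t=1..T. insensitive_loss q lam (F (fst (z t)) - snd (z t)) + lip * lam)"
  proof (rule sum_mono)
    fix t assume t: "t \<in> {1..T}"
    let ?u = "proj_unit F (fst (z t)) - snd (z t)"
    have "\<bar>?u\<bar> powr q \<le> insensitive_loss q lam ?u + q * 2 powr (q - 1) * lam"
      using proj_unit_bound[of F "fst (z t)"] z(2)[OF t] q lam by (intro powr_le_insensitive_loss) auto
    also have "insensitive_loss q lam ?u \<le> insensitive_loss q lam (F (fst (z t)) - snd (z t))"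
      using z(2)[OF t] q by (intro insensitive_loss_mono proj_unit_closer) auto
    finally show "\<bar>snd (z t) - proj_unit F (fst (z t))\<bar> powr q \<le>
        insensitive_loss q lam (F (fst (z t)) - snd (z t)) + lip * lam"
      by (simp add: lip_def abs_minus_commute)
  qed
  also have "\<dots> = real T * (?emp F + lip * lam)" by (simp add: sum.distrib emp_sum distrib_left)
  also have "\<dots> \<le> real T * (?emp f\<^sub>q + lam * (rkhs_norm X K f\<^sub>q)\<^sup>2 + lip * lam)"
    using min[OF f\<^sub>q] lam by (intro mult_left_mono) (auto simp: R.risk_def intro: order_trans[rotated])
  also have "\<dots> = real T * ?emp f\<^sub>q + real T * lam * ((rkhs_norm X K f\<^sub>q)\<^sup>2 + lip)"
    by (simp add: algebra_simps)
  also have "real T * ?emp f\<^sub>q \<le> (\<Sum>t=1..T. \<bar>snd (z t) - f\<^sub>q (fst (z t))\<bar> powr q)"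
    unfolding emp_sum
    by (intro sum_mono, subst abs_minus_commute, intro insensitive_loss_le_powr) (use lam q in auto)
  finally show "(\<Sum>t=1..T. excess (proj_unit F) (z t)) \<le> real T * lam * ((rkhs_norm X K f\<^sub>q)\<^sup>2 + lip)"
    by (simp add: excess_def sum_subtractf)
qed

lemma sq_dist_perturb:
  assumes g: "g \<in> borel_measurable (restrict_space borel X)" "\<And>x. x \<in> X \<Longrightarrow> \<bar>g x\<bar> \<le> 1"
    and h: "h \<in> borel_measurable (restrict_space borel X)" "\<And>x. x \<in> X \<Longrightarrow> \<bar>h x\<bar> \<le> 1"
    and gh: "\<And>x. x \<in> X \<Longrightarrow> \<bar>h x - g x\<bar> \<le> r"
  shows "sq_dist h \<le> 2 * sq_dist g + 2 * r\<^sup>2"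
proof -
  interpret M: prob_space \<mu> by (rule prob_space_\<mu>)
  have ig: "integrable \<mu> (\<lambda>x. (g x - f\<^sub>q x)\<^sup>2)" by (rule integrable_sq[OF g(1)]) (rule g)
  have ih: "integrable \<mu> (\<lambda>x. (h x - f\<^sub>q x)\<^sup>2)" by (rule integrable_sq[OF h(1)]) (rule h)
  have "sq_dist h \<le> (\<integral>x. 2 * (g x - f\<^sub>q x)\<^sup>2 + 2 * r\<^sup>2 \<partial>\<mu>)"
    unfolding sq_dist_def
  proof (rule integral_mono[OF ih])
    fix x assume "x \<in> space \<mu>"
    then have x: "x \<in> X" by simp
    have "(h x - g x)\<^sup>2 \<le> r\<^sup>2" using gh[OF x] by (rule power2_le_iff_abs_le[THEN iffD2, rotated]) (use gh[OF x] in linarith)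
    moreover have "0 \<le> ((g x - f\<^sub>q x) - (h x - g x))\<^sup>2" by simp
    ultimately show "(h x - f\<^sub>q x)\<^sup>2 \<le> 2 * (g x - f\<^sub>q x)\<^sup>2 + 2 * r\<^sup>2"
      by (simp add: power2_eq_square algebra_simps)
  qed (use ig in simp)
  also have "\<dots> = 2 * sq_dist g + 2 * r\<^sup>2"
    using ig by (simp add: sq_dist_def M.prob_space[unfolded space_\<mu>])
  finally show ?thesis .
qed

text \<open>The functions differ by at most \<open>2\<close>, so for \<open>s \<ge> 2\<close> the \<open>s\<close>-th power is dominated by the square.\<close>

lemma Ls_norm_le:
  assumes g: "g \<in> borel_measurable (restrict_space borel X)" "\<And>x. x \<in> X \<Longrightarrow> \<bar>g x\<bar> \<le> 1" and s: "2 \<le> s"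
  shows "Ls_norm s \<mu> (\<lambda>x. g x - f\<^sub>q x) \<le> (2 powr (s - 2) * sq_dist g) powr (1 / s)"
proof -
  interpret M: prob_space \<mu> by (rule prob_space_\<mu>)
  note [measurable] = f\<^sub>q_measurable g(1)
  have ig: "integrable \<mu> (\<lambda>x. (g x - f\<^sub>q x)\<^sup>2)" by (rule integrable_sq[OF g(1)]) (rule g)
  have le: "\<bar>g x - f\<^sub>q x\<bar> powr s \<le> 2 powr (s - 2) * (g x - f\<^sub>q x)\<^sup>2" if x: "x \<in> X" for x
  proof (cases "g x = f\<^sub>q x")
    case False
    have "\<bar>g x - f\<^sub>q x\<bar> powr s = \<bar>g x - f\<^sub>q x\<bar> powr (s - 2) * \<bar>g x - f\<^sub>q x\<bar> powr 2"
      by (subst powr_add[symmetric]) simp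
    also have "\<dots> = \<bar>g x - f\<^sub>q x\<bar> powr (s - 2) * (g x - f\<^sub>q x)\<^sup>2" using False by (simp add: powr_numeral)
    also have "\<dots> \<le> 2 powr (s - 2) * (g x - f\<^sub>q x)\<^sup>2"
      using g(2)[OF x] f\<^sub>q_bound[OF x] s by (intro mult_right_mono powr_mono2) auto
    finally show ?thesis .
  qed (use s in simp)
  have int_s: "integrable \<mu> (\<lambda>x. \<bar>g x - f\<^sub>q x\<bar> powr s)"
    by (rule Bochner_Integration.integrable_bound[of _ "\<lambda>x. 2 powr (s - 2) * (g x - f\<^sub>q x)\<^sup>2"])
      (use ig le in auto)
  have "(\<integral>x. \<bar>g x - f\<^sub>q x\<bar> powr s \<partial>\<mu>) \<le> (\<integral>x. 2 powr (s - 2) * (g x - f\<^sub>q x)\<^sup>2 \<partial>\<mu>)"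
    using int_s ig le by (intro integral_mono) auto
  also have "\<dots> = 2 powr (s - 2) * sq_dist g" by (simp add: sq_dist_def)
  finally show ?thesis unfolding Ls_norm_def using s by (intro powr_mono2 integral_nonneg_AE) auto
qed

lemma error_event_measurable:
  assumes K: "mercer_kernel X K" and lam: "0 < lam"
  shows "{z \<in> space (PiM {1..T} (\<lambda>_. \<rho>)).
    Ls_norm s \<mu> (\<lambda>x. proj_unit (svr_estimator X K q lam lam T z) x - f\<^sub>q x) \<le> b} \<in> sets (PiM {1..T} (\<lambda>_. \<rho>))"
proof -
  interpret M: prob_space \<mu> by (rule prob_space_\<mu>)
  let ?P = "PiM {1..T} (\<lambda>_. \<rho>)"
  note [measurable] = f\<^sub>q_measurable
  have "(\<lambda>(z, x). svr_estimator X K q lam lam T z x) \<in> borel_measurable (?P \<Otimes>\<^sub>M \<mu>)"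
    using svr_estimator_measurable[OF K sets_\<rho> lam q] by (simp cong: measurable_cong_sets sets_pair_measure_cong)
  then have [measurable]: "(\<lambda>w. svr_estimator X K q lam lam T (fst w) (snd w)) \<in> borel_measurable (?P \<Otimes>\<^sub>M \<mu>)"
    by (simp add: case_prod_beta')
  have "(\<lambda>z. \<integral>x. \<bar>proj_unit (svr_estimator X K q lam lam T z) x - f\<^sub>q x\<bar> powr s \<partial>\<mu>) \<in> borel_measurable ?P"
    unfolding proj_unit_eq by measurable
  then have "(\<lambda>z. Ls_norm s \<mu> (\<lambda>x. proj_unit (svr_estimator X K q lam lam T z) x - f\<^sub>q x)) \<in> borel_measurable ?P"
    unfolding Ls_norm_def by measurable
  then show ?thesis by measurable
qed

text \<open>On the good event the excess loss of the net element nearest to the estimator is controlled; replacing one by the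
other costs \<open>1/T\<close>, which is at most \<open>\<lambda>\<close>.\<close>

theorem learning_rate:
  assumes X: "compact X" and K: "mercer_kernel X K" "smooth_kernel_on X K" and f\<^sub>q: "f\<^sub>q \<in> rkhs X K"
  shows "\<exists>C. \<forall>T::nat. \<forall>\<delta>. T \<ge> 1 \<longrightarrow> 0 < \<delta> \<longrightarrow> \<delta> < 1 \<longrightarrow>
    measure (PiM {1..T} (\<lambda>t. \<rho>)) {z \<in> space (PiM {1..T} (\<lambda>t. \<rho>)).
      Ls_norm (q + \<phi> + 1) \<mu> (\<lambda>x. proj_unit (svr_estimator X K q
          (real T powr (- ((q + \<phi> + 1) / (2 * (q + \<phi>))))) (real T powr (- ((q + \<phi> + 1) / (2 * (q + \<phi>))))) T z) x - f\<^sub>q x)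
        \<le> C * sqrt (ln (3 / \<delta>)) * real T powr (- (1 / (2 * (q + \<phi>))))} \<ge> 1 - \<delta>"
proof -
  define s where "s = q + \<phi> + 1"
  have s: "2 < s" using q \<phi> by (simp add: s_def)
  define \<alpha> where "\<alpha> = s / (2 * (q + \<phi>))"
  have \<alpha>: "0 < \<alpha>" "\<alpha> < 1" using q \<phi> by (auto simp: \<alpha>_def s_def field_simps)
  have p: "0 < 1 - \<alpha>" using \<alpha> by simp
  obtain C0 where C0: "0 \<le> C0" and net: "\<forall>T\<ge>1. \<exists>\<N>. finite \<N> \<and> \<N> \<subseteq> rkhs_ball X K (sqrt T) \<and>
      real (card \<N>) \<le> exp (C0 * T powr (1 - \<alpha>)) \<and>
      (\<forall>f\<in>rkhs_ball X K (sqrt T). \<exists>g\<in>\<N>. \<forall>x\<in>X. \<bar>f x - g x\<bar> \<le> 1 / T)"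
    using rkhs_ball_net[OF X K p] by (elim exE conjE)
  define c where "c = growth_const q \<phi>"
  have c: "0 < c" unfolding c_def by (rule growth_const_pos[OF q \<phi>])
  define D0 where "D0 = (rkhs_norm X K f\<^sub>q)\<^sup>2 + lip"
  have D0: "0 \<le> D0" using lip_pos by (simp add: D0_def)
  define C2 where "C2 = 4 / c * (D0 + lip + (C0 + 1) / chernoff_rate) + 2"
  have C2: "0 \<le> C2" using c D0 lip_pos C0 chernoff_rate_pos by (simp add: C2_def)
  define C where "C = (2 powr (s - 2) * C2) powr (1 / s)"
  have main: "measure (PiM {1..T} (\<lambda>t. \<rho>)) {z \<in> space (PiM {1..T} (\<lambda>t. \<rho>)).
      Ls_norm s \<mu> (\<lambda>x. proj_unit (svr_estimator X K q lam lam T z) x - f\<^sub>q x)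
        \<le> C * sqrt (ln (3 / \<delta>)) * real T powr (- (1 / (2 * (q + \<phi>))))} \<ge> 1 - \<delta>"
    if T: "T \<ge> 1" and \<delta>: "0 < \<delta>" "\<delta> < 1" and lam_def: "lam = real T powr (- \<alpha>)" for T :: nat and \<delta> lam
  proof -
    let ?P = "PiM {1..T} (\<lambda>_. \<rho>)"
    interpret P: prob_space ?P by (intro prob_space_PiM prob_space_axioms)
    have T1: "1 \<le> real T" using T by simp
    have lam: "0 < lam" using T by (simp add: lam_def)
    have Tlam: "1 / real T \<le> lam"
    proof -
      have "real T powr (-1) \<le> real T powr (- \<alpha>)" using T1 \<alpha> by (intro powr_mono) auto
      then show ?thesis using T1 by (simp add: lam_def powr_minus_divide)
    qed
    define l where "l = ln (3 / \<delta>)"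
    have l: "1 \<le> l" "ln (1 / \<delta>) \<le> l"
    proof -
      have "exp 1 \<le> (3 :: real)" by (rule exp_le)
      also have "3 \<le> 3 / \<delta>" using \<delta> by (simp add: field_simps)
      finally show "1 \<le> l" unfolding l_def using \<delta> by (simp add: ln_ge_iff)
      show "ln (1 / \<delta>) \<le> l" unfolding l_def using \<delta> by (intro ln_mono) (auto simp: field_simps)
    qed
    from net[THEN spec, THEN mp, OF T1] obtain \<N> where N: "finite \<N>" "\<N> \<subseteq> rkhs_ball X K (sqrt (real T))"
      "real (card \<N>) \<le> exp (C0 * real T powr (1 - \<alpha>))"
      "\<forall>f\<in>rkhs_ball X K (sqrt (real T)). \<exists>g\<in>\<N>. \<forall>x\<in>X. \<bar>f x - g x\<bar> \<le> 1 / real T"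
      by (elim exE conjE)
    have N_meas: "g \<in> borel_measurable (restrict_space borel X)" if "g \<in> \<N>" for g
      using N(2) that rkhs_measurable[OF K(1)] by (auto simp: rkhs_ball_def)
    \<comment> \<open>The slack that makes the union bound over the net at most \<open>\<delta>\<close>; divided by \<open>T\<close>, its first part is of order \<open>\<lambda>\<close>.\<close>
    define u where "u = (C0 * real T powr (1 - \<alpha>) + ln (1 / \<delta>)) / chernoff_rate"
    have fin: "finite (proj_unit ` \<N>)" using N(1) by simp
    have "\<exists>E\<in>sets ?P. measure ?P E \<ge> 1 - real (card (proj_unit ` \<N>)) * exp (- chernoff_rate * u) \<and>
      (\<forall>z\<in>E. (\<forall>t\<in>{1..T}. \<bar>snd (z t)\<bar> \<le> 1/2) \<and>
        (\<forall>g\<in>proj_unit ` \<N>. real T * expectation (excess g) / 2 - u \<le> (\<Sum>t=1..T. excess g (z t))))"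
      by (rule uniform_lower_tail[OF fin]) (use proj_unit_bound N_meas in auto)
    then obtain E where E: "E \<in> sets ?P"
      "measure ?P E \<ge> 1 - real (card (proj_unit ` \<N>)) * exp (- chernoff_rate * u)"
      and E_all: "\<forall>z\<in>E. (\<forall>t\<in>{1..T}. \<bar>snd (z t)\<bar> \<le> 1/2) \<and>
        (\<forall>g\<in>proj_unit ` \<N>. real T * expectation (excess g) / 2 - u \<le> (\<Sum>t=1..T. excess g (z t)))"
      by (elim bexE conjE)
    have E_bd: "\<bar>snd (z t)\<bar> \<le> 1/2" if "z \<in> E" "t \<in> {1..T}" for z t
      using E_all that by blast
    have E_net: "real T * expectation (excess (proj_unit g)) / 2 - u \<le> (\<Sum>t=1..T. excess (proj_unit g) (z t))"
      if "z \<in> E" "g \<in> \<N>" for z g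
      using E_all that by blast
    have "real (card (proj_unit ` \<N>)) * exp (- chernoff_rate * u) \<le> \<delta>"
    proof -
      have "real (card (proj_unit ` \<N>)) \<le> real (card \<N>)" using N(1) by (simp add: card_image_le)
      also have "\<dots> \<le> exp (C0 * real T powr (1 - \<alpha>))" by (rule N(3))
      finally have "real (card (proj_unit ` \<N>)) * exp (- chernoff_rate * u) \<le>
          exp (C0 * real T powr (1 - \<alpha>)) * exp (- chernoff_rate * u)" by (rule mult_right_mono) simp
      also have "\<dots> = exp (ln \<delta>)"
        using chernoff_rate_pos \<delta> by (simp add: u_def ln_div flip: exp_add)
      finally show ?thesis using \<delta> by simp
    qed
    then have PE: "1 - \<delta> \<le> measure ?P E" using E(2) by linarith
    have good: "Ls_norm s \<mu> (\<lambda>x. proj_unit (svr_estimator X K q lam lam T z) x - f\<^sub>q x)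
        \<le> C * sqrt l * real T powr (- (1 / (2 * (q + \<phi>))))" if z: "z \<in> E" for z
    proof -
      let ?F = "svr_estimator X K q lam lam T z"
      have zX: "fst (z t) \<in> X" if "t \<in> {1..T}" for t
        using sets.sets_into_space[OF E(1)] z that by (auto simp: space_PiM space_\<rho> PiE_iff mem_Times_iff)
      have sample: "\<forall>t\<in>{1..T}. fst (z t) \<in> X" "\<forall>t\<in>{1..T}. \<bar>snd (z t)\<bar> \<le> 1/2"
        using zX E_bd[OF z] by auto
      note est = estimator_excess_le[OF K(1) f\<^sub>q T lam sample]
      have F_meas: "?F \<in> borel_measurable (restrict_space borel X)" by (rule rkhs_measurable[OF K(1) est(1)])
      have "1 / lam \<le> real T" using Tlam lam T1 by (simp add: field_simps)
      then have "(rkhs_norm X K ?F)\<^sup>2 \<le> real T" using est(2) by linarith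
      then have "?F \<in> rkhs_ball X K (sqrt (real T))"
        using est(1) by (simp add: rkhs_ball_def real_le_rsqrt)
      then obtain g where g: "g \<in> \<N>" "\<And>x. x \<in> X \<Longrightarrow> \<bar>?F x - g x\<bar> \<le> 1 / real T" using N(4) by blast
      have near: "\<bar>proj_unit ?F x - proj_unit g x\<bar> \<le> 1 / real T" if "x \<in> X" for x
        using proj_unit_contraction[of ?F x g] g(2)[OF that] by linarith
      have "(\<Sum>t=1..T. excess (proj_unit g) (z t)) \<le> (\<Sum>t=1..T. excess (proj_unit ?F) (z t) + lip * (1 / real T))"
      proof (rule sum_mono)
        fix t assume t: "t \<in> {1..T}"
        have "\<bar>\<bar>snd (z t) - proj_unit g (fst (z t))\<bar> powr q - \<bar>snd (z t) - proj_unit ?F (fst (z t))\<bar> powr q\<bar>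
            \<le> lip * \<bar>proj_unit g (fst (z t)) - proj_unit ?F (fst (z t))\<bar>"
          using E_bd[OF z t] proj_unit_bound[of g "fst (z t)"] proj_unit_bound[of ?F "fst (z t)"]
          by (intro abs_loss_diff_le) linarith+
        also have "\<dots> \<le> lip * (1 / real T)"
          using near[OF zX[OF t]] lip_pos by (intro mult_left_mono) (auto simp: abs_minus_commute)
        finally show "excess (proj_unit g) (z t) \<le> excess (proj_unit ?F) (z t) + lip * (1 / real T)"
          unfolding excess_def by linarith
      qed
      also have "\<dots> = (\<Sum>t=1..T. excess (proj_unit ?F) (z t)) + lip" using T1 by (simp add: sum.distrib)
      also have "\<dots> \<le> real T * lam * D0 + lip" using est(3) by (simp add: D0_def)
      finally have "real T * expectation (excess (proj_unit g)) / 2 \<le> real T * lam * D0 + lip + u"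
        using E_net[OF z g(1)] by linarith
      then have "expectation (excess (proj_unit g)) \<le> 2 * (lam * D0 + (lip + u) / real T)"
        using T1 by (simp add: field_simps)
      moreover have "c * sq_dist (proj_unit g) \<le> expectation (excess (proj_unit g))"
        unfolding c_def using N_meas[OF g(1)] proj_unit_bound by (intro expectation_excess_ge) auto
      ultimately have sqg: "sq_dist (proj_unit g) \<le> 2 / c * (lam * D0 + (lip + u) / real T)"
        using c by (simp add: field_simps)
      \<comment> \<open>Here \<open>T powr (1 - \<alpha>) / T = \<lambda>\<close>, which is the reason for applying the net with \<open>p = 1 - \<alpha>\<close>.\<close>
      have uT: "(lip + u) / real T \<le> (lip + (C0 + 1) / chernoff_rate) * (l * lam)"
      proof -
        have "real T powr (1 - \<alpha>) / real T = lam" using T1 by (simp add: lam_def powr_diff powr_minus_divide)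
        then have "u / real T = (C0 * lam + ln (1 / \<delta>) * (1 / real T)) / chernoff_rate"
          by (simp add: u_def add_divide_distrib) (metis mult.commute times_divide_eq_right divide_divide_eq_left)
        also have "\<dots> \<le> (C0 * (l * lam) + l * lam) / chernoff_rate"
        proof (intro divide_right_mono add_mono mult_left_mono mult_mono)
          show "lam \<le> l * lam" using l lam by simp
        qed (use l lam C0 Tlam chernoff_rate_pos in auto)
        also have "\<dots> = (C0 + 1) / chernoff_rate * (l * lam)" by (simp add: algebra_simps add_divide_distrib)
        finally have 1: "u / real T \<le> (C0 + 1) / chernoff_rate * (l * lam)" .
        have "1 / real T \<le> l * lam" using mult_mono[OF l(1) Tlam] l lam by simp
        then have "lip * (1 / real T) \<le> lip * (l * lam)" using lip_pos by (intro mult_left_mono) auto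
        with 1 show ?thesis by (simp add: add_divide_distrib distrib_right)
      qed
      have "sq_dist (proj_unit ?F) \<le> 2 * sq_dist (proj_unit g) + 2 * (1 / real T)\<^sup>2"
        using N_meas[OF g(1)] F_meas proj_unit_bound near by (intro sq_dist_perturb) auto
      also have "\<dots> \<le> 4 / c * (D0 * (l * lam) + (lip + (C0 + 1) / chernoff_rate) * (l * lam)) + 2 * (l * lam)"
      proof (rule add_mono)
        have "lam * D0 \<le> D0 * (l * lam)" using l lam D0 by (simp add: mult_le_cancel_left1 mult.commute mult_left_mono)
        then have "2 / c * (lam * D0 + (lip + u) / real T) \<le>
            2 / c * (D0 * (l * lam) + (lip + (C0 + 1) / chernoff_rate) * (l * lam))"
          using uT c by (intro mult_left_mono add_mono) auto
        then show "2 * sq_dist (proj_unit g) \<le> 4 / c * (D0 * (l * lam) + (lip + (C0 + 1) / chernoff_rate) * (l * lam))"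
        proof -
          have double: "4 / c * y = 2 * (2 / c * y)" for y by simp
          assume "2 / c * (lam * D0 + (lip + u) / real T) \<le>
            2 / c * (D0 * (l * lam) + (lip + (C0 + 1) / chernoff_rate) * (l * lam))"
          with sqg show ?thesis unfolding double by linarith
        qed
        have "(1 / real T)\<^sup>2 \<le> 1 / real T" using T1 by (simp add: power2_eq_square field_simps)
        also have "\<dots> \<le> l * lam" using mult_mono[OF l(1) Tlam] l lam by simp
        finally show "2 * (1 / real T)\<^sup>2 \<le> 2 * (l * lam)" by simp
      qed
      also have "\<dots> = C2 * (l * lam)" by (simp only: C2_def distrib_right distrib_left add.assoc mult.assoc)
      finally have sq: "sq_dist (proj_unit ?F) \<le> C2 * (l * lam)" .
      have "0 \<le> sq_dist (proj_unit ?F)" unfolding sq_dist_def by (rule integral_nonneg_AE) simp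
      have "Ls_norm s \<mu> (\<lambda>x. proj_unit ?F x - f\<^sub>q x) \<le> (2 powr (s - 2) * sq_dist (proj_unit ?F)) powr (1 / s)"
        using F_meas proj_unit_bound s by (intro Ls_norm_le) auto
      also have "\<dots> \<le> (2 powr (s - 2) * (C2 * (l * lam))) powr (1 / s)"
        using sq s \<open>0 \<le> sq_dist (proj_unit ?F)\<close> by (intro powr_mono2 mult_left_mono) auto
      also have "\<dots> = ((2 powr (s - 2) * C2) * l * lam) powr (1 / s)" by (simp add: mult.assoc)
      also have "\<dots> = C * l powr (1 / s) * lam powr (1 / s)"
        using C2 l lam by (simp add: powr_mult C_def)
      also have "lam powr (1 / s) = real T powr (- (1 / (2 * (q + \<phi>))))"
      proof -
        have "- \<alpha> * (1 / s) = - (1 / (2 * (q + \<phi>)))" using s by (simp add: \<alpha>_def)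
        then show ?thesis by (simp add: lam_def powr_powr)
      qed
      also have "C * l powr (1 / s) * real T powr (- (1 / (2 * (q + \<phi>)))) \<le>
          C * sqrt l * real T powr (- (1 / (2 * (q + \<phi>))))"
      proof (intro mult_right_mono mult_left_mono)
        have "l powr (1 / s) \<le> l powr (1 / 2)" using l s by (intro powr_mono) (auto simp: field_simps)
        then show "l powr (1 / s) \<le> sqrt l" using l by (simp add: powr_half_sqrt)
      qed (auto simp: C_def)
      finally show ?thesis .
    qed
    let ?S = "{z \<in> space ?P. Ls_norm s \<mu> (\<lambda>x. proj_unit (svr_estimator X K q lam lam T z) x - f\<^sub>q x)
        \<le> C * sqrt l * real T powr (- (1 / (2 * (q + \<phi>))))}"
    have "E \<subseteq> ?S" using good sets.sets_into_space[OF E(1)] by auto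
    then have "measure ?P E \<le> measure ?P ?S"
      by (intro P.finite_measure_mono error_event_measurable[OF K(1) lam])
    then show ?thesis using PE by (simp add: l_def)
  qed
  show ?thesis
    by (rule exI[of _ C]) (use main in \<open>simp add: s_def \<alpha>_def\<close>)
qed

end

theorem theorem1:
  fixes X :: "(real ^ 'n) set"
    and K :: "real ^ 'n \<Rightarrow> real ^ 'n \<Rightarrow> real"
    and \<rho> :: "((real ^ 'n) \<times> real) measure"
    and \<kappa> :: "real ^ 'n \<Rightarrow> real measure"
    and f\<^sub>q :: "real ^ 'n \<Rightarrow> real"
    and q \<phi> :: real
  assumes "compact X"
    and "mercer_kernel X K"
    and "smooth_kernel_on X K"
    and "q > 1"
    and "borel_prob_on (X \<times> UNIV) \<rho>"
    and "conditional_distributions X \<rho> \<kappa>"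
    and "is_q_minimizer X q \<rho> \<kappa> f\<^sub>q"
    and "f\<^sub>q \<in> rkhs X K"
    and "\<forall>x\<in>X. \<bar>f\<^sub>q x\<bar> \<le> 1 / 4"
    and "\<phi> > 0"
    and "\<forall>x\<in>X. \<kappa> x = density lborel (\<lambda>y. ennreal
           (if \<bar>y - f\<^sub>q x\<bar> \<le> 1 / 4
            then (2 powr (2 * \<phi> + 1) * (\<phi> + 1)) * \<bar>y - f\<^sub>q x\<bar> powr \<phi> else 0))"
  shows "\<exists>C'::real. \<forall>T::nat. \<forall>lam \<epsilon> \<delta> :: real.
           T \<ge> 1 \<longrightarrow>
           lam = real T powr (- ((q + \<phi> + 1) / (2 * (q + \<phi>)))) \<longrightarrow> \<epsilon> = lam \<longrightarrow>
           0 < \<delta> \<longrightarrow> \<delta> < 1 \<longrightarrow>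
           measure (PiM {1..T} (\<lambda>t. \<rho>))
             {z \<in> space (PiM {1..T} (\<lambda>t. \<rho>)).
                Ls_norm (q + \<phi> + 1) (marginal_X X \<rho>)
                    (\<lambda>x. proj_unit (svr_estimator X K q \<epsilon> lam T z) x - f\<^sub>q x)
                  \<le> C' * sqrt (ln (3 / \<delta>)) * real T powr (- (1 / (2 * (q + \<phi>))))}
             \<ge> 1 - \<delta>"
proof -
  interpret regression_model X \<rho> \<kappa> f\<^sub>q q \<phi>
    using assms rkhs_measurable[OF assms(2,8)] by unfold_locales (auto simp: noise_density_def)
  obtain C where "\<forall>T::nat. \<forall>\<delta>. T \<ge> 1 \<longrightarrow> 0 < \<delta> \<longrightarrow> \<delta> < 1 \<longrightarrow>
    measure (PiM {1..T} (\<lambda>t. \<rho>)) {z \<in> space (PiM {1..T} (\<lambda>t. \<rho>)).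
      Ls_norm (q + \<phi> + 1) (marginal_X X \<rho>) (\<lambda>x. proj_unit (svr_estimator X K q
          (real T powr (- ((q + \<phi> + 1) / (2 * (q + \<phi>))))) (real T powr (- ((q + \<phi> + 1) / (2 * (q + \<phi>))))) T z) x - f\<^sub>q x)
        \<le> C * sqrt (ln (3 / \<delta>)) * real T powr (- (1 / (2 * (q + \<phi>))))} \<ge> 1 - \<delta>"
    using learning_rate[OF assms(1,2,3,8)] by (elim exE)
  then show ?thesis by (intro exI[of _ C] allI impI) simp
qed

end
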